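(* Let $\ell,n\ge 1$ be integers, and let the sign $\pm$ be fixed to be either $-$ or $+$ throughout. Let $M\in\mathcal{M}_\pm^{\ell\to n}$ and let $m:=\dim\operatorname{supp}M$. Let $\mathcal{X}\subseteq\mathbb{R}^\ell$ be a set such that: in the $-$ case, $\mathcal{X}\subseteq\mathbb{X}_-^\ell$; in the $+$ case, $\mathcal{X}\subseteq\mathbb{X}_+^\ell$ and $\mathcal{X}$ is $\mathbf{u}_\ell/2$-symmetric. If $\mathcal{X}$ is observationally complete for $M$ with respect to $\mathbb{X}_\pm^\ell$, then for every $L\in\mathcal{M}_\pm^{\ell\to m}$ such that $M^+M=L^+L$ and $L\,\mathbb{X}_\pm^\ell=\mathbb{X}_\pm^m$, the set $L\mathcal{X}\subseteq\mathbb{R}^m$ supports a spherical $2$-design.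
   Context: Notation. $\mathbb{R}^{\ell\to n}$ is the set of linear maps $\mathbb{R}^\ell\to\mathbb{R}^n$ (real $n\times\ell$ matrices). $M^+$ is the Moore-Penrose pseudoinverse, and $\operatorname{supp}M=(\ker M)^\perp$, so $M^+M$ is the orthogonal projector onto $\operatorname{supp}M$. For a set $S$, $MS=\{Mx: x\in S\}$. $|\cdot|_2$ is the Euclidean norm. For every $k\ge 1$ a nonzero vector $\mathbf{u}_k\in\mathbb{R}^k$ is fixed once and for all, and $\hat{\mathbf{u}}_k=\mathbf{u}_k/|\mathbf{u}_k|_2$. Classes of maps. $\mathcal{M}_+^{\ell\to n}=\{M\in\mathbb{R}^{\ell\to n}: M\mathbf{u}_\ell=\mathbf{u}_n\}$ and $\mathcal{M}_-^{\ell\to n}=\{M\in\mathbb{R}^{\ell\to n}: M^T\mathbf{u}_n=\mathbf{u}_\ell\}$. State and effect spaces. For every dimension $\ell$ and $\mathbf{v}\in\mathbb{R}^\ell$ let $g(\mathbf{v})=|\mathbf{v}|_2-\sqrt2\,\hat{\mathbf{u}}_\ell\cdot\mathbf{v}$. Then $\mathbb{X}_-^\ell=\{\mathbf{v}\in\mathbb{R}^\ell: g(\mathbf{v})\le 0,\ \mathbf{u}_\ell\cdot\mathbf{v}=1\}$ (spherical state space) and $\mathbb{X}_+^\ell=\{\mathbf{v}\in\mathbb{R}^\ell: g(\mathbf{v})\le0,\ g(\mathbf{u}_\ell-\mathbf{v})\le 0\}$ (conical effect space). A set $\mathcal{X}\subseteq\mathbb{R}^\ell$ is $\mathbf{u}_\ell/2$-symmetric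 if $\mathbf{v}\in\mathcal{X}$ implies $\mathbf{u}_\ell-\mathbf{v}\in\mathcal{X}$. Data-driven inference. For $S\subseteq\mathbb{R}^n$, $\operatorname{vol}(S)$ is the Euclidean volume of $S$ within its affine hull $\operatorname{aff}S$. For $\mathbb{X}\subseteq\mathbb{R}^\ell$ and $\mathcal{Y}\subseteq\mathbb{R}^n$ let $\mathcal{L}_\pm(\mathcal{Y}|\mathbb{X})=\{K\in\mathcal{M}_\pm^{\ell\to n}: \mathcal{Y}\subseteq K\mathbb{X}\subseteq\operatorname{span}\mathcal{Y}\}$. Then $\mathtt{ddi}_\pm(\mathcal{Y}|\mathbb{X})$ is the set of all images $K\mathbb{X}$, where $K$ ranges over the minimizers of $\operatorname{vol}(K\mathbb{X})$ over $K\in\mathcal{L}_\pm(\mathcal{Y}|\mathbb{X})$. Observational completeness. A set $\mathcal{X}\subseteq\mathbb{X}\subseteq\mathbb{R}^\ell$ is observationally complete for $M\in\mathcal{M}_\pm^{\ell\to n}$ with respect to $\mathbb{X}$ if $\mathtt{ddi}_\pm(M\mathcal{X}|\mathbb{X})=\{M\mathbb{X}\}$. Spherical designs. Let $\{p_k\}$ be a probability distribution over vectors $\mathbf{v}_k\in\mathbb{R}^m$ with $\mathbf{v}_k\cdot\mathbf{u}_m=1$ for all $k$. Then $\{p_k,\mathbf{v}_k\}$ is a spherical $t$-design if $\sum_k p_k\mathbf{v}_k^{\otimes t}=\int dO\,(O\mathbf{v})^{\otimes t}$ for any $\mathbf{v}$ on the boundary sphere $\{\mathbf{v}\in\mathbb{R}^m:\mathbf{u}_m\cdot\mathbf{v}=1,\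 g(\mathbf{v})=0\}$ of $\mathbb{X}_-^m$, where $dO$ is the normalized Haar measure on the symmetry group of $\mathbb{X}_-^m$, i.e. the group of orthogonal $m\times m$ matrices $O$ with $O\mathbf{u}_m=\mathbf{u}_m$. A set $S\subseteq\mathbb{R}^m$ supports a spherical $t$-design if there are finitely many $\mathbf{v}_k\in S$ with $\mathbf{u}_m\cdot\mathbf{v}_k\neq0$ and a probability distribution $\{p_k\}$ such that $\{p_k,\tilde{\mathbf{v}}_k\}$ is a spherical $t$-design, where $\tilde{\mathbf{v}}_k=(\mathbf{u}_m\cdot\mathbf{v}_k)^{-1}\mathbf{v}_k$.
   Formalization: The set of nonnegative multiples of elements of X is additionally assumed closed (in the − case: X closed); without this the claim fails, e.g. for ℓ=n=2, M=L=identity and X the relative interior of the segment X_-^2. *)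

theory Defs
  imports "HOL-Analysis.Analysis"
begin

text \<open>
  \<open>\<real>\<^sup>k\<close> is \<^typ>\<open>real^'k\<close>, with \<open>k = CARD('k)\<close>. The distinguished nonzero vector of each space
  is passed to the definitions as an explicit argument \<open>u\<close>, or \<open>ul\<close> for the source
  and \<open>un\<close> for the target of a map.
\<close>

datatype sign = Minus | Plus

definition sign_maps :: "sign \<Rightarrow> real^'l \<Rightarrow> real^'n \<Rightarrow> (real^'l^'n) set" where
  "sign_maps s ul un =
     (case s of Minus \<Rightarrow> {M. transpose M *v un = ul} | Plus \<Rightarrow> {M. M *v ul = un})"

definition pinv :: "real^'l^'n \<Rightarrow> real^'n^'l" where
  "pinv M = (THE P. M ** P ** M = M \<and> P ** M ** P = P \<and>
                    transpose (M ** P) = M ** P \<and> transpose (P ** M) = P ** M)"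

definition supp :: "real^'l^'n \<Rightarrow> (real^'l) set" where
  "supp M = orthogonal_comp {x. M *v x = 0}"

definition cone_fun :: "real^'l \<Rightarrow> real^'l \<Rightarrow> real" where
  "cone_fun u v = norm v - sqrt 2 * ((u /\<^sub>R norm u) \<bullet> v)"

definition state_space :: "real^'l \<Rightarrow> (real^'l) set" where
  "state_space u = {v. cone_fun u v \<le> 0 \<and> u \<bullet> v = 1}"

definition effect_space :: "real^'l \<Rightarrow> (real^'l) set" where
  "effect_space u = {v. cone_fun u v \<le> 0 \<and> cone_fun u (u - v) \<le> 0}"

definition sign_space :: "sign \<Rightarrow> real^'l \<Rightarrow> (real^'l) set" where
  "sign_space s u = (case s of Minus \<Rightarrow> state_space u | Plus \<Rightarrow> effect_space u)"

definition half_unit_symmetric :: "real^'l \<Rightarrow> (real^'l) set \<Rightarrow> bool" where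
  "half_unit_symmetric u X \<longleftrightarrow> (\<forall>v\<in>X. u - v \<in> X)"

definition aff_direction :: "'a::euclidean_space set \<Rightarrow> 'a set" where
  "aff_direction S = {x - y | x y. x \<in> affine hull S \<and> y \<in> affine hull S}"

text \<open>
  Volume within the affine hull: Lebesgue measure (of dimension \<^term>\<open>aff_dim S\<close>) of \<open>S\<close> in
  orthonormal coordinates of \<^term>\<open>affine hull S\<close>. Neither the basis \<open>B\<close> nor the origin \<open>p\<close>
  matters, by invariance of Lebesgue measure under isometries; a single point has volume 1.
\<close>

definition aff_basis :: "'a::euclidean_space set \<Rightarrow> 'a set" where
  "aff_basis S = (SOME B. pairwise orthogonal B \<and> (\<forall>b\<in>B. norm b = 1) \<and>
                          span B = aff_direction S)"

definition aff_origin :: "'a::euclidean_space set \<Rightarrow> 'a" where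
  "aff_origin S = (SOME p. p \<in> affine hull S)"

definition aff_vol :: "'a::euclidean_space set \<Rightarrow> ennreal" where
  "aff_vol S = (let B = aff_basis S; p = aff_origin S in
     emeasure (completion (Pi\<^sub>M B (\<lambda>_. lborel)))
       {c \<in> PiE B (\<lambda>_. UNIV). p + (\<Sum>b\<in>B. c b *\<^sub>R b) \<in> S})"

definition feasible_maps ::
    "sign \<Rightarrow> real^'l \<Rightarrow> real^'n \<Rightarrow> (real^'n) set \<Rightarrow> (real^'l) set \<Rightarrow> (real^'l^'n) set" where
  "feasible_maps s ul un Y XX =
     {K \<in> sign_maps s ul un. Y \<subseteq> (*v) K ` XX \<and> (*v) K ` XX \<subseteq> span Y}"

definition ddi ::
    "sign \<Rightarrow> real^'l \<Rightarrow> real^'n \<Rightarrow> (real^'n) set \<Rightarrow> (real^'l) set \<Rightarrow> (real^'n) set set" where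
  "ddi s ul un Y XX =
     {(*v) K ` XX | K. is_arg_min (\<lambda>K. aff_vol ((*v) K ` XX)) (\<lambda>K. K \<in> feasible_maps s ul un Y XX) K}"

definition obs_complete ::
    "sign \<Rightarrow> real^'l \<Rightarrow> real^'n \<Rightarrow> (real^'l) set \<Rightarrow> real^'l^'n \<Rightarrow> (real^'l) set \<Rightarrow> bool" where
  "obs_complete s ul un XX M X \<longleftrightarrow>
     X \<subseteq> XX \<and> ddi s ul un ((*v) M ` X) XX = {(*v) M ` XX}"

definition sym_group :: "real^'m \<Rightarrow> (real^'m^'m) set" where
  "sym_group u = {Q. orthogonal_matrix Q \<and> Q *v u = u}"

text \<open>The normalized left Haar measure of a compact matrix group, on its Borel sets.\<close>

definition haar :: "(real^'m^'m) set \<Rightarrow> (real^'m^'m) measure" where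
  "haar G = (THE \<mu>. sets \<mu> = sets (restrict_space borel G) \<and> emeasure \<mu> (space \<mu>) = 1 \<and>
                    (\<forall>Q\<in>G. \<forall>A\<in>sets \<mu>. emeasure \<mu> ((**) Q ` A) = emeasure \<mu> A))"

definition boundary_sphere :: "real^'m \<Rightarrow> (real^'m) set" where
  "boundary_sphere u = {v. u \<bullet> v = 1 \<and> cone_fun u v = 0}"

text \<open>
  \<^term>\<open>tensor_power t v i\<close> is the component of the \<open>t\<close>-fold tensor power of \<open>v\<close> at the
  multi-index \<open>(i 0, ..., i (t - 1))\<close>; equations between tensors are read componentwise.
\<close>

definition tensor_power :: "nat \<Rightarrow> real^'m \<Rightarrow> (nat \<Rightarrow> 'm) \<Rightarrow> real" where
  "tensor_power t v i = (\<Prod>j<t. v $ i j)"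

definition spherical_design ::
    "real^'m \<Rightarrow> nat \<Rightarrow> nat \<Rightarrow> (nat \<Rightarrow> real) \<Rightarrow> (nat \<Rightarrow> real^'m) \<Rightarrow> bool" where
  "spherical_design u t N p v \<longleftrightarrow>
     (\<forall>k<N. 0 \<le> p k) \<and> (\<Sum>k<N. p k) = 1 \<and> (\<forall>k<N. v k \<bullet> u = 1) \<and>
     (\<forall>w\<in>boundary_sphere u. \<forall>i.
        (\<Sum>k<N. p k * tensor_power t (v k) i) =
        (LINT Q|haar (sym_group u). tensor_power t (Q *v w) i))"

definition supports_design :: "real^'m \<Rightarrow> nat \<Rightarrow> (real^'m) set \<Rightarrow> bool" where
  "supports_design u t S \<longleftrightarrow>
     (\<exists>N p v. (\<forall>k<N. v k \<in> S \<and> u \<bullet> v k \<noteq> 0) \<and>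
              spherical_design u t N p (\<lambda>k. v k /\<^sub>R (u \<bullet> v k)))"

end

theory Submission
  imports Defs "HOL-Probability.Infinite_Product_Measure"
begin

text \<open>
  Since \<open>M\<close> and \<open>L\<close> have the same kernel, \<open>M = N L\<close> with \<open>N\<close> injective, and a linear \<open>T\<close> on
  \<open>\<real>\<^sup>m\<close> that preserves the class of maps, with \<open>L X \<subseteq> T \<X>\<^sup>m\<close> for \<open>\<X>\<^sup>m\<close> the standard space of \<open>\<real>\<^sup>m\<close>,
  is such that \<open>N T L\<close> competes with \<open>M\<close>; its image has \<open>\<bar>det T\<bar>\<close> times the volume.
  By Haar invariance, \<open>L X\<close> supports a spherical 2-design iff an explicit matrix lies
  in the convex hull of the \<open>v v\<^sup>T\<close>, for \<open>v\<close> the normalized nonzero elements of \<open>L X\<close>. If it does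
  not, a separating hyperplane is a symmetric matrix \<open>H\<close> that is positive on \<open>L X - {0}\<close> and has
  negative inner product with the explicit matrix. As in John's theorem on the ellipsoid of least
  volume, moving the quadratic form of the cone in the direction of \<open>H\<close> gives such a \<open>T\<close> with
  \<open>\<bar>det T\<bar> < 1\<close>.
  Closedness of the cone over \<open>X\<close> makes the separation strict.
\<close>

section \<open>Linear images of Lebesgue measure\<close>

text \<open>The two signs constrain T differently: in the - case it must preserve the functional v
  -> u . v, in the + case it must fix the vector u. With e = u/|u|, q(v) = 2 (e . v)^2 - |v|^2 and k
  orthogonal to e, the motions v -> -(e . v) k and v -> (k . v) e change q in the same way to first
  order: they differ by the infinitesimal boost v -> (e . v) k + (k . v) e, which preserves q. So
  one H yields an admissible motion for either sign, with the same trace. In the + case, the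
  symmetry of X under v -> u - v turns one cone inequality into the two that define the effect
  space.

  The proofs work with the inverse Q of T, because "Q L x lies in the standard space" is a pointwise
  inequality. Hence Q expands, and to first order its determinant is given by a trace.

  \<open>haar\<close> and \<open>pinv\<close> are definite descriptions and say something only once
  existence and uniqueness are proved; this is why a Haar measure is constructed.
  \<open>aff_vol\<close> chooses its coordinates by \<open>SOME\<close>, but from the affine hull
  alone, so all images that are compared share them. Dimension 1 is separate: there nothing but 0 is
  orthogonal to e.\<close>

text \<open>The formula for \<^const>\<open>lebesgue\<close> measure of linear images in the library needs a well-ordered
  index type, so it is transported from this copy of the index type.\<close>

typedef 'a indexed = "UNIV :: 'a set" morphisms of_indexed to_indexed by simp

instance indexed :: (finite) finite
proof
  have "(UNIV :: 'a indexed set) = range to_indexed"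
    by (metis of_indexed_inverse surj_def)
  then show "finite (UNIV :: 'a indexed set)"
    by (metis finite finite_imageI)
qed

instantiation indexed :: (finite) wellorder
begin
definition "a \<le> b \<longleftrightarrow> to_nat (of_indexed a) \<le> to_nat (of_indexed b)"
definition "a < b \<longleftrightarrow> to_nat (of_indexed a) < to_nat (of_indexed b)"
instance
proof
  show "P a" if "\<And>x. (\<And>y. y < x \<Longrightarrow> P y) \<Longrightarrow> P x" for P and a :: "'a indexed"
    by (induction a rule: measure_induct_rule[where f = "\<lambda>x. to_nat (of_indexed x)"])
       (use that less_indexed_def in blast)
qed (auto simp: less_eq_indexed_def less_indexed_def of_indexed_inject)
end

lemma bij_to_indexed: "bij to_indexed" and bij_of_indexed: "bij of_indexed"
  by (rule o_bij[of of_indexed], auto simp: to_indexed_inverse of_indexed_inverse)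
     (rule o_bij[of to_indexed], auto simp: to_indexed_inverse of_indexed_inverse)

text \<open>Boxes pull back to boxes with the same side lengths in another order, and
  \<open>lborel\<close> is determined by boxes. Source and target have different types, so such a
  map has no determinant.\<close>

lemma distr_lborel_permute_basis:
  fixes f :: "'a::euclidean_space \<Rightarrow> 'b::euclidean_space"
  assumes f [measurable]: "f \<in> borel_measurable borel"
    and p: "bij_betw p Basis Basis"
    and fp: "\<And>x b. b \<in> Basis \<Longrightarrow> f x \<bullet> b = x \<bullet> p b"
  shows "distr lborel borel f = lborel"
proof (rule lborel_eqI[symmetric])
  fix l u :: 'b assume lu: "\<And>b. b \<in> Basis \<Longrightarrow> l \<bullet> b \<le> u \<bullet> b"
  define q where "q = inv_into Basis p"
  define t where "t v = (\<Sum>b\<in>Basis. (v \<bullet> q b) *\<^sub>R b)" for v :: 'b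
  have t: "t v \<bullet> b = v \<bullet> q b" if "b \<in> Basis" for v b
    using that by (simp add: t_def)
  have qp: "q (p b) = b" if "b \<in> Basis" for b
    using that p by (simp add: q_def bij_betw_inv_into_left)
  have "f -` box l u = box (t l) (t u)"
  proof -
    have tp: "t v \<bullet> p b = v \<bullet> b" if "b \<in> Basis" for v b
      using that p by (simp add: t qp bij_betw_apply)
    have "(\<forall>b\<in>Basis. l \<bullet> b < f x \<bullet> b \<and> f x \<bullet> b < u \<bullet> b) \<longleftrightarrow>
          (\<forall>b\<in>p ` Basis. t l \<bullet> b < x \<bullet> b \<and> x \<bullet> b < t u \<bullet> b)" for x
      by (simp add: fp tp)
    then have "(\<forall>b\<in>Basis. l \<bullet> b < f x \<bullet> b \<and> f x \<bullet> b < u \<bullet> b) \<longleftrightarrow>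
          (\<forall>b\<in>Basis. t l \<bullet> b < x \<bullet> b \<and> x \<bullet> b < t u \<bullet> b)" for x
      by (simp only: bij_betw_imp_surj_on[OF p])
    then show ?thesis by (auto simp: mem_box)
  qed
  then have "emeasure (distr lborel borel f) (box l u) = emeasure lborel (box (t l) (t u))"
    by (simp add: emeasure_distr)
  also have "\<dots> = (\<Prod>b\<in>Basis. (t u - t l) \<bullet> b)"
    using lu p by (intro emeasure_lborel_box) (auto simp: t q_def bij_betw_def inv_into_into)
  also have "(\<Prod>b\<in>Basis. (t u - t l) \<bullet> b) = (\<Prod>b\<in>Basis. (t u - t l) \<bullet> p b)"
    using p by (rule prod.reindex_bij_betw[symmetric])
  also have "\<dots> = (\<Prod>b\<in>Basis. (u - l) \<bullet> b)"
    using p by (intro prod.cong) (auto simp: inner_diff_left t qp bij_betw_apply)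
  finally show "emeasure (distr lborel borel f) (box l u) = (\<Prod>b\<in>Basis. (u - l) \<bullet> b)" .
qed simp

definition index_vec :: "real^'m \<Rightarrow> real^('m::finite) indexed" where
  "index_vec x = (\<chi> i. x $ of_indexed i)"

definition unindex_vec :: "real^('m::finite) indexed \<Rightarrow> real^'m" where
  "unindex_vec x = (\<chi> i. x $ to_indexed i)"

lemma index_vec_inverse [simp]: "unindex_vec (index_vec x) = x" "index_vec (unindex_vec y) = y"
  by (simp_all add: index_vec_def unindex_vec_def vec_eq_iff to_indexed_inverse of_indexed_inverse)

lemma linear_index_vec: "linear index_vec" and linear_unindex_vec: "linear unindex_vec"
  by (auto intro!: linearI simp: index_vec_def unindex_vec_def vec_eq_iff)

lemma inj_conj_index_vec: "inj (index_vec \<circ> f \<circ> unindex_vec) \<longleftrightarrow> inj f"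
proof
  assume "inj (index_vec \<circ> f \<circ> unindex_vec)"
  then have "inj ((index_vec \<circ> f \<circ> unindex_vec) \<circ> index_vec)"
    by (rule inj_compose) (rule inj_on_inverseI[of _ unindex_vec], simp)
  then show "inj f"
    by (simp add: inj_def)
next
  assume "inj f"
  then show "inj (index_vec \<circ> f \<circ> unindex_vec)"
    by (intro inj_compose) (rule inj_on_inverseI[of _ unindex_vec], simp, assumption, rule inj_on_inverseI[of _ index_vec], simp)
qed

lemma borel_measurable_linear:
  fixes f :: "'a::euclidean_space \<Rightarrow> 'b::euclidean_space"
  shows "linear f \<Longrightarrow> f \<in> borel_measurable borel"
  by (simp add: borel_measurable_continuous_onI linear_continuous_on linear_linear)

lemma image_inverse_eq_vimage:
  assumes "\<And>x. h (g x) = x" "\<And>y. g (h y) = y"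
  shows "g ` S = h -` S"
  using assms by (auto simp: image_iff) metis

lemma index_vec_image:
  assumes S: "S \<in> sets borel"
  shows "index_vec ` S \<in> sets borel" "emeasure lborel (index_vec ` S) = emeasure lborel S"
proof -
  have [measurable]: "unindex_vec \<in> borel_measurable borel"
    by (rule borel_measurable_linear[OF linear_unindex_vec])
  have eq: "index_vec ` S = unindex_vec -` S"
    by (rule image_inverse_eq_vimage) simp_all
  show "index_vec ` S \<in> sets borel"
    unfolding eq using measurable_sets_borel[of unindex_vec borel S] S by simp
  have "distr lborel borel unindex_vec = (lborel :: (real^'a) measure)"
  proof (rule distr_lborel_permute_basis)
    show "bij_betw (\<lambda>b::real^'a. index_vec b) Basis Basis"
    proof (rule bij_betw_byWitness[where f' = unindex_vec])
      show "index_vec ` (Basis::(real^'a) set) \<subseteq> Basis"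
      proof
        fix y assume "y \<in> index_vec ` (Basis::(real^'a) set)"
        then obtain i where "y = index_vec (axis i (1::real))"
          by (auto simp: Basis_vec_def)
        then have "y = axis (to_indexed i) 1"
          by (auto simp: index_vec_def vec_eq_iff axis_def to_indexed_inverse of_indexed_inverse)
        then show "y \<in> Basis" by (auto simp: Basis_vec_def)
      qed
      show "unindex_vec ` Basis \<subseteq> (Basis::(real^'a) set)"
      proof
        fix y :: "real^'a" assume "y \<in> unindex_vec ` Basis"
        then obtain i where "y = unindex_vec (axis i (1::real))"
          by (auto simp: Basis_vec_def)
        then have "y = axis (of_indexed i) 1"
          by (auto simp: unindex_vec_def vec_eq_iff axis_def to_indexed_inverse of_indexed_inverse)
        then show "y \<in> Basis" by (auto simp: Basis_vec_def)
      qed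
    qed simp_all
    fix x and b :: "real^'a"
    show "unindex_vec x \<bullet> b = x \<bullet> index_vec b"
    proof -
      have "(\<Sum>i\<in>UNIV. x $ to_indexed i * b $ i) =
            (\<Sum>i\<in>UNIV. x $ i * b $ of_indexed i)"
        by (subst sum.reindex_bij_betw[OF bij_to_indexed, symmetric]) (simp add: to_indexed_inverse)
      then show ?thesis by (simp add: inner_vec_def unindex_vec_def index_vec_def)
    qed
  qed measurable
  then show "emeasure lborel (index_vec ` S) = emeasure lborel S"
    unfolding eq using S emeasure_distr[of unindex_vec lborel borel S] by simp
qed

lemma linear_bij_image_borel:
  fixes f :: "'a::euclidean_space \<Rightarrow> 'a"
  assumes "linear f" "inj f" "S \<in> sets borel"
  shows "f ` S \<in> sets borel"
proof -
  obtain g where g: "linear g" "\<And>x. g (f x) = x" "\<And>x. f (g x) = x"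
    using linear_injective_isomorphism[OF assms(1,2)] by auto
  then have "f ` S = g -` S" by (intro image_inverse_eq_vimage) auto
  then show ?thesis
    using measurable_sets_borel[OF borel_measurable_linear[OF g(1)] assms(3)] by simp
qed

lemma emeasure_linear_image_wellorder:
  fixes f :: "real^'k::{finite,wellorder} \<Rightarrow> real^'k::_"
  assumes f: "linear f" "inj f" and S: "S \<in> sets borel" and fin: "emeasure lborel S < \<infinity>"
  shows "emeasure lborel (f ` S) = ennreal \<bar>det (matrix f)\<bar> * emeasure lborel S"
proof -
  have S': "S \<in> lmeasurable"
    using S fin by (simp add: fmeasurable_def)
  have fS: "f ` S \<in> sets borel"
    using f S by (rule linear_bij_image_borel)
  have "f ` S \<in> lmeasurable" "measure lebesgue (f ` S) = \<bar>det (matrix f)\<bar> * measure lebesgue S"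
    using measurable_linear_image[OF f(1) S'] measure_linear_image[OF f(1) S'] by auto
  then have "emeasure lebesgue (f ` S) = ennreal \<bar>det (matrix f)\<bar> * emeasure lebesgue S"
    using S' by (simp add: emeasure_eq_measure2 fmeasurableD2 ennreal_mult)
  then show ?thesis using S fS by simp
qed

text \<open>Conjugation by \<open>index_vec\<close> preserves measure. The determinant is left on
  the conjugated side: later only its sign, its value for isometries and its first-order expansion
  matter, and all three can be read off there.\<close>

lemma emeasure_linear_image_indexed:
  fixes f :: "real^'m \<Rightarrow> real^'m"
  assumes f: "linear f" "inj f" and S: "S \<in> sets borel" and fin: "emeasure lborel S < \<infinity>"
  shows "emeasure lborel (f ` S) =
    ennreal \<bar>det (matrix (index_vec \<circ> f \<circ> unindex_vec))\<bar> * emeasure lborel S"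
proof -
  let ?f = "index_vec \<circ> f \<circ> unindex_vec"
  have fS: "f ` S \<in> sets borel"
    using f S by (rule linear_bij_image_borel)
  have lin: "linear ?f"
    by (intro linear_compose linear_index_vec linear_unindex_vec f)
  have inj: "inj ?f"
    using f(2) by (simp add: inj_conj_index_vec)
  have "emeasure lborel (f ` S) = emeasure lborel (?f ` index_vec ` S)"
    using index_vec_image(2)[OF fS] by (simp add: image_comp o_def)
  also have "\<dots> = ennreal \<bar>det (matrix ?f)\<bar> * emeasure lborel (index_vec ` S)"
    using index_vec_image[OF S] fin by (intro emeasure_linear_image_wellorder lin inj) auto
  finally show ?thesis using index_vec_image[OF S] by simp
qed

lemma det_conj_index_vec_nonzero:
  fixes f :: "real^'m \<Rightarrow> real^'m"
  assumes f: "linear f" "inj f"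
  shows "det (matrix (index_vec \<circ> f \<circ> unindex_vec)) \<noteq> 0"
proof -
  let ?f = "index_vec \<circ> f \<circ> unindex_vec"
  have lin: "linear ?f"
    by (intro linear_compose linear_index_vec linear_unindex_vec f)
  have inj: "inj ?f"
    using f(2) by (simp add: inj_conj_index_vec)
  show ?thesis
    using inj lin by (simp add: det_nz_iff_inj)
qed

lemma emeasure_linear_image:
  fixes f :: "real^'m \<Rightarrow> real^'m"
  assumes f: "linear f" "inj f"
  obtains d where "0 < d" "\<And>S. S \<in> sets borel \<Longrightarrow> emeasure lborel S < \<infinity> \<Longrightarrow>
     emeasure lborel (f ` S) = ennreal d * emeasure lborel S"
  using that[of "\<bar>det (matrix (index_vec \<circ> f \<circ> unindex_vec))\<bar>"]
    emeasure_linear_image_indexed[OF f] det_conj_index_vec_nonzero[OF f] by simp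

lemma emeasure_orthogonal_image:
  fixes f :: "real^'m \<Rightarrow> real^'m"
  assumes f: "orthogonal_transformation f" and S: "S \<in> sets borel" "emeasure lborel S < \<infinity>"
  shows "emeasure lborel (f ` S) = emeasure lborel S"
proof -
  let ?f = "index_vec \<circ> f \<circ> unindex_vec"
  have f': "linear f" "inj f"
    using f by (auto simp: orthogonal_transformation_linear orthogonal_transformation_inj)
  have norm: "norm (index_vec x) = norm x" for x :: "real^'m"
  proof -
    have "(\<Sum>i\<in>UNIV. (x $ of_indexed i)\<^sup>2) = (\<Sum>i\<in>UNIV. (x $ i)\<^sup>2)"
      by (rule sum.reindex_bij_betw[OF bij_of_indexed])
    then show ?thesis by (simp add: norm_vec_def L2_set_def index_vec_def)
  qed
  have "linear ?f"
    by (intro linear_compose linear_index_vec linear_unindex_vec f')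
  then have "orthogonal_transformation ?f"
    using f norm[of "unindex_vec _"] by (simp add: orthogonal_transformation norm)
  then have "\<bar>det (matrix ?f)\<bar> = 1" by (rule orthogonal_transformation_det)
  then show ?thesis using emeasure_linear_image_indexed[OF f' S] by simp
qed

section \<open>First-order expansion of the determinant\<close>

text \<open>In the Leibniz formula, a permutation other than the identity moves at least two
  indices. Its product then has two factors that vanish at t = 0, so its derivative there is 0. The
  identity contributes the trace by the product rule.\<close>

lemma det_perturbation_derivative:
  fixes A :: "real^'n^'n"
  shows "((\<lambda>t. det (mat 1 + t *\<^sub>R A)) has_real_derivative trace A) (at 0)"
proof -
  let ?U = "UNIV :: 'n set"
  have "((\<lambda>t. \<Sum>p | p permutes ?U. of_int (sign p) * (\<Prod>i\<in>?U. mat 1 $ i $ p i + t * A $ i $ p i))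
    has_real_derivative (\<Sum>p | p permutes ?U. of_int (sign p) *
       (\<Sum>i\<in>?U. A $ i $ p i * (\<Prod>j\<in>?U - {i}. mat 1 $ j $ p j + 0 * A $ j $ p j)))) (at 0)"
    by (intro DERIV_sum DERIV_cmult has_field_derivative_prod) (auto intro!: derivative_eq_intros)
  also have "(\<Sum>p | p permutes ?U. of_int (sign p) *
       (\<Sum>i\<in>?U. A $ i $ p i * (\<Prod>j\<in>?U - {i}. mat 1 $ j $ p j + 0 * A $ j $ p j))) =
     (\<Sum>p | p permutes ?U. if p = id then trace A else 0)"
  proof (intro sum.cong refl)
    fix p assume "p \<in> {p. p permutes ?U}"
    then have p: "p permutes ?U" by simp
    show "of_int (sign p) * (\<Sum>i\<in>?U. A $ i $ p i * (\<Prod>j\<in>?U - {i}. mat 1 $ j $ p j + 0 * A $ j $ p j)) =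
      (if p = id then trace A else 0)"
    proof (cases "p = id")
      case True
      then show ?thesis by (simp add: trace_def mat_def sign_id)
    next
      case False
      have "(\<Prod>j\<in>?U - {i}. mat 1 $ j $ p j + 0 * A $ j $ p j) = 0" for i
      proof -
        obtain k where k: "p k \<noteq> k" using False by (auto simp: fun_eq_iff)
        \<comment> \<open>Both \<open>k\<close> and \<open>p k\<close> are moved, and one of them
          survives the deletion of the index \<open>i\<close>.\<close>
        then have "p (p k) \<noteq> p k" using p by (metis permutes_inj injD)
        then obtain j where "j \<noteq> i" "p j \<noteq> j" using k by metis
        then show ?thesis by (intro prod_zero) (auto simp: mat_def intro!: bexI[of _ j])
      qed
      then show ?thesis using False by (simp only: mult_zero_right sum.neutral_const if_False)
    qed
  qed
  also have "\<dots> = trace A"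
    by (simp add: sum.delta' permutes_id finite_permutations)
  finally show ?thesis
    by (simp add: det_def)
qed

text \<open>The determinant is 1 + t trace A + o(t). "Eventually" lets this be combined with the
  smallness conditions that keep points in the cone.\<close>

lemma emeasure_perturbation_image:
  fixes A :: "real^'m^'m"
  assumes "0 < trace A"
  shows "\<forall>\<^sub>F t in at_right 0. \<exists>d>1. inj (\<lambda>x. x + t *\<^sub>R (A *v x)) \<and>
    (\<forall>S \<in> sets borel. emeasure lborel S < \<infinity> \<longrightarrow>
       emeasure lborel ((\<lambda>x. x + t *\<^sub>R (A *v x)) ` S) = ennreal d * emeasure lborel S)"
proof -
  let ?A = "matrix (index_vec \<circ> (*v) A \<circ> unindex_vec)"
  have linA: "linear (index_vec \<circ> (*v) A \<circ> unindex_vec)"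
    by (intro linear_compose linear_index_vec linear_unindex_vec) simp
  have tr: "trace ?A = trace A"
  proof -
    have "?A $ i $ i = A $ of_indexed i $ of_indexed i" for i
    proof -
      have "unindex_vec (axis i 1) = (axis (of_indexed i) 1 :: real^'m)"
        by (auto simp: unindex_vec_def vec_eq_iff axis_def to_indexed_inverse of_indexed_inverse)
      then show ?thesis
        by (simp add: matrix_def index_vec_def matrix_vector_mult_basis column_def)
    qed
    then show ?thesis
      unfolding trace_def
      by (simp add: sum.reindex_bij_betw[OF bij_of_indexed, of "\<lambda>i. A $ i $ i"])
  qed
  have "\<forall>\<^sub>F t in at_right 0. det (mat 1 + t *\<^sub>R ?A) > 1"
  proof -
    have "((\<lambda>t. det (mat 1 + t *\<^sub>R ?A)) has_real_derivative trace A) (at 0)"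
      using det_perturbation_derivative[of ?A] unfolding tr .
    from DERIV_pos_inc_right[OF this assms] obtain e where "e > 0"
      "\<And>h. 0 < h \<Longrightarrow> h < e \<Longrightarrow> det (mat 1 + 0 *\<^sub>R ?A) < det (mat 1 + (0 + h) *\<^sub>R ?A)"
      by blast
    then show ?thesis
      by (auto simp: eventually_at_right_field intro!: exI[of _ e])
  qed
  then show ?thesis
  proof (rule eventually_mono)
    fix t assume det: "1 < det (mat 1 + t *\<^sub>R ?A)"
    let ?f = "\<lambda>x. x + t *\<^sub>R (A *v x)"
    have lin: "linear ?f"
      by (intro linear_compose_add linear_compose_scale_right linear_ident) auto
    have mat: "matrix (index_vec \<circ> ?f \<circ> unindex_vec) = mat 1 + t *\<^sub>R ?A"
    proof -
      have "index_vec \<circ> ?f \<circ> unindex_vec = (*v) (mat 1 + t *\<^sub>R ?A)"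
        by (rule ext) (simp add: matrix_vector_mult_add_rdistrib scaleR_matrix_vector_assoc[symmetric]
            matrix_works[OF linA[unfolded linear_def scalar_mult_eq_scaleR[symmetric]]] linear_add[OF linear_index_vec] linear_scale[OF linear_index_vec])
      then show ?thesis by (simp only: matrix_of_matrix_vector_mul)
    qed
    have "inj (index_vec \<circ> ?f \<circ> unindex_vec)"
      using det by (subst det_nz_iff_inj[symmetric])
        (auto simp: mat intro!: linear_compose linear_index_vec linear_unindex_vec lin)
    then have inj: "inj ?f"
      by (simp add: inj_conj_index_vec)
    show "\<exists>d>1. inj ?f \<and> (\<forall>S \<in> sets borel. emeasure lborel S < \<infinity> \<longrightarrow>
       emeasure lborel (?f ` S) = ennreal d * emeasure lborel S)"
      using det emeasure_linear_image_indexed[OF lin inj] unfolding mat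
      by (intro exI[of _ "det (mat 1 + t *\<^sub>R ?A)"]) (auto simp: inj)
  qed
qed

section \<open>Volume within the affine hull\<close>

text \<open>The index set is arbitrary so that vectors of one space, the orthonormal basis chosen by
  \<open>aff_vol\<close>, can label the coordinates of another.\<close>

lemma lborel_eq_distr_PiM:
  fixes h :: "'i \<Rightarrow> 'a::euclidean_space"
  assumes I: "finite I" and h: "bij_betw h I Basis"
  shows "distr (Pi\<^sub>M I (\<lambda>_. lborel)) borel (\<lambda>c. \<Sum>i\<in>I. c i *\<^sub>R h i) = lborel"
proof (rule lborel_eqI[symmetric])
  interpret product_sigma_finite "\<lambda>_::'i. lborel :: real measure" by standard
  have hB: "h i \<in> Basis" if "i \<in> I" for i using h that by (auto simp: bij_betw_def)
  have comp: "(\<Sum>k\<in>I. c k *\<^sub>R h k) \<bullet> h i = c i" if "i \<in> I" for c i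
  proof -
    have "(\<Sum>k\<in>I. c k *\<^sub>R h k) \<bullet> h i = (\<Sum>k\<in>I. if k = i then c k else 0)"
      using h that by (auto simp: inner_sum_left inner_Basis hB bij_betw_def inj_on_eq_iff intro!: sum.cong)
    then show ?thesis using I that by simp
  qed
  fix l u :: 'a assume lu: "\<And>b. b \<in> Basis \<Longrightarrow> l \<bullet> b \<le> u \<bullet> b"
  have "(\<lambda>c. \<Sum>i\<in>I. c i *\<^sub>R h i) -` box l u \<inter> space (Pi\<^sub>M I (\<lambda>_. lborel)) =
    Pi\<^sub>E I (\<lambda>i. {l \<bullet> h i <..< u \<bullet> h i})"
  proof -
    have "x \<in> box l u \<longleftrightarrow> (\<forall>b\<in>h ` I. l \<bullet> b < x \<bullet> b \<and> x \<bullet> b < u \<bullet> b)" for x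
      using h by (simp add: mem_box bij_betw_def)
    then show ?thesis
      by (auto simp: comp space_PiM PiE_iff)
  qed
  then have "emeasure (distr (Pi\<^sub>M I (\<lambda>_. lborel)) borel (\<lambda>c. \<Sum>i\<in>I. c i *\<^sub>R h i)) (box l u) =
      (\<Prod>i\<in>I. emeasure lborel {l \<bullet> h i <..< u \<bullet> h i})"
    using I by (simp add: emeasure_distr emeasure_PiM)
  also have "\<dots> = (\<Prod>i\<in>I. ennreal ((u - l) \<bullet> h i))"
    using lu hB by (intro prod.cong) (auto simp: inner_diff_left)
  also have "\<dots> = ennreal (\<Prod>i\<in>I. (u - l) \<bullet> h i)"
    using lu hB by (intro prod_ennreal) (auto simp: inner_diff_left)
  also have "(\<Prod>i\<in>I. (u - l) \<bullet> h i) = (\<Prod>b\<in>Basis. (u - l) \<bullet> b)"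
    using h by (rule prod.reindex_bij_betw)
  finally show "emeasure (distr (Pi\<^sub>M I (\<lambda>_. lborel)) borel (\<lambda>c. \<Sum>i\<in>I. c i *\<^sub>R h i)) (box l u) =
    (\<Prod>b\<in>Basis. (u - l) \<bullet> b)" .
qed simp

text \<open>Up to coordinates, the set on the right is the product of \<open>E\<close> with a unit
  cube, which has measure 1. \<open>J\<close> supplies the coordinates that \<open>B\<close>
  lacks.\<close>

lemma emeasure_PiM_eq_lborel:
  fixes h :: "'i \<Rightarrow> 'a::euclidean_space"
  assumes fin: "finite B" "finite J" and disj: "B \<inter> J = {}"
    and h: "bij_betw h (B \<union> J) Basis" and E: "E \<in> sets (Pi\<^sub>M B (\<lambda>_. lborel))"
  shows "emeasure (Pi\<^sub>M B (\<lambda>_. lborel)) E =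
    emeasure lborel {x. (\<lambda>b\<in>B. x \<bullet> h b) \<in> E \<and> (\<forall>j\<in>J. x \<bullet> h j \<in> {0..1})}"
proof -
  interpret product_sigma_finite "\<lambda>_::'i. lborel :: real measure" by standard
  interpret J: finite_product_sigma_finite "\<lambda>_::'i. lborel :: real measure" J by standard fact
  let ?M = "\<lambda>I. Pi\<^sub>M I (\<lambda>_. lborel :: real measure)"
  let ?S = "{x. (\<lambda>b\<in>B. x \<bullet> h b) \<in> E \<and> (\<forall>j\<in>J. x \<bullet> h j \<in> {0..1})}"
  let ?g = "\<lambda>c. \<Sum>i\<in>B \<union> J. c i *\<^sub>R h i"
  have hB: "h i \<in> Basis" if "i \<in> B \<union> J" for i using h that by (auto simp: bij_betw_def)
  have comp: "?g c \<bullet> h i = c i" if "i \<in> B \<union> J" for c i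
  proof -
    have "?g c \<bullet> h i = (\<Sum>k\<in>B \<union> J. if k = i then c k else 0)"
      using h that by (auto simp: inner_sum_left inner_Basis hB bij_betw_def inj_on_eq_iff intro!: sum.cong)
    then show ?thesis using fin that by simp
  qed
  have S: "?S \<in> sets borel"
  proof -
    have [measurable]: "(\<lambda>x. \<lambda>b\<in>B. x \<bullet> h b) \<in> measurable borel (?M B)"
      by (intro measurable_restrict) auto
    have "{x \<in> space borel. (\<lambda>b\<in>B. x \<bullet> h b) \<in> E \<and> (\<forall>j\<in>J. x \<bullet> h j \<in> {0..1})} \<in> sets borel"
      using E fin by measurable
    then show ?thesis by simp
  qed
  have "emeasure lborel ?S = emeasure (distr (?M (B \<union> J)) borel ?g) ?S"
    using lborel_eq_distr_PiM[OF _ h] fin by simp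
  also have "\<dots> = emeasure (?M (B \<union> J)) (?g -` ?S \<inter> space (?M (B \<union> J)))"
    using S by (intro emeasure_distr) auto
  also have "\<dots> = emeasure (distr (?M B \<Otimes>\<^sub>M ?M J) (?M (B \<union> J)) (merge B J)) (?g -` ?S \<inter> space (?M (B \<union> J)))"
    using distr_merge[OF disj fin] by simp
  also have "\<dots> = emeasure (?M B \<Otimes>\<^sub>M ?M J)
      (merge B J -` (?g -` ?S \<inter> space (?M (B \<union> J))) \<inter> space (?M B \<Otimes>\<^sub>M ?M J))"
  proof (intro emeasure_distr)
    have "?g \<in> measurable (?M (B \<union> J)) borel" by measurable
    then show "?g -` ?S \<inter> space (?M (B \<union> J)) \<in> sets (?M (B \<union> J))"
      using S by (rule measurable_sets)
  qed auto
  also have "merge B J -` (?g -` ?S \<inter> space (?M (B \<union> J))) \<inter> space (?M B \<Otimes>\<^sub>M ?M J) =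
      E \<times> Pi\<^sub>E J (\<lambda>_. {0..1})"
  proof -
    have r: "(\<lambda>b\<in>B. ?g (merge B J (c, d)) \<bullet> h b) = c" if "c \<in> space (?M B)" for c d
      using that disj by (auto simp: comp merge_def space_PiM PiE_iff extensional_def fun_eq_iff)
    have s: "?g (merge B J (c, d)) \<bullet> h j = d j" if "j \<in> J" for c d j
      using that disj by (subst comp) (auto simp: merge_def)
    have m: "merge B J (c, d) \<in> space (?M (B \<union> J))" for c d
      by (auto simp: space_PiM merge_def PiE_iff extensional_def)
    show ?thesis
      using sets.sets_into_space[OF E]
      by (auto simp: r s m space_pair_measure space_PiM PiE_iff Pi_iff)
  qed
  also have "emeasure (?M B \<Otimes>\<^sub>M ?M J) (E \<times> Pi\<^sub>E J (\<lambda>_. {0..1})) = emeasure (?M B) E * emeasure (?M J) (Pi\<^sub>E J (\<lambda>_. {0..1}))"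
    using E fin by (intro J.emeasure_pair_measure_Times) auto
  also have "emeasure (?M J) (Pi\<^sub>E J (\<lambda>_. {0..1})) = 1"
    using fin by (subst emeasure_PiM) auto
  finally show ?thesis by (simp only: mult_1_right)
qed

lemma emeasure_lborel_translation:
  fixes S :: "'a::euclidean_space set"
  assumes "S \<in> sets borel"
  shows "emeasure lborel ((\<lambda>x. a + x) ` S) = emeasure lborel S"
proof -
  have eq: "(\<lambda>x. a + x) ` S = (\<lambda>x. - a + x) -` S"
    by (rule image_inverse_eq_vimage) auto
  have "emeasure lborel S = emeasure (distr lborel borel ((+) (- a))) S"
    using lborel_distr_plus[of "- a"] by simp
  also have "\<dots> = emeasure lborel ((\<lambda>x. - a + x) -` S)"
    using assms by (subst emeasure_distr) auto
  finally show ?thesis by (simp add: eq)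
qed

lemma aff_vol_linear_image:
  fixes N :: "real^'m \<Rightarrow> real^'n" and u :: "real^'m"
  assumes N: "linear N" "inj N"
    and W: "(W = UNIV \<and> T = {0}) \<or> (W = {v. u \<bullet> v = 1} \<and> u \<noteq> 0 \<and> T = {0..1})"
  obtains \<kappa> where "0 < \<kappa>"
    "\<And>Y. compact Y \<Longrightarrow> affine hull Y = W \<Longrightarrow>
      aff_vol (N ` Y) = ennreal \<kappa> * emeasure lborel {y + t *\<^sub>R u | y t. y \<in> Y \<and> t \<in> T}"
proof -
  define D where "D = {x - y | x y. x \<in> N ` W \<and> y \<in> N ` W}"
  define B where "B = (SOME B. pairwise orthogonal B \<and> (\<forall>b\<in>B. norm b = 1) \<and> span B = D)"
  define p where "p = (SOME p. p \<in> N ` W)"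
  define V where "V = {x - y | x y. x \<in> W \<and> y \<in> W}"
  \<comment> \<open>The label of the coordinate along \<open>u\<close>; 0 is free for this because
    an orthonormal basis does not contain it.\<close>
  define J where "J = (if T = {0} then {} else {0 :: real^'n})"
  have V: "(V = UNIV \<and> T = {0} \<and> W = UNIV) \<or> (V = {v. u \<bullet> v = 0} \<and> u \<noteq> 0 \<and> T = {0..1} \<and> W = {v. u \<bullet> v = 1})"
    using W
  proof (elim disjE conjE)
    assume a: "W = UNIV" "T = {0}"
    have "V = UNIV"
      unfolding V_def a by (metis (mono_tags, lifting) UNIV_I UNIV_eq_I diff_zero mem_Collect_eq)
    then show ?thesis using a by simp
  next
    assume a: "W = {v. u \<bullet> v = 1}" "u \<noteq> 0" "T = {0..1}"
    have "v \<in> V" if "u \<bullet> v = 0" for v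
    proof -
      let ?w = "u /\<^sub>R (u \<bullet> u)"
      have "v = (v + ?w) - ?w" "v + ?w \<in> W" "?w \<in> W"
        using a that by (auto simp: inner_add_right)
      then show ?thesis unfolding V_def by blast
    qed
    then have "V = {v. u \<bullet> v = 0}"
      using a(1) by (auto simp: V_def inner_diff_right)
    then show ?thesis using a by simp
  qed
  have subV: "subspace V"
    using V subspace_hyperplane[of u] subspace_UNIV by (elim disjE conjE) (simp_all only:)
  have D: "D = N ` V"
  proof -
    have "N x - N y \<in> N ` V" if "x \<in> W" "y \<in> W" for x y
      using that by (auto simp: V_def linear_diff[OF N(1), symmetric])
    moreover have "N (x - y) \<in> D" if "x \<in> W" "y \<in> W" for x y
      using that by (auto simp: D_def linear_diff[OF N(1)])
    ultimately show ?thesis by (auto simp: D_def V_def)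
  qed
  have subD: "subspace D"
    unfolding D by (rule linear_subspace_image[OF N(1) subV])
  have "\<exists>B. pairwise orthogonal B \<and> (\<forall>b\<in>B. norm b = 1) \<and> span B = D"
    by (rule orthonormal_basis_subspace[OF subD]) blast
  from someI_ex[OF this, folded B_def]
  have B: "pairwise orthogonal B" "\<And>b. b \<in> B \<Longrightarrow> norm b = 1" "span B = D"
    by auto
  have B0: "0 \<notin> B" using B(2) by force
  have indB: "independent B"
    using B(1) B0 by (rule pairwise_orthogonal_independent)
  have finB: "finite B" by (rule independent_imp_finite[OF indB])
  have cardB: "card B = dim V"
    using dim_eq_card_independent[OF indB] dim_span[of B] dim_image_eq[OF N(1), of V]
      inj_on_subset[OF N(2), of "span V"]
    by (simp add: B(3) D)
  have finJ: "finite J" and disj: "B \<inter> J = {}"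
    using B0 by (auto simp: J_def)
  have card: "card (B \<union> J) = card (Basis :: (real^'m) set)"
  proof -
    have "card (B \<union> J) = card B + card J"
      using finB finJ disj by (rule card_Un_disjoint)
    also have "\<dots> = DIM(real^'m)"
      using V
    proof
      assume "V = UNIV \<and> T = {0} \<and> W = UNIV"
      then show ?thesis by (simp add: cardB J_def)
    next
      assume v: "V = {v. u \<bullet> v = 0} \<and> u \<noteq> 0 \<and> T = {0..1} \<and> W = {v. u \<bullet> v = 1}"
      then have "(1::real) \<in> T" by simp
      then have "T \<noteq> {0}" by auto
      then show ?thesis using v dim_hyperplane[of u] by (simp add: cardB J_def)
    qed
    finally show ?thesis by simp
  qed
  then obtain h where h: "bij_betw h (B \<union> J) (Basis :: (real^'m) set)"
    using finite_same_card_bij[of "B \<union> J" "Basis :: (real^'m) set"] finB finJ by auto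
  obtain L where L: "linear L" "\<And>x. L (N x) = x"
    using linear_injective_left_inverse[OF N] by (auto simp: fun_eq_iff)
  have "W \<noteq> {}"
    using W
  proof (elim disjE conjE)
    assume "W = {v. u \<bullet> v = 1}" "u \<noteq> 0"
    then have "u /\<^sub>R (u \<bullet> u) \<in> W" by simp
    then show ?thesis by blast
  qed simp
  then have p: "p \<in> N ` W" unfolding p_def by (simp add: some_in_eq)
  \<comment> \<open>From coordinates to \<real>\<open>\<^sup>m\<close>: the
    \<open>B\<close>-coordinates give the direction in \<open>V\<close> whose image under
    \<open>N\<close> has these coordinates, the \<open>J\<close>-coordinate gives the height along
    \<open>u\<close>.\<close>
  define G where "G x = L (\<Sum>b\<in>B. (x \<bullet> h b) *\<^sub>R b) + (\<Sum>j\<in>J. x \<bullet> h j) *\<^sub>R u" for x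
  have linG: "linear G"
    unfolding G_def
    by (intro linear_compose_add linear_compose[OF _ L(1), unfolded o_def] linear_compose_sum ballI linearI)
       (simp_all add: algebra_simps inner_add_left sum.distrib sum_distrib_left sum_distrib_right scaleR_sum_right)
  have sumD: "(\<Sum>b\<in>B. c b *\<^sub>R b) \<in> N ` V" for c
    unfolding D[symmetric] B(3)[symmetric] by (intro span_sum span_scale span_base)
  have WV: "w + v \<in> W" if "w \<in> W" "v \<in> V" for w v
    using that V by (auto simp: inner_add_right)
  have injG: "inj G"
  proof (rule linear_injective_0[OF linG, THEN iffD2], intro allI impI)
    fix x assume "G x = 0"
    obtain v where v: "v \<in> V" "(\<Sum>b\<in>B. (x \<bullet> h b) *\<^sub>R b) = N v"
      using sumD[of "\<lambda>b. x \<bullet> h b"] by auto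
    have e: "v + (\<Sum>j\<in>J. x \<bullet> h j) *\<^sub>R u = 0"
      using \<open>G x = 0\<close> by (simp add: G_def v L)
    have "v = 0 \<and> (\<forall>j\<in>J. x \<bullet> h j = 0)"
      using V
    proof
      assume "V = UNIV \<and> T = {0} \<and> W = UNIV"
      then show ?thesis using e by (simp add: J_def)
    next
      assume a: "V = {v. u \<bullet> v = 0} \<and> u \<noteq> 0 \<and> T = {0..1} \<and> W = {v. u \<bullet> v = 1}"
      have "u \<bullet> (v + (\<Sum>j\<in>J. x \<bullet> h j) *\<^sub>R u) = 0" using e by simp
      then have "(\<Sum>j\<in>J. x \<bullet> h j) = 0" using a v(1) by (simp add: inner_add_right)
      then show ?thesis using e by (auto simp: J_def split: if_splits)
    qed
    then have v0: "v = 0" and xJ: "\<And>j. j \<in> J \<Longrightarrow> x \<bullet> h j = 0" by auto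
    have "(\<Sum>b\<in>B. (x \<bullet> h b) *\<^sub>R b) = 0" using v v0 linear_0[OF N(1)] by simp
    then have "x \<bullet> h b = 0" if "b \<in> B" for b
      using indB finB that by (auto simp: independent_explicit)
    with xJ have "\<forall>i\<in>B \<union> J. x \<bullet> h i = 0" by auto
    then have "\<forall>b\<in>h ` (B \<union> J). x \<bullet> b = 0"
      by blast
    then have "\<forall>b\<in>Basis. x \<bullet> b = 0"
      by (simp only: bij_betw_imp_surj_on[OF h])
    then show "x = 0" by (simp only: euclidean_all_zero_iff)
  qed
  obtain G' where G': "linear G'" "\<And>x. G' (G x) = x" "\<And>x. G (G' x) = x"
    using linear_injective_isomorphism[OF linG injG] by auto
  have injG': "inj G'" using G'(3) by (metis injI)
  \<comment> \<open>The scaling factor of the inverse of \<open>G\<close>; neither involves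
    \<open>Y\<close>.\<close>
  obtain \<kappa> where \<kappa>: "0 < \<kappa>" "\<And>S. S \<in> sets borel \<Longrightarrow> emeasure lborel S < \<infinity> \<Longrightarrow>
     emeasure lborel (G' ` S) = ennreal \<kappa> * emeasure lborel S"
    using emeasure_linear_image[OF G'(1) injG'] by metis
  show ?thesis
  proof (rule that[OF \<kappa>(1)])
    fix Y :: "(real^'m) set" assume Y: "compact Y" "affine hull Y = W"
    let ?Z = "{y + t *\<^sub>R u | y t. y \<in> Y \<and> t \<in> T}"
    let ?E = "{c \<in> PiE B (\<lambda>_. UNIV). p + (\<Sum>b\<in>B. c b *\<^sub>R b) \<in> N ` Y}"
    have NW: "affine hull (N ` Y) = N ` W"
      using affine_hull_linear_image[of N Y] N(1) Y(2) by (simp add: linear_conv_bounded_linear)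
    have YW: "Y \<subseteq> W" using Y(2) hull_subset[of Y affine] by simp
    have vol: "aff_vol (N ` Y) = emeasure (completion (Pi\<^sub>M B (\<lambda>_. lborel))) ?E"
      by (simp add: aff_vol_def aff_basis_def aff_direction_def aff_origin_def NW B_def D_def p_def)
    have closed: "closed (N ` Y)"
      using Y(1) N(1) by (simp add: compact_imp_closed compact_continuous_image linear_continuous_on linear_linear)
    \<comment> \<open>On a Borel set the completed measure in \<open>aff_vol\<close> agrees with the
      product measure; compactness of \<open>Y\<close> puts \<open>?E\<close> among these.\<close>
    have E: "?E \<in> sets (Pi\<^sub>M B (\<lambda>_. lborel))"
    proof -
      have "(\<lambda>c. p + (\<Sum>b\<in>B. c b *\<^sub>R b)) -` (N ` Y) \<inter> space (Pi\<^sub>M B (\<lambda>_. lborel)) \<in> sets (Pi\<^sub>M B (\<lambda>_. lborel))"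
        using closed by (intro measurable_sets[where A = borel] borel_closed) measurable
      also have "(\<lambda>c. p + (\<Sum>b\<in>B. c b *\<^sub>R b)) -` (N ` Y) \<inter> space (Pi\<^sub>M B (\<lambda>_. lborel)) = ?E"
        by (auto simp: space_PiM)
      finally show ?thesis .
    qed
    have Z: "compact ?Z"
    proof -
      have "compact T" using W by auto
      then have "compact {y + t | y t. y \<in> Y \<and> t \<in> (\<lambda>t. t *\<^sub>R u) ` T}"
        using Y(1) by (intro compact_sums compact_continuous_image) (auto intro!: continuous_intros)
      also have "{y + t | y t. y \<in> Y \<and> t \<in> (\<lambda>t. t *\<^sub>R u) ` T} = ?Z" by auto
      finally show ?thesis .
    qed
    have set: "{x. (\<lambda>b\<in>B. x \<bullet> h b) \<in> ?E \<and> (\<forall>j\<in>J. x \<bullet> h j \<in> {0..1})} = G' ` ((\<lambda>x. - L p + x) ` ?Z)"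
    proof -
      have L: "(\<lambda>b\<in>B. x \<bullet> h b) \<in> ?E \<and> (\<forall>j\<in>J. x \<bullet> h j \<in> {0..1}) \<longleftrightarrow> L p + G x \<in> ?Z" for x
      proof -
        obtain w where w: "w \<in> W" "p = N w" using p by auto
        obtain v where v: "v \<in> V" "(\<Sum>b\<in>B. (x \<bullet> h b) *\<^sub>R b) = N v"
          using sumD[of "\<lambda>b. x \<bullet> h b"] by auto
        have "(\<lambda>b\<in>B. x \<bullet> h b) \<in> ?E \<longleftrightarrow> N (w + v) \<in> N ` Y"
          by (simp add: linear_add[OF N(1)] w v)
        also have "\<dots> \<longleftrightarrow> w + v \<in> Y" using N(2) by (simp add: inj_image_mem_iff)
        finally have 1: "(\<lambda>b\<in>B. x \<bullet> h b) \<in> ?E \<longleftrightarrow> w + v \<in> Y" .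
        define s where "s = (\<Sum>j\<in>J. x \<bullet> h j)"
        have 2: "L p + G x = (w + v) + s *\<^sub>R u"
          by (simp add: G_def w v L s_def)
        have wv: "w + v \<in> W" using w v by (intro WV)
        show ?thesis
          unfolding 1 2 using V
        proof
          assume "V = UNIV \<and> T = {0} \<and> W = UNIV"
          then show "(w + v \<in> Y \<and> (\<forall>j\<in>J. x \<bullet> h j \<in> {0..1})) = (w + v + s *\<^sub>R u \<in> ?Z)"
            by (simp add: s_def J_def)
        next
          assume a: "V = {v. u \<bullet> v = 0} \<and> u \<noteq> 0 \<and> T = {0..1} \<and> W = {v. u \<bullet> v = 1}"
          then have "(1::real) \<in> T" by simp
          then have "T \<noteq> {0}" by auto
          then have J: "J = {0}" by (simp add: J_def)
          \<comment> \<open>The inner product with \<open>u\<close> is 1 on \<open>Y\<close>, so it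
            recovers the height, and then the base point, from the sum.\<close>
          have "y = w + v \<and> t = s" if "w + v + s *\<^sub>R u = y + t *\<^sub>R u" "y \<in> Y" for y t
          proof -
            have "u \<bullet> (w + v + s *\<^sub>R u) = u \<bullet> (y + t *\<^sub>R u)" using that by simp
            moreover have "u \<bullet> y = 1" "u \<bullet> (w + v) = 1" using that YW wv a by auto
            ultimately have "s = t" using a by (simp add: inner_add_right)
            then show ?thesis using that by simp
          qed
          then have "w + v + s *\<^sub>R u \<in> ?Z \<longleftrightarrow> w + v \<in> Y \<and> s \<in> T"
            by blast
          then show "(w + v \<in> Y \<and> (\<forall>j\<in>J. x \<bullet> h j \<in> {0..1})) = (w + v + s *\<^sub>R u \<in> ?Z)"
            using a by (simp add: s_def J)
        qed
      qed
      have R: "x \<in> G' ` ((\<lambda>x. - L p + x) ` ?Z) \<longleftrightarrow> L p + G x \<in> ?Z" for x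
      proof -
        have "G' ` ((\<lambda>x. - L p + x) ` ?Z) = G -` ((\<lambda>x. L p + x) -` ?Z)"
          using image_inverse_eq_vimage[of G G'] image_inverse_eq_vimage[of "\<lambda>x. L p + x" "\<lambda>x. - L p + x"] G' by simp
        then show ?thesis by simp
      qed
      show ?thesis
        by (rule set_eqI) (subst R, subst mem_Collect_eq, rule L)
    qed
    have Zb: "?Z \<in> sets borel" using Z by (simp add: borel_compact)
    have Zt: "compact ((\<lambda>x. - L p + x) ` ?Z)" using Z by (rule compact_translation)
    have "aff_vol (N ` Y) = emeasure (Pi\<^sub>M B (\<lambda>_. lborel)) ?E"
      unfolding vol using E by simp
    also have "\<dots> = emeasure lborel {x. (\<lambda>b\<in>B. x \<bullet> h b) \<in> ?E \<and> (\<forall>j\<in>J. x \<bullet> h j \<in> {0..1})}"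
      by (rule emeasure_PiM_eq_lborel[OF finB finJ disj h E])
    also have "\<dots> = ennreal \<kappa> * emeasure lborel ((\<lambda>x. - L p + x) ` ?Z)"
      unfolding set using Zt by (intro \<kappa>(2) borel_compact emeasure_compact_finite)
    also have "emeasure lborel ((\<lambda>x. - L p + x) ` ?Z) = emeasure lborel ?Z"
      by (rule emeasure_lborel_translation[OF Zb])
    finally show "aff_vol (N ` Y) = ennreal \<kappa> * emeasure lborel ?Z" .
  qed
qed

section \<open>Haar measure of the symmetry group\<close>

text \<open>The predicate under the definite description in \<open>haar\<close>, named so that
  existence and uniqueness can be treated apart.\<close>

definition haar_measure :: "(real^'m^'m) set \<Rightarrow> (real^'m^'m) measure \<Rightarrow> bool" where
  "haar_measure G \<mu> \<longleftrightarrow> sets \<mu> = sets (restrict_space borel G) \<and> emeasure \<mu> (space \<mu>) = 1 \<and>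
     (\<forall>Q\<in>G. \<forall>A\<in>sets \<mu>. emeasure \<mu> ((**) Q ` A) = emeasure \<mu> A)"

lemma sym_group_mult: "P \<in> sym_group u \<Longrightarrow> Q \<in> sym_group u \<Longrightarrow> P ** Q \<in> sym_group u"
  by (simp add: sym_group_def orthogonal_matrix_mul matrix_vector_mul_assoc[symmetric])

lemma sym_group_transpose:
  assumes "Q \<in> sym_group u"
  shows "transpose Q \<in> sym_group u" "transpose Q ** Q = mat 1" "Q ** transpose Q = mat 1"
proof -
  show 1: "transpose Q ** Q = mat 1" and "Q ** transpose Q = mat 1"
    using assms by (auto simp: sym_group_def orthogonal_matrix_def)
  have "transpose Q *v u = transpose Q *v (Q *v u)"
    using assms by (simp add: sym_group_def)
  also have "\<dots> = u" by (simp add: matrix_vector_mul_assoc 1)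
  finally show "transpose Q \<in> sym_group u"
    using assms by (simp add: sym_group_def orthogonal_matrix_transpose)
qed

lemma sym_group_cancel:
  assumes "Q \<in> sym_group u"
  shows "transpose Q ** (Q ** A) = A" "Q ** (transpose Q ** A) = A"
  using sym_group_transpose[OF assms] by (simp_all add: matrix_mul_assoc)

lemma sym_group_image:
  assumes "Q \<in> sym_group u"
  shows "(**) Q ` E = {A. transpose Q ** A \<in> E}"
proof (intro set_eqI iffI)
  fix A assume "A \<in> {A. transpose Q ** A \<in> E}"
  then show "A \<in> (**) Q ` E"
    by (intro image_eqI[of _ _ "transpose Q ** A"]) (simp_all add: sym_group_cancel[OF assms])
qed (auto simp: sym_group_cancel[OF assms])

lemma borel_measurable_matrix_mult:
  fixes f g :: "'a \<Rightarrow> real^'m^'m"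
  assumes "f \<in> borel_measurable M" "g \<in> borel_measurable M"
  shows "(\<lambda>x. f x ** g x) \<in> borel_measurable M"
proof -
  have "continuous_on UNIV (\<lambda>p. fst p ** snd p :: real^'m^'m)"
    unfolding matrix_matrix_mult_def by (intro continuous_intros)
  then show ?thesis
    by (rule borel_measurable_continuous_Pair[OF assms, where H = "(**)"])
qed

lemma borel_measurable_transpose:
  fixes f :: "'a \<Rightarrow> real^'m^'m"
  assumes "f \<in> borel_measurable M"
  shows "(\<lambda>x. transpose (f x)) \<in> borel_measurable M"
proof -
  have "continuous_on UNIV (transpose :: real^'m^'m \<Rightarrow> _)"
    unfolding transpose_def by (intro continuous_intros)
  then show ?thesis
    using assms borel_measurable_continuous_on by blast
qed

lemma haar_measureD:
  assumes "haar_measure G \<mu>"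
  shows "sets \<mu> = sets (restrict_space borel G)" "space \<mu> = G" "prob_space \<mu>"
    "\<And>Q A. Q \<in> G \<Longrightarrow> A \<in> sets \<mu> \<Longrightarrow> emeasure \<mu> ((**) Q ` A) = emeasure \<mu> A"
  using assms sets_eq_imp_space_eq[of \<mu> "restrict_space borel G"]
  by (auto simp: haar_measure_def space_restrict_space intro: prob_spaceI)

lemma haar_measure_borel:
  assumes "haar_measure G \<mu>"
  shows "(\<lambda>Q. Q) \<in> borel_measurable \<mu>"
  using haar_measureD(1)[OF assms]
  by (subst measurable_cong_sets[OF haar_measureD(1)[OF assms] refl]) (rule measurable_restrict_space1, simp)

text \<open>Evaluating the measure of \<open>{(Q, R). Q\<^sup>T R \<in> E}\<close> in both orders of integration.\<close>

lemma haar_measure_transpose: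
  fixes u :: "real^'m"
  assumes \<mu>: "haar_measure (sym_group u) \<mu>" and \<nu>: "haar_measure (sym_group u) \<nu>"
    and E: "E \<in> sets \<mu>"
  shows "emeasure \<mu> E = emeasure \<nu> (transpose ` E)"
proof -
  let ?G = "sym_group u"
  note m = haar_measureD[OF \<mu>] and n = haar_measureD[OF \<nu>]
  interpret M: prob_space \<mu> by (rule m)
  interpret N: prob_space \<nu> by (rule n)
  interpret P: pair_sigma_finite \<nu> \<mu> by standard
  let ?X = "{p \<in> space (\<nu> \<Otimes>\<^sub>M \<mu>). transpose (fst p) ** snd p \<in> E}"
  have EG: "E \<subseteq> ?G" using sets.sets_into_space[OF E] m by simp
  have meas: "(\<lambda>p. transpose (fst p) ** snd p) \<in> measurable (\<nu> \<Otimes>\<^sub>M \<mu>) \<mu>"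
  proof -
    have "(\<lambda>p. transpose (fst p) ** snd p) \<in> borel_measurable (\<nu> \<Otimes>\<^sub>M \<mu>)"
      using measurable_compose[OF measurable_fst haar_measure_borel[OF \<nu>], of \<mu>]
        measurable_compose[OF measurable_snd haar_measure_borel[OF \<mu>], of \<nu>]
      by (intro borel_measurable_matrix_mult borel_measurable_transpose)
    then have "(\<lambda>p. transpose (fst p) ** snd p) \<in> measurable (\<nu> \<Otimes>\<^sub>M \<mu>) (restrict_space borel ?G)"
      by (rule measurable_restrict_space2[rotated])
         (auto simp: space_pair_measure m n sym_group_mult sym_group_transpose)
    then show ?thesis by (simp cong: measurable_cong_sets add: m)
  qed
  have X: "?X \<in> sets (\<nu> \<Otimes>\<^sub>M \<mu>)"
    using measurable_sets[OF meas E] by (simp add: vimage_def Int_def conj_commute)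
  have "emeasure \<mu> E = (\<integral>\<^sup>+z. emeasure \<mu> E \<partial>\<nu>)"
    by (simp add: N.emeasure_space_1)
  also have "\<dots> = (\<integral>\<^sup>+z. emeasure \<mu> (Pair z -` ?X) \<partial>\<nu>)"
  proof (rule nn_integral_cong)
    fix z assume "z \<in> space \<nu>"
    then have z: "z \<in> ?G" by (simp add: n)
    have "Pair z -` ?X = (**) z ` E"
      using z sym_group_image[OF z, of E] EG
      by (auto simp: space_pair_measure m n) (metis sym_group_cancel(2) sym_group_mult subsetD)
    then show "emeasure \<mu> E = emeasure \<mu> (Pair z -` ?X)"
      using m(4)[OF z E] by simp
  qed
  also have "\<dots> = emeasure (\<nu> \<Otimes>\<^sub>M \<mu>) ?X"
    by (rule M.emeasure_pair_measure_alt[symmetric, OF X])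
  also have "\<dots> = (\<integral>\<^sup>+y. emeasure \<nu> ((\<lambda>z. (z, y)) -` ?X) \<partial>\<mu>)"
    by (rule P.emeasure_pair_measure_alt2[OF X])
  also have "\<dots> = (\<integral>\<^sup>+y. emeasure \<nu> (transpose ` E) \<partial>\<mu>)"
  proof (rule nn_integral_cong)
    fix y assume "y \<in> space \<mu>"
    then have y: "y \<in> ?G" by (simp add: m)
    have ET: "transpose ` E \<in> sets \<nu>"
    proof -
      have "transpose \<in> measurable \<nu> \<mu>"
      proof -
        have "transpose \<in> measurable \<nu> (restrict_space borel ?G)"
          using borel_measurable_transpose[OF haar_measure_borel[OF \<nu>]]
          by (rule measurable_restrict_space2[rotated]) (auto simp: n sym_group_transpose)
        then show ?thesis by (simp cong: measurable_cong_sets add: m)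
      qed
      then have "transpose -` E \<inter> space \<nu> \<in> sets \<nu>" using E by (rule measurable_sets)
      also have "transpose -` E \<inter> space \<nu> = transpose ` E"
        using EG by (auto simp: n image_iff sym_group_transpose) (metis transpose_transpose)
      finally show ?thesis .
    qed
    have "(\<lambda>z. (z, y)) -` ?X = (**) y ` (transpose ` E)"
    proof -
      have "transpose y ** z \<in> transpose ` E \<longleftrightarrow> transpose z ** y \<in> E" for z
        by (metis (no_types, lifting) imageE imageI matrix_transpose_mul transpose_transpose)
      moreover have "z \<in> ?G" if "transpose z ** y \<in> E" for z
      proof -
        have "transpose z ** y \<in> ?G" using that EG by auto
        then have "y ** transpose (transpose z ** y) \<in> ?G"
          by (intro sym_group_mult[OF y] sym_group_transpose(1))
        also have "y ** transpose (transpose z ** y) = z"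
          by (simp add: matrix_transpose_mul sym_group_cancel[OF y])
        finally show ?thesis .
      qed
      ultimately show ?thesis
        using y by (auto simp: sym_group_image[OF y] space_pair_measure m n)
    qed
    then show "emeasure \<nu> ((\<lambda>z. (z, y)) -` ?X) = emeasure \<nu> (transpose ` E)"
      using n(4)[OF y ET] by simp
  qed
  finally show ?thesis by (simp add: M.emeasure_space_1)
qed

text \<open>By the previous lemma, applied to \<mu>, \<nu> and to \<nu>, \<nu>, both measures of
  \<open>E\<close> equal the \<nu>-measure of the transposed set.\<close>

lemma haar_measure_unique:
  fixes u :: "real^'m"
  assumes \<mu>: "haar_measure (sym_group u) \<mu>" and \<nu>: "haar_measure (sym_group u) \<nu>"
  shows "\<mu> = \<nu>"
proof (rule measure_eqI)
  show "sets \<mu> = sets \<nu>" using haar_measureD(1)[OF \<mu>] haar_measureD(1)[OF \<nu>] by simp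
  fix E assume "E \<in> sets \<mu>"
  then show "emeasure \<mu> E = emeasure \<nu> E"
    using haar_measure_transpose[OF \<mu> \<nu>, of E] haar_measure_transpose[OF \<nu> \<nu>, of E]
      haar_measureD(1)[OF \<mu>] haar_measureD(1)[OF \<nu>] by simp
qed

section \<open>Existence of Haar measure from random frames\<close>

text \<open>A rotation invariant law. The radius 2 leaves room for the balls of radius at most 1
  around unit vectors that are used in \<open>haar_measure_exists\<close>.\<close>

lemma prob_space_uniform_ball:
  "prob_space (uniform_measure lborel (ball (0::'a::euclidean_space) 2))"
  by (intro prob_space_uniform_measure) (simp_all add: emeasure_ball less_imp_neq[OF unit_ball_vol_pos, symmetric])

lemma emeasure_uniform_ball_orthogonal:
  fixes f :: "real^'m \<Rightarrow> real^'m"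
  assumes f: "orthogonal_transformation f" and A: "A \<in> sets borel"
  shows "emeasure (uniform_measure lborel (ball 0 2)) (f -` A) = emeasure (uniform_measure lborel (ball 0 2)) A"
proof -
  obtain g where g: "orthogonal_transformation g" "\<And>x. g (f x) = x" "\<And>x. f (g x) = x"
    using f by (metis orthogonal_transformation_inv orthogonal_transformation_bij bij_inv_eq_iff)
  have eq: "f -` S = g ` S" for S
    by (rule image_inverse_eq_vimage[symmetric]) (use g in auto)
  have "ball 0 2 \<inter> f -` A = f -` (A \<inter> ball 0 2)"
    using orthogonal_transformation_norm[OF f] by auto
  also have "\<dots> = g ` (A \<inter> ball 0 2)" by (rule eq)
  also have "emeasure lborel \<dots> = emeasure lborel (A \<inter> ball 0 2)"
    using A by (intro emeasure_orthogonal_image[OF g(1)] le_less_trans[OF emeasure_mono emeasure_lborel_ball_finite[of 0 2]]) auto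
  finally have "emeasure lborel (ball 0 2 \<inter> f -` A) = emeasure lborel (ball 0 2 \<inter> A)"
    by (simp only: Int_commute)
  moreover have "f -` A \<in> sets borel"
    using A borel_measurable_linear[OF orthogonal_transformation_linear[OF f]]
    by (metis measurable_sets_borel)
  ultimately show ?thesis
    using A by simp
qed

lemma PiM_orthogonal_invariant:
  fixes f :: "real^'m \<Rightarrow> real^'m"
  assumes f: "orthogonal_transformation f" and I: "finite I"
  defines "P \<equiv> Pi\<^sub>M I (\<lambda>_. uniform_measure lborel (ball 0 2))"
  shows "distr P P (\<lambda>a. \<lambda>k\<in>I. f (a k)) = P"
proof -
  interpret p: prob_space "uniform_measure lborel (ball (0::real^'m) 2)"
    by (rule prob_space_uniform_ball)
  interpret product_prob_space "\<lambda>_::'a. uniform_measure lborel (ball (0::real^'m) 2)" by standard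
  have fm [measurable]: "f \<in> borel_measurable borel"
    by (rule borel_measurable_linear[OF orthogonal_transformation_linear[OF f]])
  have meas: "(\<lambda>a. \<lambda>k\<in>I. f (a k)) \<in> measurable P P"
    unfolding P_def by measurable
  show ?thesis
    unfolding P_def
  proof (rule PiM_eqI[OF I])
    fix A assume A: "\<And>i. i \<in> I \<Longrightarrow> A i \<in> sets (uniform_measure lborel (ball (0::real^'m) 2))"
    have "(\<lambda>a. \<lambda>k\<in>I. f (a k)) -` Pi\<^sub>E I A \<inter> space P = Pi\<^sub>E I (\<lambda>i. f -` A i)"
      by (auto simp: P_def space_PiM PiE_iff)
    moreover have "f -` A i \<in> sets borel" if "i \<in> I" for i
      using A[OF that] by (intro measurable_sets_borel[OF fm]) simp
    ultimately show "emeasure (distr (Pi\<^sub>M I (\<lambda>_. uniform_measure lborel (ball 0 2))) (Pi\<^sub>M I (\<lambda>_. uniform_measure lborel (ball 0 2))) (\<lambda>a. \<lambda>k\<in>I. f (a k))) (Pi\<^sub>E I A) =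
      (\<Prod>i\<in>I. emeasure (uniform_measure lborel (ball 0 2)) (A i))"
      using meas A I
      by (simp add: emeasure_distr P_def emeasure_PiM emeasure_uniform_ball_orthogonal[OF f] sets_PiM_I_finite del: emeasure_uniform_measure)
  qed simp
qed

text \<open>Since \<open>sgn 0 = 0\<close>, the recursion is total and measurable also on linearly
  dependent families.\<close>

fun gram_schmidt :: "(nat \<Rightarrow> 'a::real_inner) \<Rightarrow> nat \<Rightarrow> 'a" where
  "gram_schmidt a k = sgn (a k - (\<Sum>j<k. (gram_schmidt a j \<bullet> a k) *\<^sub>R gram_schmidt a j))"

declare gram_schmidt.simps [simp del]

definition gs_residual :: "(nat \<Rightarrow> 'a::real_inner) \<Rightarrow> nat \<Rightarrow> 'a" where
  "gs_residual a k = a k - (\<Sum>j<k. (gram_schmidt a j \<bullet> a k) *\<^sub>R gram_schmidt a j)"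

lemma gram_schmidt_eq: "gram_schmidt a k = sgn (gs_residual a k)"
  by (subst gram_schmidt.simps) (simp add: gs_residual_def)

lemma gram_schmidt_orthonormal:
  assumes "\<And>k. k < m \<Longrightarrow> gs_residual a k \<noteq> 0" "i < m" "j < m"
  shows "gram_schmidt a i \<bullet> gram_schmidt a j = (if i = j then 1 else 0)"
proof -
  have "\<forall>i\<le>k. \<forall>j\<le>k. gram_schmidt a i \<bullet> gram_schmidt a j = (if i = j then 1 else 0)" if "k < m" for k
    using that
  proof (induction k rule: less_induct)
    case (less k)
    have IH: "gram_schmidt a i \<bullet> gram_schmidt a j = (if i = j then 1 else 0)" if "i < k" "j < k" for i j
      using less.IH[of "max i j"] less.prems that by auto
    have orth: "gram_schmidt a i \<bullet> gram_schmidt a k = 0" if "i < k" for i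
    proof -
      have "gram_schmidt a i \<bullet> gs_residual a k =
          gram_schmidt a i \<bullet> a k - (\<Sum>j<k. if j = i then gram_schmidt a j \<bullet> a k else 0)"
        unfolding gs_residual_def inner_diff_right inner_sum_right
        using that by (intro arg_cong2[where f = "(-)"] sum.cong) (auto simp: IH)
      then have "gram_schmidt a i \<bullet> gs_residual a k = 0" using that by simp
      then show ?thesis by (simp add: gram_schmidt_eq[of a k] sgn_div_norm)
    qed
    have "norm (gram_schmidt a k) = 1"
      using assms(1)[OF less.prems] by (simp add: gram_schmidt_eq norm_sgn)
    then have "gram_schmidt a k \<bullet> gram_schmidt a k = 1"
      by (simp add: norm_eq_1)
    then show ?case
      using IH orth by (auto simp: le_less inner_commute)
  qed
  then show ?thesis
    using assms(2,3) by (metis max.cobounded1 max.cobounded2 max_less_iff_conj)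
qed

text \<open>The process consists of inner products, norms and linear combinations, all of which an
  isometry respects. This is the source of the invariance of the measure constructed below.\<close>

lemma gram_schmidt_equivariant:
  assumes f: "orthogonal_transformation f" and "\<And>k. k < m \<Longrightarrow> b k = f (a k)" and "k < m"
  shows "gs_residual b k = f (gs_residual a k)" "gram_schmidt b k = f (gram_schmidt a k)"
proof -
  note lin = orthogonal_transformation_linear[OF f]
  have fi: "f x \<bullet> f y = x \<bullet> y" for x y
    using f by (simp add: orthogonal_transformation_def)
  have "gs_residual b k = f (gs_residual a k) \<and> gram_schmidt b k = f (gram_schmidt a k)"
    using assms(3)
  proof (induction k rule: less_induct)
    case (less k)
    have "gs_residual b k = f (gs_residual a k)"
      using less assms(2)
      by (simp add: gs_residual_def linear_diff[OF lin] linear_sum[OF lin] linear_scale[OF lin] fi)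
    moreover have "norm (f x) = norm x" for x by (rule orthogonal_transformation_norm[OF f])
    ultimately show ?case
      by (simp add: gram_schmidt_eq sgn_div_norm linear_scale[OF lin])
  qed
  then show "gs_residual b k = f (gs_residual a k)" "gram_schmidt b k = f (gram_schmidt a k)" by auto
qed

lemma borel_measurable_gram_schmidt:
  fixes a :: "'b \<Rightarrow> nat \<Rightarrow> 'a::euclidean_space"
  assumes "\<And>k. k < m \<Longrightarrow> (\<lambda>x. a x k) \<in> borel_measurable M" "k < m"
  shows "(\<lambda>x. gs_residual (a x) k) \<in> borel_measurable M" "(\<lambda>x. gram_schmidt (a x) k) \<in> borel_measurable M"
proof -
  have "(\<lambda>x. gs_residual (a x) k) \<in> borel_measurable M \<and> (\<lambda>x. gram_schmidt (a x) k) \<in> borel_measurable M"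
    using assms(2)
  proof (induction k rule: less_induct)
    case (less k)
    have [measurable]: "(\<lambda>x. a x k) \<in> borel_measurable M" using assms(1) less.prems by simp
    have [measurable]: "(\<lambda>x. gram_schmidt (a x) j) \<in> borel_measurable M" if "j \<in> {..<k}" for j
      using less that by auto
    have [measurable]: "(\<lambda>x. gs_residual (a x) k) \<in> borel_measurable M"
      unfolding gs_residual_def by measurable
    show ?case unfolding gram_schmidt_eq sgn_div_norm by measurable
  qed
  then show "(\<lambda>x. gs_residual (a x) k) \<in> borel_measurable M" "(\<lambda>x. gram_schmidt (a x) k) \<in> borel_measurable M"
    by auto
qed

text \<open>Near an orthonormal family the Gram matrix is diagonally dominant.\<close>

lemma gs_residual_nonzero_near_orthonormal:
  fixes a c :: "nat \<Rightarrow> 'a::euclidean_space"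
  assumes c: "\<And>i j. i < m \<Longrightarrow> j < m \<Longrightarrow> c i \<bullet> c j = (if i = j then 1 else 0)"
    and a: "\<And>k. k < m \<Longrightarrow> norm (a k - c k) \<le> d" and d: "real m * d < 1" and k: "k < m"
  shows "gs_residual a k \<noteq> 0"
proof
  assume 0: "gs_residual a k = 0"
  have gs: "gram_schmidt a j \<in> span (a ` {..j})" for j
  proof (induction j rule: less_induct)
    case (less j)
    have "gram_schmidt a i \<in> span (a ` {..j})" if "i < j" for i
    proof -
      have "a ` {..i} \<subseteq> a ` {..j}" using that by (intro image_mono) auto
      then show ?thesis using less[OF that] span_mono by blast
    qed
    then have "gs_residual a j \<in> span (a ` {..j})"
      unfolding gs_residual_def by (intro span_diff span_sum span_scale) (auto intro: span_base)
    then show ?case by (simp add: gram_schmidt_eq sgn_div_norm span_scale)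
  qed
  have "gram_schmidt a j \<in> span (a ` {..<k})" if "j < k" for j
  proof -
    have "a ` {..j} \<subseteq> a ` {..<k}" using that by (intro image_mono) auto
    then show ?thesis using gs[of j] span_mono by blast
  qed
  then have "(\<Sum>j<k. (gram_schmidt a j \<bullet> a k) *\<^sub>R gram_schmidt a j) \<in> span (a ` {..<k})"
    by (intro span_sum span_scale) auto
  then have "a k \<in> span (a ` {..<k})"
    using 0 by (simp add: gs_residual_def)
  then have "\<exists>s. a k = (\<Sum>j<k. s j *\<^sub>R a j)"
  proof (induction rule: span_induct_alt)
    case base
    show ?case by (intro exI[of _ "\<lambda>_. 0"]) simp
  next
    case (step r x y)
    then obtain s j where s: "y = (\<Sum>j<k. s j *\<^sub>R a j)" and j: "j < k" "x = a j" by auto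
    have "(\<Sum>i<k. (s i + (if i = j then r else 0)) *\<^sub>R a i) = y + (\<Sum>i<k. if i = j then r *\<^sub>R a i else 0)"
      unfolding s sum.distrib[symmetric] by (intro sum.cong) (auto simp: scaleR_add_left)
    also have "\<dots> = r *\<^sub>R x + y" using j by simp
    finally show ?case
      by (intro exI[of _ "\<lambda>i. s i + (if i = j then r else 0)"]) (rule sym)
  qed
  then obtain s where s: "a k = (\<Sum>j<k. s j *\<^sub>R a j)" ..
  \<comment> \<open>A vanishing residual makes \<open>a k\<close> a combination of its predecessors,
    that is, a linear relation with coefficient -1 at \<open>k\<close>.\<close>
  define t where "t j = (if j = k then -1 else if j < k then s j else 0)" for j
  have t0: "(\<Sum>j<m. t j *\<^sub>R a j) = 0"
  proof -
    have "(\<Sum>j<m. t j *\<^sub>R a j) = (\<Sum>j\<in>insert k {..<k}. t j *\<^sub>R a j)"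
      using k by (intro sum.mono_neutral_right) (auto simp: t_def)
    then show ?thesis by (simp add: t_def s)
  qed
  \<comment> \<open>Pair the relation with the \<open>c i\<close> of the largest coefficient: the
    result is \<open>t i\<close> up to an error of at most T m d < T, although
    \<bar>\<open>t i\<close>\<bar> = T.\<close>
  define T where "T = Max ((\<lambda>j. \<bar>t j\<bar>) ` {..<m})"
  have T: "\<bar>t j\<bar> \<le> T" if "j < m" for j
    using that by (auto simp: T_def)
  have "T \<in> (\<lambda>j. \<bar>t j\<bar>) ` {..<m}"
    unfolding T_def using k by (intro Max_in) auto
  then obtain i where i: "i < m" "T = \<bar>t i\<bar>" by auto
  have T1: "1 \<le> T" using T[OF k] by (simp add: t_def)
  have "0 = c i \<bullet> (\<Sum>j<m. t j *\<^sub>R a j)" using t0 by simp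
  also have "\<dots> = (\<Sum>j<m. t j * (c i \<bullet> c j)) + (\<Sum>j<m. t j * (c i \<bullet> (a j - c j)))"
    by (simp add: inner_sum_right inner_diff_right sum.distrib[symmetric] algebra_simps)
  also have "(\<Sum>j<m. t j * (c i \<bullet> c j)) = (\<Sum>j<m. if j = i then t j else 0)"
    using c i by (intro sum.cong) auto
  also have "\<dots> = t i" using i by simp
  finally have "\<bar>t i\<bar> = \<bar>\<Sum>j<m. t j * (c i \<bullet> (a j - c j))\<bar>" by linarith
  also have "\<dots> \<le> (\<Sum>j<m. \<bar>t j * (c i \<bullet> (a j - c j))\<bar>)" by (rule sum_abs)
  also have "\<dots> \<le> (\<Sum>j<m. T * d)"
  proof (rule sum_mono)
    fix j assume "j \<in> {..<m}"
    then have j: "j < m" by simp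
    have "norm (c i) = 1" using c[OF i(1) i(1)] by (simp add: norm_eq_1)
    then have "\<bar>c i \<bullet> (a j - c j)\<bar> \<le> d"
      using Cauchy_Schwarz_ineq2[of "c i" "a j - c j"] a[OF j] by simp
    then show "\<bar>t j * (c i \<bullet> (a j - c j))\<bar> \<le> T * d"
      using T[OF j] T1 by (simp add: abs_mult mult_mono)
  qed
  also have "\<dots> = T * (real m * d)" by simp
  also have "\<dots> < T * 1" using d T1 by (intro mult_strict_left_mono) auto
  finally show False using i by simp
qed

text \<open>Draw independent vectors uniformly from a ball, replace the first by \<open>e\<close>,
  condition on linear independence and orthonormalize; the matrix that takes a fixed orthonormal
  frame to the result is a random element of the group. Multiplying it on the left by a group
  element amounts to rotating all drawn vectors, which leaves their law unchanged, and the group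
  fixes \<open>e\<close>.\<close>

lemma haar_measure_exists:
  fixes u :: "real^'m"
  assumes "u \<noteq> 0"
  shows "\<exists>\<mu>. haar_measure (sym_group u) \<mu>"
proof -
  let ?G = "sym_group u" and ?m = "CARD('m)"
  define e where "e = u /\<^sub>R norm u"
  have ne: "norm e = 1" using assms by (simp add: e_def)
  have ue: "u = norm u *\<^sub>R e" using assms by (simp add: e_def)
  have Qe: "Q *v e = e" if "Q \<in> ?G" for Q
    using that by (simp add: e_def sym_group_def matrix_vector_mult_scaleR)
  obtain \<sigma> where \<sigma>: "bij_betw \<sigma> {..<?m} (UNIV :: 'm set)"
    using ex_bij_betw_nat_finite[of "UNIV :: 'm set"] by (auto simp: atLeast0LessThan)
  have "\<exists>f :: real^'m \<Rightarrow> real^'m. orthogonal_transformation f \<and> f (axis (\<sigma> 0) 1) = e"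
  proof (rule orthogonal_transformation_exists_1[OF norm_axis_1[of "\<sigma> 0"] ne])
    fix f :: "real^'m \<Rightarrow> real^'m" assume "orthogonal_transformation f" "f (axis (\<sigma> 0) 1) = e"
    then show ?thesis by (intro exI[of _ f] conjI)
  qed
  then obtain f :: "real^'m \<Rightarrow> real^'m" where f: "orthogonal_transformation f" "f (axis (\<sigma> 0) 1) = e"
    by blast
  \<comment> \<open>A fixed orthonormal frame that starts with \<open>e\<close>, so that a matrix
    taking it to a frame starting with \<open>e\<close> fixes \<open>e\<close>.\<close>
  define c where "c k = f (axis (\<sigma> k) 1)" for k
  have c: "c i \<bullet> c j = (if i = j then 1 else 0)" if "i < ?m" "j < ?m" for i j
    using f(1) \<sigma> that
    by (auto simp: c_def orthogonal_transformation_def inner_axis_axis bij_betw_def inj_on_eq_iff)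
  have c0: "c 0 = e" by (simp add: c_def f)
  have expand: "(\<Sum>k<?m. (c k \<bullet> x)\<^sup>2) = (norm x)\<^sup>2" for x
  proof -
    obtain y where y: "x = f y"
      using orthogonal_transformation_surj[OF f(1)] by (metis surjD)
    have "(\<Sum>k<?m. (c k \<bullet> x)\<^sup>2) = (\<Sum>k<?m. (y $ \<sigma> k)\<^sup>2)"
      using f(1) by (simp add: c_def y orthogonal_transformation_def inner_axis')
    also have "\<dots> = (\<Sum>i\<in>UNIV. (y $ i)\<^sup>2)"
      by (rule sum.reindex_bij_betw[OF \<sigma>])
    also have "\<dots> = (norm y)\<^sup>2" by (simp add: norm_vec_def L2_set_def sum_nonneg)
    finally show ?thesis by (simp add: y orthogonal_transformation_norm[OF f(1)])
  qed
  define \<rho> where "\<rho> = uniform_measure lborel (ball (0::real^'m) 2)"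
  define P where "P = Pi\<^sub>M {..<?m} (\<lambda>_. \<rho>)"
  interpret \<rho>: prob_space \<rho> unfolding \<rho>_def by (rule prob_space_uniform_ball)
  interpret product_prob_space "\<lambda>_::nat. \<rho>" "{..<?m}" by standard
  interpret PS: prob_space P unfolding P_def by (rule prob_space_PiM) (rule \<rho>.prob_space_axioms)
  \<comment> \<open>Overwriting the first vector commutes with the group, because the group fixes
    \<open>e\<close>.\<close>
  define b where "b a = a(0 := e)" for a :: "nat \<Rightarrow> real^'m"
  define Good where "Good = {a \<in> space P. \<forall>k<?m. gs_residual (b a) k \<noteq> 0}"
  have bm: "(\<lambda>a. b a k) \<in> borel_measurable P" if "k < ?m" for k
  proof (cases "k = 0")
    case False
    have "(\<lambda>a. a k) \<in> measurable P \<rho>"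
      unfolding P_def using that by (intro measurable_component_singleton) simp
    then show ?thesis using False by (simp add: b_def \<rho>_def cong: measurable_cong_sets)
  qed (simp add: b_def)
  note meas = borel_measurable_gram_schmidt[where a = b and m = ?m, OF bm]
  have [measurable]: "Good \<in> sets P"
  proof -
    have [measurable]: "(\<lambda>a. gs_residual (b a) k) \<in> borel_measurable P" if "k \<in> {..<?m}" for k
      using meas(1) that by simp
    have "{a \<in> space P. \<forall>k\<in>{..<?m}. gs_residual (b a) k \<noteq> 0} \<in> sets P"
      by measurable
    then show ?thesis by (simp add: Good_def Ball_def)
  qed
  have pos: "emeasure P Good \<noteq> 0"
  proof -
    \<comment> \<open>Small enough for \<open>gs_residual_nonzero_near_orthonormal\<close>, which
      asks for m d < 1; moreover d \<le> 1 keeps the balls around the \<open>c k\<close> inside the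
      ball of radius 2. So the good event contains a box of positive probability.\<close>
    define d where "d = 1 / (real ?m + 1)"
    have d: "0 < d" "d \<le> 1" "real ?m * d < 1" by (auto simp: d_def field_simps)
    let ?Box = "Pi\<^sub>E {..<?m} (\<lambda>k. ball (c k) d)"
    have "?Box \<subseteq> Good"
    proof
      fix a assume a: "a \<in> ?Box"
      have "norm (b a k - c k) \<le> d" if "k < ?m" for k
      proof (cases "k = 0")
        case False
        have "a k \<in> ball (c k) d" using that by (intro PiE_mem[OF a]) simp
        then have "norm (a k - c k) < d"
          by (simp only: mem_ball dist_norm norm_minus_commute[of "c k"])
        then show ?thesis using False by (simp add: b_def)
      qed (use d in \<open>simp add: b_def c0\<close>)
      then have "\<forall>k<?m. gs_residual (b a) k \<noteq> 0"
        by (intro allI impI gs_residual_nonzero_near_orthonormal[OF c _ d(3)])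
      moreover have "a \<in> space P" using a by (auto simp: P_def space_PiM \<rho>_def PiE_iff)
      ultimately show "a \<in> Good" by (simp add: Good_def)
    qed
    then have "emeasure P ?Box \<le> emeasure P Good" by (rule emeasure_mono) simp
    moreover have "emeasure P ?Box = (\<Prod>k<?m. emeasure \<rho> (ball (c k) d))"
      unfolding P_def by (intro emeasure_PiM) (auto simp: \<rho>_def)
    moreover have "emeasure \<rho> (ball (c k) d) \<noteq> 0" if "k < ?m" for k
    proof -
      have "norm (c k) = 1" using c[OF that that] by (simp add: norm_eq_1)
      then have "ball (c k) d \<subseteq> ball 0 2"
        using d by (simp add: ball_subset_ball_iff dist_norm)
      then have "ball 0 2 \<inter> ball (c k) d = ball (c k) d" by auto
      then show ?thesis
        using d by (simp add: \<rho>_def emeasure_ball less_imp_neq[OF unit_ball_vol_pos, symmetric]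
          ennreal_divide_eq_0_iff ennreal_mult_eq_top_iff)
    qed
    ultimately show ?thesis by (auto simp: prod_zero_iff)
  qed
  define U where "U = uniform_measure P Good"
  interpret U: prob_space U
    unfolding U_def using pos by (intro prob_space_uniform_measure) auto
  \<comment> \<open>The sum of the q c\<open>\<^sup>T\<close> over the pairs of a vector c of the
    fixed frame and the corresponding orthonormalized vector q, so c goes to q.\<close>
  define \<Phi> where "\<Phi> a = (\<chi> i j. \<Sum>k<?m. gram_schmidt (b a) k $ i * c k $ j)" for a
  have \<Phi>v: "\<Phi> a *v x = (\<Sum>k<?m. (c k \<bullet> x) *\<^sub>R gram_schmidt (b a) k)" for a x
    unfolding \<Phi>_def matrix_vector_mult_def inner_vec_def vec_eq_iff
    by (simp add: sum_distrib_left sum_distrib_right, subst sum.swap) (simp add: mult_ac)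
  have \<Phi>G: "\<Phi> a \<in> ?G" if "a \<in> Good" for a
  proof -
    have on: "gram_schmidt (b a) i \<bullet> gram_schmidt (b a) j = (if i = j then 1 else 0)" if "i < ?m" "j < ?m" for i j
      using \<open>a \<in> Good\<close> that by (intro gram_schmidt_orthonormal[of ?m]) (auto simp: Good_def)
    have "norm (\<Phi> a *v x) = norm x" for x
    proof -
      have "(norm (\<Phi> a *v x))\<^sup>2 = (\<Sum>i<?m. \<Sum>j<?m. if j = i then (c i \<bullet> x) * (c j \<bullet> x) else 0)"
        unfolding \<Phi>v power2_norm_eq_inner inner_sum_left inner_sum_right
        by (intro sum.cong refl) (auto simp: on)
      also have "\<dots> = (norm x)\<^sup>2" by (simp add: power2_eq_square[symmetric] expand)
      finally show ?thesis by (simp add: power2_eq_iff_nonneg)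
    qed
    then have "orthogonal_transformation ((*v) (\<Phi> a))"
      by (simp add: orthogonal_transformation)
    then have "orthogonal_matrix (\<Phi> a)"
      by (simp add: orthogonal_transformation_matrix matrix_of_matrix_vector_mul)
    moreover have "\<Phi> a *v e = e"
    proof -
      have "gram_schmidt (b a) 0 = e"
        using ne by (subst gram_schmidt_eq) (simp add: gs_residual_def b_def sgn_div_norm)
      moreover have "c k \<bullet> e = (if k = 0 then 1 else 0)" if "k < ?m" for k
        using c[OF that, of 0] by (simp only: c0 zero_less_card_finite)
      then have "(\<Sum>k<?m. (c k \<bullet> e) *\<^sub>R gram_schmidt (b a) k) = (\<Sum>k<?m. if k = 0 then gram_schmidt (b a) k else 0)"
        by (intro sum.cong) auto
      ultimately show ?thesis by (simp add: \<Phi>v)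
    qed
    then have "\<Phi> a *v u = u" by (subst (1 2) ue) (simp add: matrix_vector_mult_scaleR)
    ultimately show ?thesis by (simp add: sym_group_def)
  qed
  have \<Phi>m: "\<Phi> \<in> borel_measurable P"
  proof -
    have [measurable]: "(\<lambda>a. gram_schmidt (b a) k) \<in> borel_measurable P" if "k \<in> {..<?m}" for k
      using meas(2) that by simp
    have "(\<lambda>x::real^'m. x $ i) \<in> borel_measurable borel" for i
      by (intro borel_measurable_continuous_onI continuous_intros)
    note [measurable] = measurable_compose[OF _ this]
    have "(\<lambda>a. \<Phi> a \<bullet> axis i (axis j 1)) \<in> borel_measurable P" for i j
      unfolding \<Phi>_def by (simp add: inner_axis) measurable
    then show ?thesis
      by (subst borel_measurable_euclidean_space) (auto simp: Basis_vec_def)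
  qed
  \<comment> \<open>The default \<open>mat 1\<close> keeps all values in the group; it is taken only
    off \<open>Good\<close>, which is a null set for \<open>U\<close>.\<close>
  define \<Psi> where "\<Psi> a = (if a \<in> Good then \<Phi> a else mat 1)" for a
  have one: "mat 1 \<in> ?G" by (simp add: sym_group_def orthogonal_matrix_id)
  have \<Psi>m: "\<Psi> \<in> measurable U (restrict_space borel ?G)"
  proof (rule measurable_restrict_space2)
    show "\<Psi> \<in> space U \<rightarrow> ?G" using \<Phi>G one by (auto simp: \<Psi>_def)
    have "\<Psi> \<in> borel_measurable P" unfolding \<Psi>_def using \<Phi>m by measurable
    then show "\<Psi> \<in> borel_measurable U" by (simp add: U_def cong: measurable_cong_sets)
  qed
  define \<mu> where "\<mu> = distr U (restrict_space borel ?G) \<Psi>"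
  interpret M: prob_space \<mu> unfolding \<mu>_def by (rule U.prob_space_distr[OF \<Psi>m])
  define S where "S A = Good \<inter> (\<Psi> -` A \<inter> space P)" for A
  have em: "emeasure \<mu> A = emeasure P (S A) / emeasure P Good" "S A \<in> sets P" if "A \<in> sets \<mu>" for A
  proof -
    have "\<Psi> -` A \<inter> space P \<in> sets P"
      using measurable_sets[OF \<Psi>m, of A] that by (simp add: \<mu>_def U_def)
    then show "emeasure \<mu> A = emeasure P (S A) / emeasure P Good" "S A \<in> sets P"
      using that \<Psi>m by (simp_all add: \<mu>_def emeasure_distr U_def S_def)
  qed
  have "emeasure \<mu> ((**) Q ` A) = emeasure \<mu> A" if Q: "Q \<in> ?G" and A: "A \<in> sets \<mu>" for Q A
  proof -
    \<comment> \<open>The transpose appears because the image of \<open>A\<close> under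
      multiplication by \<open>Q\<close> is the preimage of \<open>A\<close> under multiplication by
      \<open>transpose Q\<close>.\<close>
    define g where "g x = transpose Q *v x" for x
    have QT: "transpose Q \<in> ?G" by (rule sym_group_transpose[OF Q])
    then have g: "orthogonal_transformation g"
      by (simp add: g_def[abs_def] orthogonal_transformation_matrix sym_group_def matrix_of_matrix_vector_mul
          del: transpose_matrix_vector)
    \<comment> \<open>Rotating every drawn vector preserves \<open>P\<close> and maps \<Phi> to
      \<open>transpose Q\<close> times \<Phi>; hence the event for the moved set is the preimage
      under \<open>R\<close> of the event for \<open>A\<close>.\<close>
    define R where "R a = (\<lambda>k\<in>{..<?m}. g (a k))" for a :: "nat \<Rightarrow> real^'m"
    have inv: "distr P P R = P"
      unfolding P_def \<rho>_def R_def[abs_def] by (rule PiM_orthogonal_invariant[OF g]) simp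
    have [measurable]: "g \<in> borel_measurable borel"
      by (rule borel_measurable_linear[OF orthogonal_transformation_linear[OF g]])
    have Rm: "R \<in> measurable P P"
      unfolding P_def R_def[abs_def] \<rho>_def by measurable
    have QA: "(**) Q ` A \<in> sets \<mu>"
    proof -
      have A': "A \<in> sets (restrict_space borel ?G)" using A by (simp add: \<mu>_def)
      have "(\<lambda>B. transpose Q ** B) \<in> borel_measurable (restrict_space borel ?G)"
        by (intro borel_measurable_matrix_mult measurable_restrict_space1) auto
      then have "(\<lambda>B. transpose Q ** B) \<in> measurable (restrict_space borel ?G) (restrict_space borel ?G)"
        by (rule measurable_restrict_space2[rotated]) (auto simp: space_restrict_space sym_group_mult QT)
      then have "(\<lambda>B. transpose Q ** B) -` A \<inter> space (restrict_space borel ?G) \<in> sets (restrict_space borel ?G)"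
        using A' by (rule measurable_sets)
      also have "(\<lambda>B. transpose Q ** B) -` A \<inter> space (restrict_space borel ?G) = (**) Q ` A"
      proof -
        have "B \<in> ?G" if "transpose Q ** B \<in> A" for B
        proof -
          have "transpose Q ** B \<in> ?G"
            using sets.sets_into_space[OF A'] that by (auto simp: space_restrict_space)
          from sym_group_mult[OF Q this] show ?thesis by (simp add: sym_group_cancel[OF Q])
        qed
        then show ?thesis by (auto simp: sym_group_image[OF Q] space_restrict_space)
      qed
      finally show ?thesis by (simp add: \<mu>_def)
    qed
    have "S ((**) Q ` A) = R -` S A \<inter> space P"
    proof -
      have "a \<in> S ((**) Q ` A) \<longleftrightarrow> R a \<in> S A" if a: "a \<in> space P" for a
      proof -
        have bR: "b (R a) k = g (b a k)" if "k < ?m" for k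
          using that Qe[OF QT] by (simp add: b_def R_def g_def)
        note eq = gram_schmidt_equivariant[OF g, of ?m "b (R a)" "b a", OF bR]
        have g0: "g x = 0 \<longleftrightarrow> x = 0" for x
          using orthogonal_transformation_norm[OF g, of x] by (metis norm_eq_zero)
        have Ra: "R a \<in> space P" using a by (simp add: R_def P_def space_PiM \<rho>_def)
        have good: "R a \<in> Good \<longleftrightarrow> a \<in> Good"
          using a Ra by (auto simp: Good_def eq g0)
        have "\<Phi> (R a) *v x = (transpose Q ** \<Phi> a) *v x" for x
          unfolding matrix_vector_mul_assoc[symmetric] \<Phi>v g_def[symmetric]
          using orthogonal_transformation_linear[OF g]
          by (simp add: linear_sum linear_scale eq)
        then have "\<Phi> (R a) = transpose Q ** \<Phi> a" by (simp add: matrix_eq)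
        then show ?thesis
          using a Ra good by (auto simp: S_def \<Psi>_def sym_group_image[OF Q])
      qed
      then show ?thesis by (auto simp: S_def)
    qed
    then have "emeasure P (S ((**) Q ` A)) = emeasure (distr P P R) (S A)"
      using em(2)[OF A] Rm by (simp add: emeasure_distr)
    then show ?thesis using em QA A by (simp add: inv)
  qed
  then have "haar_measure ?G \<mu>"
    unfolding haar_measure_def using M.emeasure_space_1 by (simp add: \<mu>_def)
  then show ?thesis ..
qed

lemma haar_measure_haar:
  fixes u :: "real^'m"
  assumes "u \<noteq> 0"
  shows "haar_measure (sym_group u) (haar (sym_group u))"
proof -
  have "\<exists>!\<mu>. haar_measure (sym_group u) \<mu>"
    using haar_measure_exists[OF assms] haar_measure_unique by blast
  then have "haar_measure (sym_group u) (THE \<mu>. haar_measure (sym_group u) \<mu>)"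
    by (rule theI')
  then show ?thesis by (simp add: haar_def haar_measure_def)
qed

section \<open>Second moments of an orbit\<close>

lemma haar_integral_invariant:
  fixes u :: "real^'m" and f :: "real^'m^'m \<Rightarrow> real"
  assumes \<mu>: "haar_measure (sym_group u) \<mu>" and R: "R \<in> sym_group u" and f: "f \<in> borel_measurable borel"
  shows "(LINT Q|\<mu>. f (R ** Q)) = (LINT Q|\<mu>. f Q)"
proof -
  let ?G = "sym_group u"
  note m = haar_measureD[OF \<mu>]
  have RT: "transpose R \<in> ?G" by (rule sym_group_transpose[OF R])
  have "(\<lambda>Q. R ** Q) \<in> borel_measurable \<mu>"
    by (intro borel_measurable_matrix_mult haar_measure_borel[OF \<mu>]) simp
  then have "(\<lambda>Q. R ** Q) \<in> measurable \<mu> (restrict_space borel ?G)"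
    by (rule measurable_restrict_space2[rotated]) (auto simp: m sym_group_mult R)
  then have meas: "(\<lambda>Q. R ** Q) \<in> measurable \<mu> \<mu>" by (simp cong: measurable_cong_sets add: m)
  have "distr \<mu> \<mu> (\<lambda>Q. R ** Q) = \<mu>"
  proof (rule measure_eqI)
    fix A assume "A \<in> sets (distr \<mu> \<mu> (\<lambda>Q. R ** Q))"
    then have A: "A \<in> sets \<mu>" by simp
    have AG: "A \<subseteq> ?G" using sets.sets_into_space[OF A] m by simp
    have "(\<lambda>Q. R ** Q) -` A \<inter> space \<mu> = (**) (transpose R) ` A"
    proof -
      have "Q \<in> ?G" if "R ** Q \<in> A" for Q
        using sym_group_mult[OF RT, of "R ** Q"] AG that by (auto simp: sym_group_cancel[OF R])
      then show ?thesis by (auto simp: sym_group_image[OF RT] m)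
    qed
    then show "emeasure (distr \<mu> \<mu> (\<lambda>Q. R ** Q)) A = emeasure \<mu> A"
      using meas A m(4)[OF RT A] by (simp add: emeasure_distr)
  qed simp
  moreover have "f \<in> borel_measurable \<mu>"
    using measurable_compose[OF haar_measure_borel[OF \<mu>] f] by simp
  ultimately show ?thesis
    using integral_distr[OF meas, of f] by simp
qed

lemma orthogonal_reflection:
  fixes a :: "'a::real_inner"
  assumes "a \<noteq> 0"
  shows "orthogonal_transformation (\<lambda>x. x - (2 * (a \<bullet> x) / (a \<bullet> a)) *\<^sub>R a)"
  unfolding orthogonal_transformation_def
proof (intro conjI allI)
  show "linear (\<lambda>x. x - (2 * (a \<bullet> x) / (a \<bullet> a)) *\<^sub>R a)"
    by (intro linearI) (simp_all add: inner_add_right algebra_simps add_divide_distrib)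
  show "(v - (2 * (a \<bullet> v) / (a \<bullet> a)) *\<^sub>R a) \<bullet> (w - (2 * (a \<bullet> w) / (a \<bullet> a)) *\<^sub>R a) = v \<bullet> w" for v w
    using assms by (simp add: inner_diff_left inner_diff_right inner_commute field_simps)
qed

text \<open>Only reflections along vectors orthogonal to \<open>e\<close> are used. The component of
  Q w along \<open>e\<close> is the constant \<open>s\<close>; a reflection makes the mean of the
  orthogonal part vanish, which removes the mixed terms; on the orthogonal complement of
  \<open>e\<close> invariance leaves only a multiple \<beta> of the inner product. The trace fixes
  \<beta>.\<close>

lemma haar_second_moment:
  fixes u w :: "real^'m"
  assumes u: "u \<noteq> 0" and m: "2 \<le> CARD('m)" and w: "w \<in> boundary_sphere u"
  shows "(LINT Q|haar (sym_group u). (x \<bullet> (Q *v w)) * (y \<bullet> (Q *v w))) =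
    (u \<bullet> x) * (u \<bullet> y) / (norm u)^4 +
    (x \<bullet> y - (u \<bullet> x) * (u \<bullet> y) / (norm u)\<^sup>2) / ((norm u)\<^sup>2 * (CARD('m) - 1))"
proof -
  let ?G = "sym_group u"
  define \<mu> where "\<mu> = haar ?G"
  have \<mu>: "haar_measure ?G \<mu>" unfolding \<mu>_def by (rule haar_measure_haar[OF u])
  interpret prob_space \<mu> by (rule haar_measureD[OF \<mu>])
  define F where "F x Q = x \<bullet> (Q *v w)" for x and Q :: "real^'m^'m"
  define b where "b x y = (LINT Q|\<mu>. F x Q * F y Q)" for x y
  define e where "e = u /\<^sub>R norm u"
  define s where "s = 1 / norm u"
  have ee: "e \<bullet> e = 1" using u by (simp add: e_def power2_norm_eq_inner[symmetric] power2_eq_square)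
  have ew: "e \<bullet> w = s" and nw: "(norm w)\<^sup>2 = 2 * s\<^sup>2"
    using w by (auto simp: boundary_sphere_def cone_fun_def e_def s_def divide_inverse power_mult_distrib)
  have Fb: "(\<lambda>Q. F x Q) \<in> borel_measurable borel" for x
    unfolding F_def matrix_vector_mult_def inner_vec_def
    by (intro borel_measurable_continuous_onI continuous_intros)
  note Fm = measurable_compose[OF haar_measure_borel[OF \<mu>] Fb]
  have GQ: "norm (Q *v z) = norm z" if "Q \<in> ?G" for Q z
    using that orthogonal_transformation_norm[of "(*v) Q" z]
    by (simp add: sym_group_def orthogonal_transformation_matrix matrix_of_matrix_vector_mul)
  have bound: "\<bar>F x Q\<bar> \<le> norm x * norm w" if "Q \<in> ?G" for x Q
    using Cauchy_Schwarz_ineq2[of x "Q *v w"] GQ[OF that, of w] by (simp add: F_def)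
  have intF: "integrable \<mu> (F x)" for x
    by (rule integrable_const_bound[of _ "norm x * norm w"])
       (auto intro!: AE_I2 simp: haar_measureD[OF \<mu>] bound Fm)
  have intFF: "integrable \<mu> (\<lambda>Q. F x Q * F y Q)" for x y
    by (rule integrable_const_bound[of _ "(norm x * norm w) * (norm y * norm w)"])
       (auto intro!: AE_I2 mult_mono borel_measurable_times Fm simp: haar_measureD[OF \<mu>] bound abs_mult)
  have b_add: "b (x + y) z = b x z + b y z" for x y z
    using intFF by (simp add: b_def F_def inner_add_left distrib_right)
  have b_scale: "b (c *\<^sub>R x) z = c * b x z" for c x z
    by (simp add: b_def F_def mult.assoc)
  have b_sym: "b x y = b y x" for x y by (simp add: b_def mult.commute)
  have b_right: "b z (x + y) = b z x + b z y" "b z (c *\<^sub>R x) = c * b z x" for x y z c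
    using b_add[of x y z] b_scale[of c x z] by (simp_all add: b_sym[of z])
  have Fe: "F e Q = s" if "Q \<in> ?G" for Q
  proof -
    have "transpose Q *v e = e"
      using sym_group_transpose(1)[OF that] by (simp add: sym_group_def e_def matrix_vector_mult_scaleR)
    moreover have "e \<bullet> (Q *v w) = (transpose Q *v e) \<bullet> w"
      by (simp add: transpose_matrix_vector dot_lmul_matrix)
    ultimately show ?thesis by (simp add: F_def ew)
  qed
  have reflect: "\<exists>R\<in>?G. \<forall>x Q. F x (R ** Q) = F (x - (2 * (a \<bullet> x) / (a \<bullet> a)) *\<^sub>R a) Q" if a: "a \<noteq> 0" "e \<bullet> a = 0" for a
  proof -
    define r where "r x = x - (2 * (a \<bullet> x) / (a \<bullet> a)) *\<^sub>R a" for x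
    have r: "orthogonal_transformation r"
      unfolding r_def[abs_def] by (rule orthogonal_reflection[OF a(1)])
    have rv: "matrix r *v x = r x" for x
      using orthogonal_transformation_linear[OF r] by (simp add: matrix_works linear_matrix_vector_mul_eq)
    have "u \<bullet> a = 0" using a u by (simp add: e_def)
    then have "matrix r \<in> ?G"
      using r by (simp add: sym_group_def rv orthogonal_transformation_matrix) (simp add: r_def inner_commute)
    moreover have "F x (matrix r ** Q) = F (r x) Q" for x Q
      unfolding F_def matrix_vector_mul_assoc[symmetric] rv
      by (simp add: r_def inner_diff_left inner_diff_right inner_commute)
    ultimately show ?thesis by (auto simp: r_def)
  qed
  \<comment> \<open>The reflection along \<open>x\<close> itself sends \<open>x\<close> to
    \<open>- x\<close>.\<close>
  have F0: "(LINT Q|\<mu>. F x Q) = 0" if x: "e \<bullet> x = 0" for x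
  proof (cases "x = 0")
    case False
    obtain R where R: "R \<in> ?G" "\<And>Q. F x (R ** Q) = F (- x) Q"
      using reflect[OF False x] False by (auto simp: scaleR_2 algebra_simps)
    have "(LINT Q|\<mu>. F x Q) = (LINT Q|\<mu>. F x (R ** Q))"
      by (rule haar_integral_invariant[OF \<mu> R(1) Fb, symmetric])
    also have "\<dots> = - (LINT Q|\<mu>. F x Q)"
      by (simp add: R) (simp add: F_def)
    finally show ?thesis by simp
  qed (simp add: F_def)
  have be: "b e z = s * (LINT Q|\<mu>. F z Q)" for z
  proof -
    have "b e z = (LINT Q|\<mu>. s * F z Q)"
      unfolding b_def by (intro Bochner_Integration.integral_cong) (auto simp: Fe haar_measureD[OF \<mu>])
    then show ?thesis by simp
  qed
  have bee: "b e e = s\<^sup>2"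
  proof -
    have "(LINT Q|\<mu>. F e Q) = (LINT Q|\<mu>. s)"
      by (intro Bochner_Integration.integral_cong) (auto simp: Fe haar_measureD[OF \<mu>])
    then show ?thesis by (simp add: be power2_eq_square prob_space)
  qed
  have b_eq_norm: "b x x = b y y" if xy: "e \<bullet> x = 0" "e \<bullet> y = 0" "norm x = norm y" for x y
  proof (cases "x = y")
    case False
    have "x \<bullet> x = y \<bullet> y" using xy by (simp add: norm_eq)
    \<comment> \<open>The reflection along \<open>x - y\<close> takes \<open>x\<close> to
      \<open>y\<close> when the two norms agree.\<close>
    then have "2 * ((x - y) \<bullet> x) = (x - y) \<bullet> (x - y)"
      by (simp add: inner_diff_left inner_diff_right inner_commute)
    then have *: "x - (2 * ((x - y) \<bullet> x) / ((x - y) \<bullet> (x - y))) *\<^sub>R (x - y) = y"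
      using False by simp
    obtain R where R: "R \<in> ?G" "\<And>Q. F x (R ** Q) = F y Q"
      using reflect[of "x - y"] False xy * by (auto simp: inner_diff_right)
    have "b x x = (LINT Q|\<mu>. F x (R ** Q) * F x (R ** Q))"
      unfolding b_def by (rule haar_integral_invariant[OF \<mu> R(1), symmetric]) (intro borel_measurable_times Fb)
    then show ?thesis by (simp add: R b_def)
  qed simp
  have "dim {x. e \<bullet> x = 0} \<noteq> 0"
  proof -
    have "e \<noteq> 0" using ee by auto
    then show ?thesis using dim_hyperplane[of e] m by simp
  qed
  then obtain z where z: "e \<bullet> z = 0" "z \<noteq> 0" by (auto simp: dim_eq_0)
  define \<beta> where "\<beta> = b z z / (norm z)\<^sup>2"
  have quad: "b x x = \<beta> * (x \<bullet> x)" if x: "e \<bullet> x = 0" for x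
  proof -
    have "b x x = b ((norm x / norm z) *\<^sub>R z) ((norm x / norm z) *\<^sub>R z)"
      using x z by (intro b_eq_norm) auto
    also have "\<dots> = (norm x / norm z)\<^sup>2 * b z z"
      by (simp only: b_scale b_right) (simp add: power2_eq_square)
    finally show ?thesis by (simp add: \<beta>_def power2_norm_eq_inner power_divide)
  qed
  have bil: "b x y = \<beta> * (x \<bullet> y)" if xy: "e \<bullet> x = 0" "e \<bullet> y = 0" for x y
  proof -
    have "b (x + y) (x + y) = b x x + 2 * b x y + b y y"
      by (simp add: b_add b_right b_sym[of y x])
    moreover have "b (x + y) (x + y) = \<beta> * ((x + y) \<bullet> (x + y))"
      using xy by (intro quad) (simp add: inner_add_right)
    ultimately show ?thesis
      using quad[OF xy(1)] quad[OF xy(2)] by (simp add: inner_add_left inner_add_right inner_commute algebra_simps)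
  qed
  have formula: "b x y = s\<^sup>2 * (e \<bullet> x) * (e \<bullet> y) + \<beta> * (x \<bullet> y - (e \<bullet> x) * (e \<bullet> y))" for x y
  proof -
    define p where "p x = x - (e \<bullet> x) *\<^sub>R e" for x
    have p: "x = (e \<bullet> x) *\<^sub>R e + p x" "e \<bullet> p x = 0" for x by (simp_all add: p_def inner_diff_right ee)
    have "b x y = b ((e \<bullet> x) *\<^sub>R e + p x) ((e \<bullet> y) *\<^sub>R e + p y)" using p(1) by metis
    also have "\<dots> = (e \<bullet> x) * (e \<bullet> y) * b e e + (e \<bullet> x) * b e (p y) + (e \<bullet> y) * b e (p x) + b (p x) (p y)"
      by (simp add: b_add b_scale b_right b_sym[of "p x" e] algebra_simps)
    also have "\<dots> = (e \<bullet> x) * (e \<bullet> y) * s\<^sup>2 + \<beta> * (p x \<bullet> p y)"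
      by (simp add: be[of "p _"] F0 p(2) bee bil)
    finally show ?thesis by (simp add: p_def inner_diff_left inner_diff_right ee inner_commute algebra_simps)
  qed
  \<comment> \<open>The trace is the mean of |Q w|^2 = |w|^2 = 2 s^2, since w lies on the boundary
    of the cone. By \<open>formula\<close> it is also s^2 + \<beta> (m - 1).\<close>
  have "(\<Sum>i\<in>UNIV. b (axis i 1) (axis i 1)) = 2 * s\<^sup>2"
  proof -
    have "(\<Sum>i\<in>UNIV. b (axis i 1) (axis i 1)) = (LINT Q|\<mu>. (\<Sum>i\<in>UNIV. F (axis i 1) Q * F (axis i 1) Q))"
      unfolding b_def using intFF by (intro Bochner_Integration.integral_sum[symmetric]) auto
    also have "\<dots> = (LINT Q|\<mu>. 2 * s\<^sup>2)"
    proof (rule Bochner_Integration.integral_cong[OF refl])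
      fix Q assume "Q \<in> space \<mu>"
      then have "(norm (Q *v w))\<^sup>2 = 2 * s\<^sup>2" using GQ nw by (simp add: haar_measureD[OF \<mu>])
      then show "(\<Sum>i\<in>UNIV. F (axis i 1) Q * F (axis i 1) Q) = 2 * s\<^sup>2"
        unfolding F_def inner_axis' power2_norm_eq_inner by (simp add: inner_vec_def)
    qed
    finally show ?thesis by (simp add: prob_space)
  qed
  moreover have "(\<Sum>i\<in>UNIV. b (axis i 1) (axis i 1)) = s\<^sup>2 * (e \<bullet> e) + \<beta> * (CARD('m) - e \<bullet> e)"
    by (simp add: formula inner_axis inner_axis_axis sum.distrib sum_subtractf sum_distrib_left[symmetric] mult.assoc)
       (simp add: inner_vec_def)
  ultimately have "\<beta> * (CARD('m) - 1) = s\<^sup>2" using ee by simp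
  then have \<beta>: "\<beta> = s\<^sup>2 / (CARD('m) - 1)" using m by (simp add: field_simps)
  show ?thesis
    using formula[of x y] u
    by (simp add: b_def F_def \<mu>_def[symmetric] \<beta> s_def e_def divide_simps) (simp add: algebra_simps power2_eq_square power4_eq_xxxx)
qed

section \<open>Moore-Penrose pseudoinverse\<close>

lemma transpose_eq_self:
  fixes A :: "real^'n^'n"
  assumes "\<And>x y. (A *v x) \<bullet> y = x \<bullet> (A *v y)"
  shows "transpose A = A"
proof -
  have "A $ i $ j = A $ j $ i" for i j
    using assms[of "axis j 1" "axis i 1"]
    by (simp add: matrix_vector_mult_basis inner_axis inner_axis' column_def)
  then show ?thesis by (simp add: transpose_def vec_eq_iff)
qed

lemma orthogonal_projector:
  fixes S :: "(real^'n) set"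
  assumes "subspace S"
  obtains A where "transpose A = A" "\<And>x. A *v x \<in> S" "\<And>x y. y \<in> S \<Longrightarrow> (x - A *v x) \<bullet> y = 0"
    "\<And>x. x \<in> S \<Longrightarrow> A *v x = x"
proof -
  obtain B where B: "B \<subseteq> S" "pairwise orthogonal B" "\<And>x. x \<in> B \<Longrightarrow> norm x = 1"
      "independent B" "span B = S"
    by (rule orthonormal_basis_subspace[OF assms]) (rule that)
  have fin: "finite B" by (rule independent_imp_finite[OF B(4)])
  define f where "f x = (\<Sum>b\<in>B. (b \<bullet> x) *\<^sub>R b)" for x
  have lin: "linear f"
    unfolding f_def by (intro linear_compose_sum ballI linearI) (auto simp: algebra_simps inner_add_right)
  have fv: "matrix f *v x = f x" for x using lin by (simp add: matrix_works)
  have fS: "f x \<in> S" for x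
    unfolding f_def using B(1) assms by (intro subspace_sum subspace_scale) auto
  have orth: "(x - f x) \<bullet> b = 0" if "b \<in> B" for x b
  proof -
    have "f x \<bullet> b = (\<Sum>c\<in>B. if c = b then c \<bullet> x else 0)"
      unfolding f_def inner_sum_left using B(2,3) that
      by (intro sum.cong) (auto simp: pairwise_def orthogonal_def norm_eq_1)
    then show ?thesis using fin that by (simp add: inner_diff_left inner_commute[of b])
  qed
  have orthS: "(x - f x) \<bullet> y = 0" if "y \<in> S" for x y
  proof -
    have "y \<in> span B" using that B(5) by simp
    then show ?thesis
      by (induction rule: span_induct) (auto simp: orth subspace_def inner_add_right)
  qed
  show ?thesis
  proof (rule that[of "matrix f"])
    show "transpose (matrix f) = matrix f"
      by (rule transpose_eq_self)
         (simp add: fv, simp add: f_def inner_sum_left inner_sum_right inner_commute mult.commute)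
    show "matrix f *v x = x" if "x \<in> S" for x
    proof -
      have "(x - f x) \<bullet> (x - f x) = 0"
        using that fS assms by (intro orthS subspace_diff) auto
      then show ?thesis by (simp add: fv)
    qed
  qed (simp_all add: fv fS orthS)
qed

text \<open>M P and M Q are both the orthogonal projector onto the range of M, and P M and Q M both
  the one onto its support; so P = P M P = Q M Q = Q.\<close>

lemma moore_penrose_unique:
  fixes M :: "real^'l^'n"
  assumes P: "M ** P ** M = M" "P ** M ** P = P" "transpose (M ** P) = M ** P" "transpose (P ** M) = P ** M"
    and Q: "M ** Q ** M = M" "Q ** M ** Q = Q" "transpose (M ** Q) = M ** Q" "transpose (Q ** M) = Q ** M"
  shows "P = Q"
proof -
  have "M ** P = (M ** Q) ** (M ** P)"
    using Q(1) by (metis matrix_mul_assoc)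
  also have "\<dots> = transpose ((M ** P) ** (M ** Q))"
    by (simp add: matrix_transpose_mul[of "M ** P"] P(3) Q(3))
  also have "(M ** P) ** (M ** Q) = M ** Q"
    using P(1) by (metis matrix_mul_assoc)
  finally have 1: "M ** P = M ** Q" by (simp add: Q(3))
  have "P ** M = (P ** M) ** (Q ** M)"
    using Q(1) by (metis matrix_mul_assoc)
  also have "\<dots> = transpose ((Q ** M) ** (P ** M))"
    by (simp add: matrix_transpose_mul[of "Q ** M"] P(4) Q(4))
  also have "(Q ** M) ** (P ** M) = Q ** M"
    using P(1) by (metis matrix_mul_assoc)
  finally have 2: "P ** M = Q ** M" by (simp add: Q(4))
  have "P = P ** M ** P" by (simp add: P(2))
  also have "\<dots> = Q ** (M ** P)" by (simp add: 2 matrix_mul_assoc)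
  also have "\<dots> = Q" by (simp add: 1 matrix_mul_assoc Q(2))
  finally show ?thesis .
qed

text \<open>Project onto the range (\<open>B\<close>), choose any linear preimage
  (\<open>g\<close>), and remove its component in the kernel (\<open>mat 1 - A\<close>).\<close>

lemma moore_penrose_exists:
  fixes M :: "real^'l^'n"
  shows "\<exists>P. M ** P ** M = M \<and> P ** M ** P = P \<and> transpose (M ** P) = M ** P \<and> transpose (P ** M) = P ** M"
proof -
  let ?K = "{x. M *v x = 0}"
  have ker: "subspace ?K"
    by (auto simp: subspace_def matrix_vector_right_distrib matrix_vector_mult_scaleR)
  obtain A where A: "transpose A = A" "\<And>x. A *v x \<in> ?K" "\<And>x y. y \<in> ?K \<Longrightarrow> (x - A *v x) \<bullet> y = 0"
    "\<And>x. x \<in> ?K \<Longrightarrow> A *v x = x"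
    by (rule orthogonal_projector[OF ker]) (rule that)
  have "subspace (range ((*v) M))" by (simp add: linear_subspace_image)
  then obtain B where B: "transpose B = B" "\<And>x. B *v x \<in> range ((*v) M)" "\<And>x. x \<in> range ((*v) M) \<Longrightarrow> B *v x = x"
    by (rule orthogonal_projector) (rule that)
  obtain g where g: "linear g" "\<And>x. M *v (g (M *v x)) = M *v x"
  proof -
    obtain g where "g ` UNIV \<subseteq> span UNIV" "linear g" "\<forall>y\<in>(*v) M ` span UNIV. M *v (g y) = y"
      using linear_exists_right_inverse_on[of "(*v) M" UNIV] by auto
    then show ?thesis using that[of g] by simp
  qed
  define P where "P = (mat 1 - A) ** matrix g ** B"
  have Pv: "P *v y = g (B *v y) - A *v g (B *v y)" for y
    by (simp add: P_def matrix_vector_mul_assoc[symmetric] matrix_works[OF g(1)[unfolded linear_def scalar_mult_eq_scaleR[symmetric]]] matrix_vector_mult_diff_rdistrib)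
  have MA: "M *v (A *v x) = 0" for x using A(2) by simp
  have MP: "M ** P = B"
  proof -
    have "M *v (P *v y) = B *v y" for y
    proof -
      obtain x where "B *v y = M *v x" using B(2) by auto
      then show ?thesis by (simp add: Pv MA matrix_vector_mult_diff_distrib g)
    qed
    then show ?thesis by (simp add: matrix_eq matrix_vector_mul_assoc[symmetric])
  qed
  have PM: "P ** M = mat 1 - A"
  proof -
    have "P *v (M *v x) = x - A *v x" for x
    proof -
      let ?z = "g (M *v x)"
      have "A *v (?z - x) = ?z - x" by (rule A(4)) (simp add: matrix_vector_mult_diff_distrib g)
      then show ?thesis by (simp add: Pv B matrix_vector_mult_diff_distrib algebra_simps)
    qed
    then show ?thesis by (simp add: matrix_eq matrix_vector_mul_assoc[symmetric] matrix_vector_mult_diff_rdistrib)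
  qed
  have "M ** P ** M = M"
    by (simp add: MP matrix_eq matrix_vector_mul_assoc[symmetric] B(3))
  moreover have "P ** M ** P = P"
  proof -
    have "A *v (P *v y) = 0" for y
      using A(4)[OF A(2)] by (simp add: Pv matrix_vector_mult_diff_distrib)
    then show ?thesis
      by (simp add: PM matrix_eq matrix_vector_mul_assoc[symmetric] matrix_vector_mult_diff_rdistrib)
  qed
  moreover have "transpose (mat 1 - A) = mat 1 - A"
    using A(1) by (simp add: transpose_def vec_eq_iff mat_def)
  ultimately show ?thesis using B(1) by (metis MP PM)
qed

lemma mult_pinv_mult:
  fixes M :: "real^'l^'n"
  shows "M ** pinv M ** M = M"
proof -
  let ?mp = "\<lambda>P. M ** P ** M = M \<and> P ** M ** P = P \<and> transpose (M ** P) = M ** P \<and> transpose (P ** M) = P ** M"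
  have "\<exists>!P. ?mp P"
    using moore_penrose_exists[of M] moore_penrose_unique[of M] by blast
  from theI'[OF this] show ?thesis unfolding pinv_def by blast
qed

text \<open>By M = M M\<open>\<^sup>+\<close> M, a matrix and its support projector have the same
  kernel.\<close>

lemma pinv_mult_eq_imp_kernel_eq:
  fixes M :: "real^'l^'n" and L :: "real^'l^'m"
  assumes "pinv M ** M = pinv L ** L"
  shows "M *v x = 0 \<longleftrightarrow> L *v x = 0"
proof -
  have "A *v x = 0 \<longleftrightarrow> (pinv A ** A) *v x = 0" for A :: "real^'l^'k"
    by (metis matrix_vector_mul_assoc matrix_vector_mult_0_right mult_pinv_mult)
  then show ?thesis using assms by metis
qed

text \<open>\<open>L\<close> is injective on \<open>supp M\<close>, the orthogonal complement of its
  own kernel, and the dimensions agree, so \<open>L\<close> is onto. Then \<open>M\<close> after any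
  linear right inverse of \<open>L\<close> is the map \<open>N\<close>: the ambiguity lies in the
  common kernel.\<close>

lemma support_factorization:
  fixes M :: "real^'l^'n" and L :: "real^'l^'m"
  assumes ker: "\<And>x. M *v x = 0 \<longleftrightarrow> L *v x = 0" and dim: "CARD('m) = dim (supp M)"
  obtains N where "linear N" "inj N" "\<And>x. N (L *v x) = M *v x" "surj ((*v) L)"
proof -
  have sub: "subspace (supp M)" unfolding supp_def by (rule subspace_orthogonal_comp)
  have "inj_on ((*v) L) (span (supp M))"
  proof (rule linear_inj_on_iff_eq_0[THEN iffD2])
    show "\<forall>v\<in>span (supp M). L *v v = 0 \<longrightarrow> v = 0"
    proof (intro ballI impI)
      fix v assume v: "v \<in> span (supp M)" "L *v v = 0"
      then have "v \<in> supp M" using sub by (metis span_eq_iff)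
      moreover have "M *v v = 0" using v ker by simp
      ultimately have "v \<bullet> v = 0" by (auto simp: supp_def orthogonal_comp_def orthogonal_def)
      then show "v = 0" by simp
    qed
  qed auto
  then have "dim ((*v) L ` supp M) = CARD('m)"
    using dim_image_eq[of "(*v) L" "supp M"] dim by simp
  then have "span ((*v) L ` supp M) = UNIV"
    using dim_eq_full[of "(*v) L ` supp M"] by simp
  then have "(*v) L ` supp M = UNIV"
    using linear_subspace_image[of "(*v) L" "supp M"] sub by (metis matrix_vector_mul_linear span_eq_iff)
  then have surj: "surj ((*v) L)" by blast
  obtain g where g: "linear g" "\<And>y. L *v (g y) = y"
    using linear_surjective_right_inverse[OF matrix_vector_mul_linear surj] by (auto simp: fun_eq_iff)
  show ?thesis
  proof (rule that[of "\<lambda>y. M *v (g y)"])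
    show lin: "linear (\<lambda>y. M *v (g y))"
      using linear_compose[OF g(1) matrix_vector_mul_linear[of M]] by (simp add: o_def)
    show "inj (\<lambda>y. M *v (g y))"
    proof (rule linear_injective_0[OF lin, THEN iffD2], intro allI impI)
      fix y assume "M *v (g y) = 0"
      then show "y = 0" using ker[of "g y"] g(2) by simp
    qed
    show "M *v (g (L *v x)) = M *v x" for x
      using ker[of "g (L *v x) - x"] by (simp add: matrix_vector_mult_diff_distrib g)
  qed (rule surj)
qed

section \<open>Geometry of the cone\<close>

lemma cone_fun_le_0_iff:
  "cone_fun u v \<le> 0 \<longleftrightarrow> norm v \<le> sqrt 2 * ((u /\<^sub>R norm u) \<bullet> v)"
  by (simp add: cone_fun_def)

text \<open>Trades the norm for a quadratic form, which expands exactly along a motion; the linear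
  condition selects one half of the double cone.\<close>

lemma cone_fun_le_0_iff_quadratic:
  defines "e u \<equiv> u /\<^sub>R norm u"
  shows "cone_fun u v \<le> 0 \<longleftrightarrow> 0 \<le> e u \<bullet> v \<and> (norm v)\<^sup>2 \<le> 2 * (e u \<bullet> v)\<^sup>2"
proof -
  have "norm v \<le> sqrt 2 * t \<longleftrightarrow> 0 \<le> t \<and> (norm v)\<^sup>2 \<le> 2 * t\<^sup>2" for t
  proof (cases "0 \<le> t")
    case True
    then have "norm v \<le> sqrt 2 * t \<longleftrightarrow> (norm v)\<^sup>2 \<le> (sqrt 2 * t)\<^sup>2"
      by (simp add: abs_le_square_iff[symmetric])
    then show ?thesis using True by (simp add: power_mult_distrib)
  next
    case False
    then have "sqrt 2 * t < 0" by (simp add: mult_pos_neg)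
    then show ?thesis using False norm_ge_zero[of v] by linarith
  qed
  then show ?thesis by (simp add: cone_fun_le_0_iff e_def)
qed

lemma cone_fun_scale: "0 \<le> c \<Longrightarrow> cone_fun u v \<le> 0 \<Longrightarrow> cone_fun u (c *\<^sub>R v) \<le> 0"
  using mult_left_mono[of "norm v" "sqrt 2 * ((u /\<^sub>R norm u) \<bullet> v)" c]
  by (simp add: cone_fun_le_0_iff algebra_simps)

text \<open>The constant 2 rounds up the sharp sqrt 2.\<close>

lemma cone_fun_le_0_imp_norm_le:
  assumes "cone_fun u v \<le> 0" "u \<noteq> 0"
  shows "norm u * norm v \<le> 2 * (u \<bullet> v)"
proof -
  have "0 \<le> u \<bullet> v"
    using assms by (simp add: cone_fun_le_0_iff_quadratic zero_le_mult_iff)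
  have "norm u * norm v \<le> sqrt 2 * (u \<bullet> v)"
    using mult_left_mono[OF assms(1)[unfolded cone_fun_le_0_iff], of "norm u"] assms(2) by (simp add: field_simps)
  also have "\<dots> \<le> 2 * (u \<bullet> v)"
    using \<open>0 \<le> u \<bullet> v\<close> by (intro mult_right_mono) (auto intro: real_le_lsqrt)
  finally show ?thesis .
qed

lemma cone_fun_le_0_imp_inner_pos:
  assumes "cone_fun u v \<le> 0" "u \<noteq> 0" "v \<noteq> 0"
  shows "0 < u \<bullet> v"
proof -
  have "0 < norm u * norm v" using assms by simp
  then show ?thesis using cone_fun_le_0_imp_norm_le[OF assms(1,2)] by linarith
qed

text \<open>At relative distance 1/10 from the axis, the norm of \<open>v\<close> is at most 11/10
  and its axial component at least 9/10 of the length on the axis, and 11/9 \<le> 5/4 \<le> sqrt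
  2.\<close>

lemma cone_fun_le_0_near_axis:
  assumes "u \<noteq> 0" "0 \<le> c" "norm (v - c *\<^sub>R u) \<le> c * norm u / 10"
  shows "cone_fun u v \<le> 0"
proof -
  define h where "h = v - c *\<^sub>R u"
  have v: "v = c *\<^sub>R u + h" by (simp add: h_def)
  have h: "norm h \<le> c * norm u / 10" using assms by (simp add: h_def)
  have "norm v \<le> c * norm u + norm h"
    unfolding v using norm_triangle_ineq[of "c *\<^sub>R u" h] assms by simp
  also have "\<dots> \<le> 5/4 * (c * norm u - norm h)"
  proof -
    have "a + b \<le> 5/4 * (a - b)" if "b \<le> a / 10" "0 \<le> b" for a b :: real
      using that by (simp add: field_simps)
    from this[OF h norm_ge_zero] show ?thesis .
  qed
  also have "\<dots> \<le> sqrt 2 * (c * norm u - norm h)"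
  proof (rule mult_right_mono)
    show "5/4 \<le> sqrt 2" by (rule real_le_rsqrt) (simp add: power2_eq_square)
    have "c * norm u / 10 \<le> c * norm u" using assms by (simp add: field_simps)
    then show "0 \<le> c * norm u - norm h" using h by linarith
  qed
  also have "\<dots> \<le> sqrt 2 * ((u /\<^sub>R norm u) \<bullet> v)"
  proof (rule mult_left_mono)
    have "\<bar>(u /\<^sub>R norm u) \<bullet> h\<bar> \<le> norm h"
      using Cauchy_Schwarz_ineq2[of "u /\<^sub>R norm u" h] assms by simp
    moreover have "(u /\<^sub>R norm u) \<bullet> (c *\<^sub>R u) = c * norm u"
      using assms by (simp add: power2_norm_eq_inner[symmetric] power2_eq_square)
    ultimately show "c * norm u - norm h \<le> (u /\<^sub>R norm u) \<bullet> v"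
      unfolding v inner_add_right by linarith
  qed simp
  finally show ?thesis by (simp add: cone_fun_le_0_iff)
qed

lemma continuous_on_cone_fun [continuous_intros]:
  "continuous_on S f \<Longrightarrow> continuous_on S (\<lambda>x. cone_fun u (f x))"
  unfolding cone_fun_def by (intro continuous_intros)

text \<open>The affine hull of \<open>sign_space s u\<close>, by
  \<open>affine_hull_sign_space\<close>: state spaces are flat, effect spaces have interior
  points.\<close>

definition unit_plane :: "sign \<Rightarrow> real^'l \<Rightarrow> (real^'l) set" where
  "unit_plane s u = (case s of Minus \<Rightarrow> {v. u \<bullet> v = 1} | Plus \<Rightarrow> UNIV)"

lemma sign_space_cone:
  "v \<in> sign_space s u \<Longrightarrow> cone_fun u v \<le> 0"
  by (cases s) (auto simp: sign_space_def state_space_def effect_space_def)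

text \<open>The first summand serves the - case, the second the + case, where adding the bounds for
  \<open>v\<close> and \<open>u - v\<close> cancels \<open>u \<bullet> v\<close>.\<close>

lemma sign_space_norm_le:
  assumes "u \<noteq> 0" "v \<in> sign_space s u"
  shows "norm v \<le> 2 / norm u + 2 * norm u"
proof (cases s)
  case Minus
  then have "norm u * norm v \<le> 2"
    using cone_fun_le_0_imp_norm_le[of u v] assms by (auto simp: sign_space_def state_space_def)
  then have "norm v \<le> 2 / norm u" using assms by (simp add: field_simps)
  then show ?thesis using norm_ge_zero[of u] by linarith
next
  case Plus
  then have "norm u * norm v \<le> 2 * (u \<bullet> v)" "norm u * norm (u - v) \<le> 2 * (u \<bullet> (u - v))"
    using cone_fun_le_0_imp_norm_le[of u v] cone_fun_le_0_imp_norm_le[of u "u - v"] assms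
    by (auto simp: sign_space_def effect_space_def)
  then have "norm u * norm v + norm u * norm (u - v) \<le> 2 * (u \<bullet> u)"
    by (simp add: inner_diff_right)
  moreover have "0 \<le> norm u * norm (u - v)" by simp
  ultimately have "norm u * norm v \<le> 2 * (u \<bullet> u)"
    by linarith
  then have "norm u * norm v \<le> norm u * (2 * norm u)"
    by (simp add: power2_norm_eq_inner[symmetric] power2_eq_square)
  then have "norm v \<le> 2 * norm u" using assms by simp
  moreover have "0 \<le> 2 / norm u" by simp
  ultimately show ?thesis by linarith
qed

lemma compact_sign_space:
  assumes "u \<noteq> 0"
  shows "compact (sign_space s u)"
proof -
  have "bounded (sign_space s u)"
    using sign_space_norm_le[OF assms] by (auto simp: bounded_iff)
  moreover have "closed (sign_space s u)"
    by (cases s) (auto simp: sign_space_def state_space_def effect_space_def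
        intro!: closed_Collect_conj closed_Collect_le closed_Collect_eq continuous_intros)
  ultimately show ?thesis by (simp add: compact_eq_bounded_closed)
qed

lemma state_space_near:
  assumes "u \<noteq> 0" "u \<bullet> v = 1" "norm (v - u /\<^sub>R (norm u)\<^sup>2) \<le> 1 / (10 * norm u)"
  shows "v \<in> state_space u"
proof -
  have eq: "1 / (10 * norm u) = (1 / (norm u)\<^sup>2) * norm u / 10"
    using assms(1) by (simp add: power2_eq_square)
  have "cone_fun u v \<le> 0"
    using assms(3) unfolding eq inverse_eq_divide
    by (rule cone_fun_le_0_near_axis[OF assms(1), rotated]) simp
  then show ?thesis
    using assms(2) by (simp add: state_space_def)
qed

lemma effect_space_near:
  assumes "u \<noteq> 0" "norm (v - u /\<^sub>R 2) \<le> norm u / 20"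
  shows "v \<in> effect_space u"
proof -
  have "u - v - (1/2) *\<^sub>R u = - (v - u /\<^sub>R 2)" by (simp add: vec_eq_iff)
  then have "norm (u - v - (1/2) *\<^sub>R u) \<le> norm u / 20" using assms by (simp only: norm_minus_cancel)
  then show ?thesis
    using cone_fun_le_0_near_axis[OF assms(1), of "1/2"] assms
    by (simp add: effect_space_def)
qed

lemma affine_hull_sign_space:
  assumes "u \<noteq> 0"
  shows "affine hull (sign_space s u) = unit_plane s u"
proof (cases s)
  case Plus
  have "ball (u /\<^sub>R 2) (norm u / 20) \<subseteq> effect_space u"
    using effect_space_near[OF assms] by (auto simp: dist_norm norm_minus_commute)
  then have "interior (effect_space u) \<noteq> {}"
    using assms by (metis centre_in_ball divide_pos_pos empty_iff interior_maximal open_ball subsetD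
        zero_less_norm_iff zero_less_numeral)
  then show ?thesis
    using affine_hull_nonempty_interior Plus by (simp add: sign_space_def unit_plane_def)
next
  case Minus
  define x0 where "x0 = u /\<^sub>R (norm u)\<^sup>2"
  have ux0: "u \<bullet> x0 = 1" using assms by (simp add: x0_def power2_norm_eq_inner)
  have x0: "x0 \<in> state_space u"
    using state_space_near[OF assms ux0] by (simp add: x0_def)
  have "v \<in> affine hull (state_space u)" if v: "u \<bullet> v = 1" for v
  proof -
    \<comment> \<open>Scales the step from \<open>x0\<close> towards \<open>v\<close> to length at
      most 1 / (10 |u|), as \<open>state_space_near\<close> asks; the summand 1 covers
      \<open>v = x0\<close>. Then \<open>v\<close> lies on the line through two states.\<close>
    define \<epsilon> where "\<epsilon> = 1 / (10 * norm u * (norm (v - x0) + 1))"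
    have pos: "0 < norm (v - x0) + 1" using norm_ge_zero[of "v - x0"] by linarith
    then have \<epsilon>: "0 < \<epsilon>" using assms by (simp add: \<epsilon>_def)
    let ?w = "x0 + \<epsilon> *\<^sub>R (v - x0)"
    have "\<epsilon> * norm (v - x0) \<le> \<epsilon> * (norm (v - x0) + 1)"
      using \<epsilon> by simp
    also have "\<dots> = 1 / (10 * norm u)"
      using pos by (simp add: \<epsilon>_def)
    finally have "\<epsilon> * norm (v - x0) \<le> 1 / (10 * norm u)" .
    then have "?w \<in> state_space u"
      using \<epsilon> by (intro state_space_near[OF assms])
        (simp_all add: inner_add_right inner_diff_right ux0 v x0_def[symmetric])
    then have "(1 - 1 / \<epsilon>) *\<^sub>R x0 + (1 / \<epsilon>) *\<^sub>R ?w \<in> affine hull (state_space u)"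
      using x0 by (intro mem_affine[OF affine_affine_hull]) (auto intro: hull_inc)
    also have "(1 - 1 / \<epsilon>) *\<^sub>R x0 + (1 / \<epsilon>) *\<^sub>R ?w = v"
      using \<epsilon> by (simp add: algebra_simps)
    finally show ?thesis .
  qed
  moreover have "affine hull (state_space u) \<subseteq> {v. u \<bullet> v = 1}"
    by (rule hull_minimal) (auto simp: state_space_def affine_hyperplane)
  ultimately show ?thesis using Minus by (auto simp: sign_space_def unit_plane_def)
qed

lemma span_sign_space:
  assumes "u \<noteq> 0"
  shows "span (sign_space s u) = UNIV"
proof -
  have sub: "unit_plane s u \<subseteq> span (sign_space s u)"
    using affine_hull_subset_span[of "sign_space s u"] affine_hull_sign_space[OF assms] by simp
  define x0 where "x0 = u /\<^sub>R (norm u)\<^sup>2"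
  have ux0: "u \<bullet> x0 = 1" using assms by (simp add: x0_def power2_norm_eq_inner)
  have "v \<in> span (sign_space s u)" for v
  proof -
    have "v + (1 - u \<bullet> v) *\<^sub>R x0 \<in> unit_plane s u" "x0 \<in> unit_plane s u"
      using ux0 by (cases s; simp add: unit_plane_def inner_add_right)+
    then have "(v + (1 - u \<bullet> v) *\<^sub>R x0) - (1 - u \<bullet> v) *\<^sub>R x0 \<in> span (sign_space s u)"
      using sub by (intro span_diff span_scale) auto
    then show ?thesis by simp
  qed
  then show ?thesis by blast
qed

text \<open>Sets in the hyperplane \<open>u \<bullet> v = 1\<close> are null sets; thickened along \<open>u\<close>, their Lebesgue measure
  is proportional to their volume in the hyperplane.\<close>

definition thicken :: "sign \<Rightarrow> real^'m \<Rightarrow> (real^'m) set \<Rightarrow> (real^'m) set" where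
  "thicken s u Y = {y + t *\<^sub>R u | y t. y \<in> Y \<and> t \<in> (case s of Minus \<Rightarrow> {0..1} | Plus \<Rightarrow> {0})}"

lemma compact_thicken:
  assumes "compact Y"
  shows "compact (thicken s u Y)"
proof -
  let ?T = "case s of Minus \<Rightarrow> {0..1} | Plus \<Rightarrow> {0::real}"
  have "compact ?T" by (cases s) auto
  then have "compact {y + t | y t. y \<in> Y \<and> t \<in> (\<lambda>t. t *\<^sub>R u) ` ?T}"
    using assms by (intro compact_sums compact_continuous_image) (auto intro!: continuous_intros)
  also have "{y + t | y t. y \<in> Y \<and> t \<in> (\<lambda>t. t *\<^sub>R u) ` ?T} = thicken s u Y"
    by (auto simp: thicken_def)
  finally show ?thesis .
qed

text \<open>Positivity is what makes a volume factor above 1 a strict increase.\<close>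

lemma emeasure_thicken_sign_space:
  fixes u :: "real^'m"
  assumes "u \<noteq> 0"
  shows "emeasure lborel (thicken s u (sign_space s u)) \<noteq> 0"
proof -
  obtain c r where r: "0 < r" and sub: "ball c r \<subseteq> thicken s u (sign_space s u)"
  proof (cases s)
    case Plus
    have "ball (u /\<^sub>R 2) (norm u / 20) \<subseteq> effect_space u"
      using effect_space_near[OF assms] by (auto simp: dist_norm norm_minus_commute)
    then show ?thesis
      using that[of "norm u / 20"] assms Plus by (simp add: thicken_def sign_space_def)
  next
    case Minus
    define x0 where "x0 = u /\<^sub>R (norm u)\<^sup>2"
    have ux0: "u \<bullet> x0 = 1" using assms by (simp add: x0_def power2_norm_eq_inner)
    \<comment> \<open>The first bound keeps the height along \<open>u\<close>, which is 1/2 at the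
      centre, within 0..1. The second bounds the part orthogonal to \<open>u\<close>, estimated by
      twice the norm of \<open>h\<close>.\<close>
    define r where "r = min (norm u / 2) (1 / (20 * norm u))"
    have r: "0 < r" "r \<le> norm u / 2" "2 * r \<le> 1 / (10 * norm u)" using assms by (auto simp: r_def min_def field_simps)
    have "ball (x0 + u /\<^sub>R 2) r \<subseteq> thicken s u (sign_space s u)"
    proof
      fix z assume z: "z \<in> ball (x0 + u /\<^sub>R 2) r"
      define h where "h = z - x0 - u /\<^sub>R 2"
      have h: "norm h \<le> r" using z by (simp add: h_def dist_norm norm_minus_commute diff_diff_eq)
      define a where "a = (u \<bullet> h) / (norm u)\<^sup>2"
      have ah: "\<bar>a\<bar> * norm u \<le> norm h"
        using Cauchy_Schwarz_ineq2[of u h] assms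
        by (simp add: a_def power2_eq_square field_simps)
      have "\<bar>a\<bar> * norm u \<le> (1/2) * norm u" using ah h r by linarith
      then have a: "\<bar>a\<bar> \<le> 1/2" using assms by (simp del: times_divide_eq_left)
      define y where "y = z - (1/2 + a) *\<^sub>R u"
      have y: "y = x0 + (h - a *\<^sub>R u)" by (simp add: y_def h_def algebra_simps)
      have "y \<in> state_space u"
      proof (rule state_space_near[OF assms])
        show "u \<bullet> y = 1"
          using assms by (simp add: y inner_add_right inner_diff_right ux0 a_def power2_norm_eq_inner)
        have "norm (h - a *\<^sub>R u) \<le> norm h + \<bar>a\<bar> * norm u"
          using norm_triangle_ineq4[of h "a *\<^sub>R u"] by simp
        also have "\<dots> \<le> 1 / (10 * norm u)" using ah h r by linarith
        finally show "norm (y - u /\<^sub>R (norm u)\<^sup>2) \<le> 1 / (10 * norm u)" by (simp add: y x0_def)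
      qed
      moreover have "z = y + (1/2 + a) *\<^sub>R u" by (simp add: y_def)
      moreover have "1/2 + a \<in> {0..1}" using a by (auto simp: abs_le_iff)
      ultimately show "z \<in> thicken s u (sign_space s u)"
        unfolding thicken_def sign_space_def Minus sign.case by blast
    qed
    then show ?thesis using that r by blast
  qed
  have "0 < emeasure lborel (ball c r)"
    using r by (simp add: emeasure_ball)
  also have "\<dots> \<le> emeasure lborel (thicken s u (sign_space s u))"
    using sub compact_thicken[OF compact_sign_space[OF assms]]
    by (intro emeasure_mono) (auto simp: borel_compact)
  finally show ?thesis by simp
qed

section \<open>Variation of the cone\<close>

text \<open>Let q(v) = 2 (e . v)^2 - |v|^2. By \<open>polar\<close>, q(y + t B y) = (1 - t h) q(y) +
  t y . H y + t^2 q(B y). On the cone the first term is nonnegative for small t, whatever the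
  multiple h, and the second dominates the third. All bounds scale with |y|^2, so one t serves all
  of \<open>Y\<close>, even near 0.\<close>

lemma cone_perturbation:
  fixes u :: "real^'m" and B H :: "real^'m \<Rightarrow> real^'m"
  defines "e \<equiv> u /\<^sub>R norm u"
  assumes B: "linear B"
    and polar: "\<And>v. 2 * (2 * (e \<bullet> v) * (e \<bullet> B v) - v \<bullet> B v) = v \<bullet> H v - h * (2 * (e \<bullet> v)\<^sup>2 - (norm v)\<^sup>2)"
    and d: "0 < d" "\<And>y. y \<in> Y \<Longrightarrow> d * (norm y)\<^sup>2 \<le> y \<bullet> H y"
    and Y: "\<And>y. y \<in> Y \<Longrightarrow> cone_fun u y \<le> 0"
  shows "\<forall>\<^sub>F t in at_right 0. \<forall>y\<in>Y. cone_fun u (y + t *\<^sub>R B y) \<le> 0"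
proof -
  obtain C where C: "0 < C" "\<And>v. norm (B v) \<le> C * norm v"
    using linear_bounded_pos[OF B] by (auto simp: mult.commute)
  \<comment> \<open>Used for three thresholds: t h \<le> 1 keeps the first term nonnegative, t C^2
    \<le> d lets the linear term win, and t C \<le> 1/2 keeps the point in the half-space of the
    cone.\<close>
  have ev: "\<forall>\<^sub>F t in at_right 0. t < c" if "0 < c" for c :: real
    using eventually_at_right_real[OF that] by (rule eventually_mono) simp
  have "\<forall>\<^sub>F t in at_right 0. t < 1 / (\<bar>h\<bar> + 1)" "\<forall>\<^sub>F t in at_right 0. t < d / C\<^sup>2"
    "\<forall>\<^sub>F t in at_right 0. t < 1 / (2 * C)" "\<forall>\<^sub>F t::real in at_right 0. 0 < t"
    using C d by (auto intro!: ev eventually_at_right_less simp: add_nonneg_pos)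
  then show ?thesis
  proof eventually_elim
    case (elim t)
    have t: "0 < t" by fact
    have th: "t * h \<le> 1"
    proof -
      have "t * h \<le> t * (\<bar>h\<bar> + 1)" using t by (intro mult_left_mono) auto
      also have "\<dots> \<le> 1" using elim(1) by (simp add: pos_less_divide_eq add_nonneg_pos less_imp_le)
      finally show ?thesis .
    qed
    have tC2: "t * C\<^sup>2 \<le> d" using elim(2) C by (simp add: pos_less_divide_eq)
    have tC: "t * C \<le> 1/2" using elim(3) C by (simp add: pos_less_divide_eq)
    show ?case
    proof
      fix y assume y: "y \<in> Y"
      have cy: "0 \<le> e \<bullet> y" "(norm y)\<^sup>2 \<le> 2 * (e \<bullet> y)\<^sup>2"
        using Y[OF y] by (auto simp: cone_fun_le_0_iff_quadratic e_def)
      let ?q = "\<lambda>v. 2 * (e \<bullet> v)\<^sup>2 - (norm v)\<^sup>2"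
      have "norm y \<le> 2 * (e \<bullet> y)"
      proof (rule power2_le_imp_le)
        have "2 * (e \<bullet> y)\<^sup>2 \<le> (2 * (e \<bullet> y))\<^sup>2" by (simp add: power_mult_distrib)
        then show "(norm y)\<^sup>2 \<le> (2 * (e \<bullet> y))\<^sup>2" using cy(2) by (rule order_trans[rotated])
      qed (use cy in simp)
      moreover have "\<bar>e \<bullet> B y\<bar> \<le> C * norm y"
      proof -
        have "\<bar>e \<bullet> B y\<bar> \<le> norm e * norm (B y)" by (rule Cauchy_Schwarz_ineq2)
        also have "\<dots> \<le> 1 * norm (B y)" by (intro mult_right_mono) (cases "u = 0"; simp add: e_def)+
        finally show ?thesis using C(2)[of y] by simp
      qed
      then have "\<bar>t * (e \<bullet> B y)\<bar> \<le> (1/2) * norm y"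
      proof -
        assume "\<bar>e \<bullet> B y\<bar> \<le> C * norm y"
        then have "t * \<bar>e \<bullet> B y\<bar> \<le> t * (C * norm y)" using t by simp
        also have "\<dots> \<le> (1/2) * norm y"
          using mult_right_mono[OF tC, of "norm y"] by (simp only: mult.assoc norm_ge_zero)
        finally show ?thesis using t by (simp only: abs_mult abs_of_pos)
      qed
      ultimately have 1: "0 \<le> e \<bullet> (y + t *\<^sub>R B y)"
        by (simp add: inner_add_right)
      have "?q (y + t *\<^sub>R B y) = ?q y + t * (2 * (2 * (e \<bullet> y) * (e \<bullet> B y) - y \<bullet> B y)) + t\<^sup>2 * ?q (B y)"
        unfolding power2_norm_eq_inner unfolding power2_eq_square
        by (simp add: inner_add_left inner_add_right inner_commute algebra_simps)
      also have "\<dots> = (1 - t * h) * ?q y + t * (y \<bullet> H y) + t\<^sup>2 * ?q (B y)"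
        unfolding polar by (simp add: algebra_simps)
      also have "\<dots> \<ge> 0 + t * (d * (norm y)\<^sup>2) + t\<^sup>2 * (- (C * norm y)\<^sup>2)"
      proof (intro add_mono mult_left_mono)
        show "0 \<le> (1 - t * h) * ?q y" using th cy by (intro mult_nonneg_nonneg) auto
        have "(norm (B y))\<^sup>2 \<le> (C * norm y)\<^sup>2" using C(2) by (intro power_mono) auto
        then show "- (C * norm y)\<^sup>2 \<le> ?q (B y)" using zero_le_power2[of "e \<bullet> B y"] by linarith
      qed (use t d(2)[OF y] in auto)
      finally have "t * (norm y)\<^sup>2 * (d - t * C\<^sup>2) \<le> ?q (y + t *\<^sub>R B y)"
        by (simp add: algebra_simps power_mult_distrib power2_eq_square)
      moreover have "0 \<le> t * (norm y)\<^sup>2 * (d - t * C\<^sup>2)" using t tC2 by simp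
      ultimately have "0 \<le> ?q (y + t *\<^sub>R B y)" by linarith
      then show "cone_fun u (y + t *\<^sub>R B y) \<le> 0"
        using 1 by (simp add: cone_fun_le_0_iff_quadratic e_def)
    qed
  qed
qed

lemma trace_matrix: "trace (matrix f) = (\<Sum>i\<in>UNIV. axis i 1 \<bullet> f (axis i 1))" for f :: "real^'m \<Rightarrow> real^'m"
  by (simp add: trace_def matrix_def inner_axis')

text \<open>The derivative \<open>S\<close>, \<open>k\<close> of a motion of the cone that moves its quadratic form
  \<open>J = 2 e e\<^sup>T - I\<close> in the direction of \<open>H\<close>, up to a multiple of \<open>J\<close>.\<close>

lemma cone_motion:
  fixes u :: "real^'m" and H :: "real^'m^'m"
  defines "e \<equiv> u /\<^sub>R norm u"
  assumes u: "u \<noteq> 0" and sym: "\<And>x y. x \<bullet> (H *v y) = (H *v x) \<bullet> y"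
    and tr: "trace H + (real CARD('m) - 2) * (e \<bullet> (H *v e)) < 0"
    and d: "0 < d" "\<And>y. y \<in> Y \<Longrightarrow> d * (norm y)\<^sup>2 \<le> y \<bullet> (H *v y)"
    and Y: "\<And>y. y \<in> Y \<Longrightarrow> cone_fun u y \<le> 0"
  obtains S :: "real^'m^'m" and k :: "real^'m" where "S *v u = 0" "\<And>v. u \<bullet> (S *v v) = 0" "u \<bullet> k = 0" "0 < trace S"
    "\<forall>\<^sub>F t in at_right 0. \<forall>y\<in>Y. cone_fun u (y + t *\<^sub>R (S *v y - (e \<bullet> y) *\<^sub>R k)) \<le> 0"
    "\<forall>\<^sub>F t in at_right 0. \<forall>y\<in>Y. cone_fun u (y + t *\<^sub>R (S *v y + (k \<bullet> y) *\<^sub>R e)) \<le> 0"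
proof -
  define h where "h = e \<bullet> (H *v e)"
  have ee: "e \<bullet> e = 1" using u by (simp add: e_def power2_norm_eq_inner[symmetric] power2_eq_square)
  have ue: "u = norm u *\<^sub>R e" using u by (simp add: e_def)
  \<comment> \<open>\<open>H\<close> minus the multiple of J that makes e . G e = 0; the factor is
    \<open>h\<close> because e . J e = 1.\<close>
  define G where "G x = H *v x - h *\<^sub>R ((2 * (e \<bullet> x)) *\<^sub>R e - x)" for x
  define P where "P x = x - (e \<bullet> x) *\<^sub>R e" for x
  \<comment> \<open>The block of \<open>G\<close> orthogonal to \<open>e\<close>. Along a motion
    inside that complement, q changes by -2 v . S v, whence the factor -1/2.\<close>
  define f where "f x = (- 1 / 2) *\<^sub>R P (G (P x))" for x
  \<comment> \<open>The mixed block of \<open>G\<close>. Each of the two rank-one motions with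
    \<open>k\<close> contributes 2 (e . v) (k . v) to the change of q.\<close>
  define k where "k = G e"
  have linP: "linear P" unfolding P_def by (intro linearI) (simp_all add: inner_add_right algebra_simps)
  have linG: "linear G" unfolding G_def
    by (intro linearI) (simp_all add: inner_add_right algebra_simps matrix_vector_right_distrib matrix_vector_mult_scaleR)
  have linf: "linear f"
    unfolding f_def using linear_compose[OF linear_compose[OF linP linG] linP]
    by (intro linear_compose_scale_right) (simp add: o_def)
  define S where "S = matrix f"
  have Sv: "S *v x = f x" for x using linf by (simp add: S_def matrix_works)
  have eP: "e \<bullet> P x = 0" for x by (simp add: P_def inner_diff_right ee)
  have Pe: "P e = 0" by (simp add: P_def ee)
  have eGe: "e \<bullet> G e = 0" by (simp add: G_def inner_diff_right ee h_def)
  have symG: "x \<bullet> G y = G x \<bullet> y" for x y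
    by (simp add: G_def inner_diff_left inner_diff_right sym[of x y] inner_commute[of x e] mult.commute)
  have Pself: "P x \<bullet> y = x \<bullet> P y" for x y by (simp add: P_def inner_diff_left inner_diff_right inner_commute)
  have Gv: "v \<bullet> G v = v \<bullet> (H *v v) - h * (2 * (e \<bullet> v)\<^sup>2 - (norm v)\<^sup>2)" for v
    by (simp add: G_def inner_diff_right power2_norm_eq_inner power2_eq_square[of "e \<bullet> v"] inner_commute[of v e])
  have PGP: "P v \<bullet> G (P v) = v \<bullet> G v - 2 * (e \<bullet> v) * (k \<bullet> v)" for v
  proof -
    have "P v \<bullet> G (P v) = v \<bullet> G v - (e \<bullet> v) * (v \<bullet> G e) - (e \<bullet> v) * (e \<bullet> G v) + (e \<bullet> v) * (e \<bullet> v) * (e \<bullet> G e)"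
      by (simp add: P_def linear_diff[OF linG] linear_scale[OF linG] inner_diff_left inner_diff_right algebra_simps)
    also have "e \<bullet> G v = k \<bullet> v" by (simp add: k_def symG)
    also have "v \<bullet> G e = k \<bullet> v" by (simp add: k_def inner_commute)
    finally show ?thesis by (simp add: eGe)
  qed
  have vf: "v \<bullet> f v = - (1/2) * (v \<bullet> G v - 2 * (e \<bullet> v) * (k \<bullet> v))" for v
    by (simp add: f_def Pself[symmetric] PGP)
  have ef: "e \<bullet> f v = 0" for v by (simp add: f_def eP)
  have fe: "f e = 0" by (simp add: f_def Pe linear_0[OF linG] linear_0[OF linP])
  have ek: "e \<bullet> k = 0" by (simp add: k_def eGe)
  have sum_e: "(\<Sum>i\<in>UNIV. (e \<bullet> axis i 1) * (x \<bullet> axis i 1)) = e \<bullet> x" for x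
    unfolding inner_axis by (simp add: inner_vec_def)
  \<comment> \<open>Since e . k = 0 the mixed block has no trace, and J has trace 2 - m. So trace S
    is -1/2 times the negative number in \<open>tr\<close>.\<close>
  have "trace S = - (1/2) * ((\<Sum>i\<in>UNIV. axis i 1 \<bullet> G (axis i 1)) - 2 * (\<Sum>i\<in>UNIV. (e \<bullet> axis i 1) * (k \<bullet> axis i 1)))"
    unfolding S_def trace_matrix vf
    by (simp only: sum_distrib_left[symmetric] sum_subtractf mult.assoc)
  also have "\<dots> = - (1/2) * (\<Sum>i\<in>UNIV. axis i 1 \<bullet> G (axis i 1))"
    by (simp only: sum_e ek mult_zero_right diff_zero)
  also have "(\<Sum>i\<in>UNIV. axis i 1 \<bullet> G (axis i 1)) = trace H - h * (2 * (\<Sum>i\<in>UNIV. (e \<bullet> axis i 1) * (e \<bullet> axis i 1)) - CARD('m))"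
    unfolding Gv trace_def
    by (simp add: sum_subtractf sum_distrib_left[symmetric] matrix_vector_mult_basis inner_axis' column_def power2_eq_square)
  also have "\<dots> = trace H + (real CARD('m) - 2) * h" by (simp add: sum_e ee algebra_simps)
  finally have trS: "0 < trace S" using tr by (simp add: h_def)
  show ?thesis
  proof (rule that[of S k])
    show "S *v u = 0" using fe by (subst ue) (simp add: Sv linear_scale[OF linf])
    show "u \<bullet> (S *v v) = 0" for v by (subst ue) (simp add: Sv ef)
    show "u \<bullet> k = 0" by (subst ue) (simp add: ek)
    show "0 < trace S" by (rule trS)
    show "\<forall>\<^sub>F t in at_right 0. \<forall>y\<in>Y. cone_fun u (y + t *\<^sub>R (S *v y - (e \<bullet> y) *\<^sub>R k)) \<le> 0"
    proof (rule cone_perturbation[where H = "(*v) H" and h = h, OF _ _ d Y])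
      show "linear (\<lambda>y. S *v y - (e \<bullet> y) *\<^sub>R k)"
        by (intro linearI) (simp_all add: inner_add_right algebra_simps matrix_vector_right_distrib matrix_vector_mult_scaleR)
      show "2 * (2 * ((u /\<^sub>R norm u) \<bullet> v) * ((u /\<^sub>R norm u) \<bullet> (S *v v - (e \<bullet> v) *\<^sub>R k)) - v \<bullet> (S *v v - (e \<bullet> v) *\<^sub>R k)) =
        v \<bullet> (H *v v) - h * (2 * ((u /\<^sub>R norm u) \<bullet> v)\<^sup>2 - (norm v)\<^sup>2)" for v
        unfolding e_def[symmetric] Gv[symmetric] Sv
        by (simp add: inner_diff_right ef ek vf inner_commute algebra_simps)
    qed
    show "\<forall>\<^sub>F t in at_right 0. \<forall>y\<in>Y. cone_fun u (y + t *\<^sub>R (S *v y + (k \<bullet> y) *\<^sub>R e)) \<le> 0"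
    proof (rule cone_perturbation[where H = "(*v) H" and h = h, OF _ _ d Y])
      show "linear (\<lambda>y. S *v y + (k \<bullet> y) *\<^sub>R e)"
        by (intro linearI) (simp_all add: inner_add_right algebra_simps matrix_vector_right_distrib matrix_vector_mult_scaleR)
      show "2 * (2 * ((u /\<^sub>R norm u) \<bullet> v) * ((u /\<^sub>R norm u) \<bullet> (S *v v + (k \<bullet> v) *\<^sub>R e)) - v \<bullet> (S *v v + (k \<bullet> v) *\<^sub>R e)) =
        v \<bullet> (H *v v) - h * (2 * ((u /\<^sub>R norm u) \<bullet> v)\<^sup>2 - (norm v)\<^sup>2)" for v
        unfolding e_def[symmetric] Gv[symmetric] Sv
        by (simp add: inner_add_right ef ee vf inner_commute algebra_simps)
    qed
  qed
qed

section \<open>Moment matrices and separation\<close>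

definition outer :: "real^'m \<Rightarrow> real^'m^'m" where
  "outer v = (\<chi> i j. v $ i * v $ j)"

text \<open>The right-hand side of \<open>haar_second_moment\<close> at pairs of axis vectors, that
  is, the second moment of the uniform distribution on the boundary sphere.\<close>

definition sphere_moment :: "real^'m \<Rightarrow> real^'m^'m" where
  "sphere_moment u = (\<chi> i j. u $ i * u $ j / (norm u)^4 +
     ((if i = j then 1 else 0) - u $ i * u $ j / (norm u)\<^sup>2) / ((norm u)\<^sup>2 * (CARD('m) - 1)))"

lemma inner_outer: "A \<bullet> outer v = v \<bullet> (A *v v)"
  by (simp add: outer_def inner_vec_def matrix_vector_mult_def sum_distrib_left sum_distrib_right mult_ac)

lemma inner_sphere_moment:
  fixes u :: "real^'m"
  shows "A \<bullet> sphere_moment u = (u \<bullet> (A *v u)) / (norm u)^4 +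
    (trace A - (u \<bullet> (A *v u)) / (norm u)\<^sup>2) / ((norm u)\<^sup>2 * (CARD('m) - 1))"
proof -
  have "sphere_moment u = (1 / (norm u)^4) *\<^sub>R outer u +
     (1 / ((norm u)\<^sup>2 * (CARD('m) - 1))) *\<^sub>R (mat 1 - (1 / (norm u)\<^sup>2) *\<^sub>R outer u)"
    by (simp add: sphere_moment_def outer_def mat_def vec_eq_iff)
  moreover have "A \<bullet> mat 1 = trace A"
    by (simp add: inner_vec_def trace_def mat_def if_distrib cong: if_cong)
  ultimately show ?thesis
    by (simp add: inner_add_right inner_diff_right inner_outer)
qed

text \<open>The components of a second tensor power are the entries of \<open>outer\<close>, so a
  convex combination is a design with the same weights. The cone makes every normalizing factor
  nonzero.\<close>

lemma supports_design_if_in_hull: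
  fixes u :: "real^'m"
  assumes u: "u \<noteq> 0" and m: "2 \<le> CARD('m)" and Y: "\<And>y. y \<in> Y \<Longrightarrow> cone_fun u y \<le> 0"
    and hull: "sphere_moment u \<in> convex hull (outer ` {y /\<^sub>R (u \<bullet> y) | y. y \<in> Y \<and> y \<noteq> 0})"
  shows "supports_design u 2 Y"
proof -
  obtain N p x where px: "\<forall>i\<in>{1::nat..N}. 0 \<le> p i \<and> x i \<in> outer ` {y /\<^sub>R (u \<bullet> y) | y. y \<in> Y \<and> y \<noteq> 0}"
    and "sum p {1..N} = 1" "(\<Sum>i = 1..N. p i *\<^sub>R x i) = sphere_moment u"
    using hull unfolding convex_hull_indexed mem_Collect_eq by (elim exE conjE) (rule that)
  then have p: "\<And>i. i \<in> {1..N} \<Longrightarrow> 0 \<le> p i" "sum p {1..N} = 1"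
    and x: "\<And>i. i \<in> {1..N} \<Longrightarrow> x i \<in> outer ` {y /\<^sub>R (u \<bullet> y) | y. y \<in> Y \<and> y \<noteq> 0}"
      "(\<Sum>i = 1..N. p i *\<^sub>R x i) = sphere_moment u"
    by blast+
  have "\<exists>y. y \<in> Y \<and> y \<noteq> 0 \<and> x i = outer (y /\<^sub>R (u \<bullet> y))" if "i \<in> {1..N}" for i
    using x(1)[OF that] by auto
  then obtain y where y: "\<And>i. i \<in> {1..N} \<Longrightarrow> y i \<in> Y" "\<And>i. i \<in> {1..N} \<Longrightarrow> y i \<noteq> 0"
    "\<And>i. i \<in> {1..N} \<Longrightarrow> x i = outer (y i /\<^sub>R (u \<bullet> y i))" by metis
  have uy: "u \<bullet> y i \<noteq> 0" if "i \<in> {1..N}" for i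
    using cone_fun_le_0_imp_inner_pos[OF Y[OF y(1)[OF that]] u y(2)[OF that]] by simp
  \<comment> \<open>The convex combination is indexed from 1, designs from 0.\<close>
  have "spherical_design u 2 N (\<lambda>j. p (Suc j)) (\<lambda>j. y (Suc j) /\<^sub>R (u \<bullet> y (Suc j)))"
    unfolding spherical_design_def
  proof (intro conjI allI ballI impI)
    fix w i assume w: "w \<in> boundary_sphere u"
    have tp: "tensor_power 2 v i = v $ i 0 * v $ i 1" for v :: "real^'m"
      by (simp add: tensor_power_def numeral_2_eq_2 lessThan_Suc)
    have "(\<Sum>k<N. p (Suc k) * tensor_power 2 (y (Suc k) /\<^sub>R (u \<bullet> y (Suc k))) i) =
        (\<Sum>k = 1..N. p k * tensor_power 2 (y k /\<^sub>R (u \<bullet> y k)) i)"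
      by (simp add: sum.atLeast1_atMost_eq)
    also have "\<dots> = (\<Sum>k = 1..N. p k *\<^sub>R x k) $ i 0 $ i 1"
      unfolding sum_component by (intro sum.cong refl) (simp add: y(3) outer_def tp)
    also have "\<dots> = sphere_moment u $ i 0 $ i 1"
      by (simp only: x(2))
    also have "\<dots> = (LINT Q|haar (sym_group u). tensor_power 2 (Q *v w) i)"
    proof -
      have "axis a (1::real) $ b = (if b = a then 1 else 0)" for a b :: 'm
        by (simp add: axis_def)
      then show ?thesis
        using haar_second_moment[OF u m w, of "axis (i 0) 1" "axis (i 1) 1"]
        by (simp add: tp inner_axis' inner_axis sphere_moment_def)
    qed
    finally show "(\<Sum>k<N. p (Suc k) * tensor_power 2 (y (Suc k) /\<^sub>R (u \<bullet> y (Suc k))) i) =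
      (LINT Q|haar (sym_group u). tensor_power 2 (Q *v w) i)" .
  next
    show "(\<Sum>k<N. p (Suc k)) = 1" using p(2) by (simp add: sum.atLeast1_atMost_eq)
  next
    fix j assume "j < N"
    then have j: "Suc j \<in> {1..N}" by auto
    show "0 \<le> p (Suc j)" by (rule p(1)[OF j])
    show "(y (Suc j) /\<^sub>R (u \<bullet> y (Suc j))) \<bullet> u = 1"
      using uy[OF j] by (simp add: inner_commute[of _ u])
  qed
  moreover have "\<forall>j<N. y (Suc j) \<in> Y \<and> u \<bullet> y (Suc j) \<noteq> 0"
    by (intro allI impI conjI y(1) uy) auto
  ultimately show ?thesis
    unfolding supports_design_def
    by (intro exI[of _ N] exI[of _ "\<lambda>j. p (Suc j)"] exI[of _ "\<lambda>j. y (Suc j)"] conjI)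
qed

text \<open>Normalized vectors satisfy u . v = 1, so the affine inequality of the separating
  hyperplane can be written with a homogeneous quadratic form, which then applies to the vectors of
  \<open>Y\<close> themselves.\<close>

lemma cone_motion_if_not_design:
  fixes u :: "real^'m"
  defines "e \<equiv> u /\<^sub>R norm u"
  assumes u: "u \<noteq> 0" and m: "2 \<le> CARD('m)" and Y: "\<And>y. y \<in> Y \<Longrightarrow> cone_fun u y \<le> 0"
    and compact: "compact {y /\<^sub>R (u \<bullet> y) | y. y \<in> Y \<and> y \<noteq> 0}"
    and design: "\<not> supports_design u 2 Y"
  obtains S :: "real^'m^'m" and k :: "real^'m" where "S *v u = 0" "\<And>v. u \<bullet> (S *v v) = 0" "u \<bullet> k = 0" "0 < trace S"
    "\<forall>\<^sub>F t in at_right 0. \<forall>y\<in>Y. cone_fun u (y + t *\<^sub>R (S *v y - (e \<bullet> y) *\<^sub>R k)) \<le> 0"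
    "\<forall>\<^sub>F t in at_right 0. \<forall>y\<in>Y. cone_fun u (y + t *\<^sub>R (S *v y + (k \<bullet> y) *\<^sub>R e)) \<le> 0"
proof -
  let ?C = "convex hull (outer ` {y /\<^sub>R (u \<bullet> y) | y. y \<in> Y \<and> y \<noteq> 0})"
  have "compact ?C"
    unfolding outer_def by (intro compact_convex_hull compact_continuous_image compact continuous_intros)
  moreover have "sphere_moment u \<notin> ?C"
    using supports_design_if_in_hull[OF u m Y] design by blast
  ultimately obtain A b where A: "A \<bullet> sphere_moment u < b" "\<And>x. x \<in> ?C \<Longrightarrow> b < A \<bullet> x"
    using separating_hyperplane_closed_point[of ?C "sphere_moment u"] by (auto simp: compact_imp_closed)
  \<comment> \<open>A level strictly between leaves slack on both sides: \<open>H\<close> is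
    negative on the moment matrix and bounded below by a positive multiple of |y|^2 on
    \<open>Y\<close>.\<close>
  obtain b' where b': "A \<bullet> sphere_moment u < b'" "b' < b" using dense[OF A(1)] by auto
  \<comment> \<open>The quadratic form of \<open>A\<close>, symmetrized; subtracting b' u
    u\<open>\<^sup>T\<close> lowers its value on normalized vectors by b'.\<close>
  define H where "H = (1/2) *\<^sub>R (A + transpose A) - b' *\<^sub>R outer u"
  have tA: "x \<bullet> (transpose A *v y) = (A *v x) \<bullet> y" for x y
    by (metis dot_lmul_matrix inner_commute transpose_matrix_vector)
  have ou: "outer u *v y = (u \<bullet> y) *\<^sub>R u" for y
    by (simp add: outer_def matrix_vector_mult_def inner_vec_def vec_eq_iff sum_distrib_left sum_distrib_right mult_ac)
  have Hv: "H *v y = (1/2) *\<^sub>R (A *v y + transpose A *v y) - (b' * (u \<bullet> y)) *\<^sub>R u" for y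
    unfolding H_def
    by (simp add: matrix_vector_mult_diff_rdistrib matrix_vector_mult_add_rdistrib scaleR_matrix_vector_assoc[symmetric] ou
        del: transpose_matrix_vector)
  have Hq: "y \<bullet> (H *v y) = y \<bullet> (A *v y) - b' * (u \<bullet> y)\<^sup>2" for y
    by (simp add: Hv inner_diff_right inner_add_right tA inner_commute power2_eq_square del: transpose_matrix_vector)
  show ?thesis
  \<comment> \<open>The slack b - b' is a multiple of (u . y)^2, and |u| |y| \<le> 2 (u . y) turns
    this into |u|^2 |y|^2 / 4.\<close>
  proof (rule cone_motion[OF u, where H = H and Y = Y and d = "(b - b') * (norm u)\<^sup>2 / 4"])
    show "x \<bullet> (H *v y) = (H *v x) \<bullet> y" for x y
    proof -
      have "x \<bullet> (A *v y) = (transpose A *v x) \<bullet> y"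
        using tA[of y x] by (simp add: inner_commute del: transpose_matrix_vector)
      then show ?thesis
        by (simp add: Hv inner_diff_right inner_add_right inner_diff_left inner_add_left tA inner_commute del: transpose_matrix_vector)
    qed
    have nu: "norm u \<noteq> 0" using u by simp
    have m1: "real CARD('m) - 1 > 0" using m by simp
    have trH: "trace H = trace A - b' * (norm u)\<^sup>2"
      by (simp add: H_def trace_def transpose_def outer_def sum_subtractf sum_distrib_left[symmetric] sum.distrib
          power2_norm_eq_inner inner_vec_def)
    \<comment> \<open>The moment matrix has inner product 1 with u u\<open>\<^sup>T\<close>, as a
      mean over normalized vectors must.\<close>
    have "H \<bullet> sphere_moment u < 0"
    proof -
      have "H \<bullet> sphere_moment u = A \<bullet> sphere_moment u - b'"
        unfolding inner_sphere_moment trH Hq power2_norm_eq_inner[symmetric]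
        using nu m1 by (simp add: field_simps power2_eq_square power4_eq_xxxx)
      then show ?thesis using b' by simp
    qed
    moreover have "u \<bullet> (H *v u) = (norm u)\<^sup>2 * (e \<bullet> (H *v e))"
      using nu by (simp add: e_def matrix_vector_mult_scaleR power2_eq_square field_simps)
    ultimately have "(e \<bullet> (H *v e)) / (norm u)\<^sup>2 + (trace H - e \<bullet> (H *v e)) / ((norm u)\<^sup>2 * (CARD('m) - 1)) < 0"
      using nu by (simp add: inner_sphere_moment power4_eq_xxxx power2_eq_square)
    \<comment> \<open>Clearing denominators turns the negative inner product into the trace
      condition of \<open>cone_motion\<close>.\<close>
    then have "(norm u)\<^sup>2 * (CARD('m) - 1) * ((e \<bullet> (H *v e)) / (norm u)\<^sup>2 + (trace H - e \<bullet> (H *v e)) / ((norm u)\<^sup>2 * (CARD('m) - 1))) < 0"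
      using nu m1 by (intro mult_pos_neg) auto
    moreover have "a * n * (x / a + y / (a * n)) = n * x + y" if "a \<noteq> 0" "n \<noteq> 0" for a n x y :: real
      using that by (simp add: field_simps)
    from this[of "(norm u)\<^sup>2" "CARD('m) - 1" "e \<bullet> (H *v e)" "trace H - e \<bullet> (H *v e)"]
    have "(norm u)\<^sup>2 * (CARD('m) - 1) * ((e \<bullet> (H *v e)) / (norm u)\<^sup>2 + (trace H - e \<bullet> (H *v e)) / ((norm u)\<^sup>2 * (CARD('m) - 1))) =
        (CARD('m) - 1) * (e \<bullet> (H *v e)) + (trace H - e \<bullet> (H *v e))"
      using nu m1 by simp
    ultimately have "(CARD('m) - 1) * (e \<bullet> (H *v e)) + (trace H - e \<bullet> (H *v e)) < 0"
      by linarith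
    then show "trace H + (real CARD('m) - 2) * ((u /\<^sub>R norm u) \<bullet> (H *v (u /\<^sub>R norm u))) < 0"
      unfolding e_def[symmetric] by (simp add: algebra_simps)
    show "0 < (b - b') * (norm u)\<^sup>2 / 4" using b' nu by simp
    show "(b - b') * (norm u)\<^sup>2 / 4 * (norm y)\<^sup>2 \<le> y \<bullet> (H *v y)" if y: "y \<in> Y" for y
    proof (cases "y = 0")
      case False
      have n: "norm u * norm y \<le> 2 * (u \<bullet> y)" by (rule cone_fun_le_0_imp_norm_le[OF Y[OF y] u])
      have uy: "0 < u \<bullet> y" by (rule cone_fun_le_0_imp_inner_pos[OF Y[OF y] u False])
      have "outer (y /\<^sub>R (u \<bullet> y)) \<in> ?C" using y False by (intro hull_inc imageI) auto
      then have "b < A \<bullet> outer (y /\<^sub>R (u \<bullet> y))" by (rule A(2))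
      also have "\<dots> = (y \<bullet> (A *v y)) / (u \<bullet> y)\<^sup>2"
        using uy by (simp add: inner_outer matrix_vector_mult_scaleR power2_eq_square divide_inverse)
      finally have "b * (u \<bullet> y)\<^sup>2 < y \<bullet> (A *v y)" using uy by (simp add: field_simps)
      then have "(b - b') * (u \<bullet> y)\<^sup>2 \<le> y \<bullet> (H *v y)" by (simp add: Hq algebra_simps)
      moreover have "(b - b') * (norm u * norm y)\<^sup>2 \<le> (b - b') * (2 * (u \<bullet> y))\<^sup>2"
        using b' n by (intro mult_left_mono power_mono) auto
      ultimately show ?thesis by (simp add: power_mult_distrib)
    qed simp
    show "cone_fun u y \<le> 0" if "y \<in> Y" for y using that by (rule Y)
  qed (use that in \<open>simp add: e_def\<close>)
qed

section \<open>Action of the admissible maps on the cones\<close>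

lemma sign_maps_iff:
  "K \<in> sign_maps s ul un \<longleftrightarrow> (case s of Minus \<Rightarrow> \<forall>x. un \<bullet> (K *v x) = ul \<bullet> x | Plus \<Rightarrow> K *v ul = un)"
proof (cases s)
  case Minus
  have eq: "un \<bullet> (K *v x) = (transpose K *v un) \<bullet> x" for x
    by (simp add: dot_lmul_matrix)
  have "transpose K *v un = ul \<longleftrightarrow> (\<forall>x. (transpose K *v un) \<bullet> x = ul \<bullet> x)"
    by (metis vector_eq_rdot)
  then show ?thesis using Minus by (simp only: sign_maps_def eq sign.case mem_Collect_eq)
qed (simp add: sign_maps_def)

text \<open>If \<open>L\<close> annihilated the cone element \<open>x\<close>, then every \<open>y\<close> in an open half-space through \<open>u\<close>
  would have \<open>y + t x\<close> in the cone for large \<open>t\<close>, so the image of the cone would contain a line.\<close>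

lemma cone_kernel_trivial:
  fixes L :: "real^'l \<Rightarrow> real^'m" and ul :: "real^'l" and um :: "real^'m"
  assumes ul: "ul \<noteq> 0" and um: "um \<noteq> 0" and m: "2 \<le> CARD('m)" and L: "linear L" "surj L" "L ul = um"
    and cone: "\<And>v. cone_fun ul v \<le> 0 \<Longrightarrow> cone_fun um (L v) \<le> 0"
    and x: "cone_fun ul x \<le> 0" "x \<noteq> 0"
  shows "L x \<noteq> 0"
proof
  assume Lx: "L x = 0"
  define e where "e = ul /\<^sub>R norm ul"
  have ee: "e \<bullet> e = 1" using ul by (simp add: e_def power2_norm_eq_inner[symmetric] power2_eq_square)
  \<comment> \<open>The polarization of q at \<open>x\<close>: q(y + t x) = q(y) + 2 t \<phi>(y) +
    t^2 q(x).\<close>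
  define \<phi> where "\<phi> y = 2 * (e \<bullet> x) * (e \<bullet> y) - x \<bullet> y" for y
  have cx: "0 \<le> e \<bullet> x" "(norm x)\<^sup>2 \<le> 2 * (e \<bullet> x)\<^sup>2"
    using x by (auto simp: cone_fun_le_0_iff_quadratic e_def)
  have ex: "0 < e \<bullet> x" using cx x(2) by (cases "e \<bullet> x = 0") auto
  have half: "cone_fun um (L y) \<le> 0" if y: "0 < \<phi> y" for y
  proof -
    \<comment> \<open>The first bound makes the axial component of \<open>y + t x\<close>
      nonnegative, the second lets 2 t \<phi>(y) outweigh |y|^2.\<close>
    define t where "t = max (\<bar>e \<bullet> y\<bar> / (e \<bullet> x)) ((norm y)\<^sup>2 / (2 * \<phi> y))"
    have t1: "\<bar>e \<bullet> y\<bar> \<le> t * (e \<bullet> x)" using ex by (simp add: t_def pos_divide_le_eq[symmetric])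
    have t2: "(norm y)\<^sup>2 \<le> t * (2 * \<phi> y)" using y by (simp add: t_def pos_divide_le_eq[symmetric])
    have t0: "0 \<le> t" using ex by (simp add: t_def le_max_iff_disj)
    let ?q = "\<lambda>v. 2 * (e \<bullet> v)\<^sup>2 - v \<bullet> v"
    have "?q (y + t *\<^sub>R x) = 2 * (e \<bullet> y)\<^sup>2 - y \<bullet> y + t * (2 * \<phi> y) + t\<^sup>2 * ?q x"
      unfolding \<phi>_def power2_eq_square
      by (simp add: inner_add_left inner_add_right inner_commute algebra_simps)
    moreover have "0 \<le> t\<^sup>2 * ?q x" using cx by (simp add: power2_norm_eq_inner)
    moreover have "0 \<le> 2 * (e \<bullet> y)\<^sup>2" by simp
    ultimately have "0 \<le> ?q (y + t *\<^sub>R x)" using t2 unfolding power2_norm_eq_inner by linarith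
    moreover have "0 \<le> e \<bullet> (y + t *\<^sub>R x)" using t1 by (simp add: inner_add_right abs_le_iff)
    ultimately have "cone_fun ul (y + t *\<^sub>R x) \<le> 0"
      by (simp add: cone_fun_le_0_iff_quadratic e_def power2_norm_eq_inner)
    then show ?thesis
      using cone[of "y + t *\<^sub>R x"] by (simp add: linear_add[OF L(1)] linear_scale[OF L(1)] Lx)
  qed
  have "dim {z. um \<bullet> z = 0} \<noteq> 0"
    using dim_hyperplane[OF um] m by simp
  then obtain z where z: "um \<bullet> z = 0" "z \<noteq> 0" by (auto simp: dim_eq_0)
  have zc: "\<not> cone_fun um (c *\<^sub>R z) \<le> 0" if "c \<noteq> 0" for c
    using cone_fun_le_0_imp_inner_pos[of um "c *\<^sub>R z"] um z that by auto
  obtain y where y: "z = L y" using L(2) by (metis surjD)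
  have \<phi>_scale: "\<phi> (c *\<^sub>R y) = c * \<phi> y" for c by (simp add: \<phi>_def algebra_simps)
  \<comment> \<open>Otherwise \<open>y\<close> or \<open>- y\<close> lies in the open half-space,
    which puts \<open>z\<close> or \<open>- z\<close> in the cone; but both are orthogonal to
    \<open>um\<close>.\<close>
  have "\<phi> y = 0"
    using half[of "1 *\<^sub>R y"] half[of "(-1) *\<^sub>R y"] zc[of 1] zc[of "-1"] unfolding \<phi>_scale
    by (auto simp: linear_scale[OF L(1)] y[symmetric] linear_neg[OF L(1)] intro: linorder_cases[of "\<phi> y" 0])
  have \<phi>u: "0 < \<phi> ul"
  proof -
    have "\<phi> ul = (norm ul) * (e \<bullet> x)"
      using ul by (simp add: \<phi>_def e_def inner_commute[of x] power2_norm_eq_inner[symmetric] power2_eq_square field_simps)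
    then show ?thesis using ex ul by simp
  qed
  \<comment> \<open>As \<phi> is positive at \<open>ul\<close>, adding a small multiple of
    \<open>ul\<close> moves \<open>y\<close> into the half-space. The limit puts \<open>z\<close>
    itself in the closed cone, a contradiction.\<close>
  have pos: "cone_fun um (z + c *\<^sub>R um) \<le> 0" if "0 < c" for c
  proof -
    have "\<phi> (y + c *\<^sub>R ul) = \<phi> y + c * \<phi> ul"
      by (simp add: \<phi>_def inner_add_right algebra_simps)
    then show ?thesis
      using half[of "y + c *\<^sub>R ul"] \<phi>u \<open>\<phi> y = 0\<close> that L(3)
      by (simp add: linear_add[OF L(1)] linear_scale[OF L(1)] y)
  qed
  have "((\<lambda>c. cone_fun um (z + c *\<^sub>R um)) \<longlongrightarrow> cone_fun um (z + 0 *\<^sub>R um)) (at_right 0)"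
    by (intro continuous_on_tendsto_compose[where s = UNIV and f = "\<lambda>c. cone_fun um (z + c *\<^sub>R um)" and g = "\<lambda>c. c"])
       (auto intro!: continuous_intros tendsto_eq_intros)
  then have "cone_fun um (z + 0 *\<^sub>R um) \<le> 0"
    by (rule tendsto_upperbound) (auto intro!: eventually_mono[OF eventually_at_right_less] pos)
  then show False using zc[of 1] by simp
qed

text \<open>Every nonzero element of the cone has a positive multiple in \<open>sign_space\<close>,
  and linearity passes from there to the whole cone.\<close>

lemma cone_image_if_sign_map:
  fixes L :: "real^'l^'m"
  assumes ul: "ul \<noteq> 0" and um: "um \<noteq> 0" and L: "L \<in> sign_maps s ul um" "(*v) L ` sign_space s ul = sign_space s um"
    and v: "cone_fun ul v \<le> 0"
  shows "cone_fun um (L *v v) \<le> 0"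
proof (cases "v = 0")
  case False
  have uv: "0 < ul \<bullet> v"
    by (rule cone_fun_le_0_imp_inner_pos[OF v ul False])
  obtain c where c: "0 < c" "c *\<^sub>R v \<in> sign_space s ul"
  proof (cases s)
    case Minus
    then show ?thesis
      using that[of "1 / (ul \<bullet> v)"] uv cone_fun_scale[OF _ v, of "1 / (ul \<bullet> v)"]
      by (simp add: sign_space_def state_space_def)
  next
    case Plus
    \<comment> \<open>Makes the norm of \<open>c v\<close> a tenth of that of \<open>ul\<close>, so
      that \<open>ul - c v\<close> is near the axis.\<close>
    define c where "c = norm ul / (10 * norm v)"
    have "0 < c" using ul False by (simp add: c_def)
    moreover have "cone_fun ul (ul - c *\<^sub>R v) \<le> 0"
      using cone_fun_le_0_near_axis[OF ul, of 1 "ul - c *\<^sub>R v"] \<open>0 < c\<close> False by (simp add: c_def)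
    ultimately show ?thesis
      using that[of c] cone_fun_scale[OF _ v, of c] Plus by (simp add: sign_space_def effect_space_def)
  qed
  then have "cone_fun um (L *v (c *\<^sub>R v)) \<le> 0"
    using L(2) by (intro sign_space_cone[of _ s]) blast
  then show ?thesis
    using cone_fun_scale[of "1 / c" um "L *v (c *\<^sub>R v)"] c(1) by (simp add: matrix_vector_mult_scaleR)
qed (simp add: cone_fun_def)

section \<open>Observational completeness\<close>

text \<open>With T the inverse of \<open>Q\<close>, the map N T L is feasible, and its image is the
  image under N of a set whose volume is smaller by the factor d.\<close>

lemma not_complete_if_contracting:
  fixes M :: "real^'l^'n" and L :: "real^'l^'m" and N :: "real^'m \<Rightarrow> real^'n" and Q :: "real^'m \<Rightarrow> real^'m"
  assumes nz: "ul \<noteq> 0" "um \<noteq> 0"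
    and M: "M \<in> sign_maps s ul un"
    and L: "L \<in> sign_maps s ul um" "(*v) L ` sign_space s ul = sign_space s um" "surj ((*v) L)"
    and N: "linear N" "inj N" "\<And>x. N (L *v x) = M *v x"
    and complete: "obs_complete s ul un (sign_space s ul) M X"
    and Q: "linear Q" "inj Q" "case s of Minus \<Rightarrow> \<forall>v. um \<bullet> Q v = um \<bullet> v | Plus \<Rightarrow> Q um = um"
    and QX: "\<And>x. x \<in> X \<Longrightarrow> Q (L *v x) \<in> sign_space s um"
    and d: "1 < d" "emeasure lborel (thicken s um (sign_space s um)) =
       ennreal d * emeasure lborel (thicken s um {y. Q y \<in> sign_space s um})"
  shows False
proof -
  obtain T where T: "linear T" "\<And>x. T (Q x) = x" "\<And>x. Q (T x) = x"
    using linear_injective_isomorphism[OF Q(1,2)] by auto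
  let ?X = "sign_space s ul" and ?Xm = "sign_space s um"
  define X2 where "X2 = {y. Q y \<in> ?Xm}"
  have X2: "X2 = T ` ?Xm" unfolding X2_def by (auto simp: T image_iff) (metis T(2))
  define K' where "K' = matrix (\<lambda>x. N (T (L *v x)))"
  have linK: "linear (\<lambda>x. N (T (L *v x)))"
    using linear_compose[OF linear_compose[OF matrix_vector_mul_linear[of L] T(1)] N(1)] by (simp add: o_def)
  have K'v: "K' *v x = N (T (L *v x))" for x using linK by (simp add: K'_def matrix_works)
  \<comment> \<open>The definition of \<open>ddi\<close> speaks of images: the minimizer
    \<open>K\<close> need not be \<open>M\<close>, but has the same image, hence the same
    volume.\<close>
  obtain K where K: "(*v) K ` ?X = (*v) M ` ?X"
    "is_arg_min (\<lambda>K. aff_vol ((*v) K ` ?X)) (\<lambda>K. K \<in> feasible_maps s ul un ((*v) M ` X) ?X) K"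
    using complete by (auto simp: obs_complete_def ddi_def set_eq_iff) metis
  have XX: "X \<subseteq> ?X" using complete by (simp add: obs_complete_def)
  \<comment> \<open>Feasibility of \<open>K\<close> puts the whole image of \<open>M\<close> in the
    span of the data, since the standard space spans.\<close>
  have span: "range ((*v) M) \<subseteq> span ((*v) M ` X)"
  proof -
    have "(*v) M ` ?X \<subseteq> span ((*v) M ` X)"
      using K by (auto simp: is_arg_min_def feasible_maps_def)
    then have "span ((*v) M ` ?X) \<subseteq> span ((*v) M ` X)"
      by (rule span_minimal) simp
    then show ?thesis
      using span_sign_space[OF nz(1), of s] by (simp add: linear_span_image)
  qed
  have "K' \<in> sign_maps s ul un"
  proof (cases s)
    case Minus
    have Ns: "un \<bullet> N y = um \<bullet> y" for y
    proof -
      obtain x where "y = L *v x" using L(3) by (metis surjD)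
      then show ?thesis using M L(1) Minus by (simp add: N(3) sign_maps_iff)
    qed
    have Qs: "um \<bullet> Q v = um \<bullet> v" for v using Q(3) Minus by simp
    have "um \<bullet> T v = um \<bullet> v" for v using Qs[of "T v"] by (simp add: T)
    then show ?thesis using L(1) Minus by (simp add: sign_maps_iff K'v Ns)
  next
    case Plus
    have "T um = um" using Q(3) Plus T(2)[of um] by simp
    moreover have "N um = un" using M L(1) Plus N(3)[of ul] by (simp add: sign_maps_iff)
    ultimately show ?thesis using L(1) Plus by (simp add: sign_maps_iff K'v)
  qed
  moreover have "(*v) M ` X \<subseteq> (*v) K' ` ?X"
  proof
    fix z assume "z \<in> (*v) M ` X"
    then obtain x where x: "x \<in> X" "z = M *v x" by auto
    obtain x' where x': "x' \<in> ?X" "Q (L *v x) = L *v x'" using QX[OF x(1)] L(2) by (metis imageE)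
    have "K' *v x' = N (T (Q (L *v x)))" by (simp add: K'v x')
    also have "\<dots> = z" by (simp add: T N x)
    finally show "z \<in> (*v) K' ` ?X" using x'(1) by blast
  qed
  moreover have "(*v) K' ` ?X \<subseteq> span ((*v) M ` X)"
  proof
    fix z assume "z \<in> (*v) K' ` ?X"
    then obtain x where "z = N (T (L *v x))" by (auto simp: K'v)
    moreover obtain x' where "T (L *v x) = L *v x'" using L(3) by (metis surjD)
    ultimately show "z \<in> span ((*v) M ` X)" using span by (auto simp: N)
  qed
  ultimately have "K' \<in> feasible_maps s ul un ((*v) M ` X) ?X"
    by (simp add: feasible_maps_def)
  then have min: "\<not> aff_vol ((*v) K' ` ?X) < aff_vol ((*v) M ` ?X)"
    using K by (auto simp: is_arg_min_def)
  have im: "(*v) M ` ?X = N ` ?Xm" "(*v) K' ` ?X = N ` X2"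
    by (simp_all add: X2 L(2)[symmetric] image_image N K'v)
  obtain \<kappa> where \<kappa>: "0 < \<kappa>" "\<And>Y. compact Y \<Longrightarrow> affine hull Y = unit_plane s um \<Longrightarrow>
      aff_vol (N ` Y) = ennreal \<kappa> * emeasure lborel (thicken s um Y)"
  proof -
    have "(unit_plane s um = UNIV \<and> (case s of Minus \<Rightarrow> {0..1} | Plus \<Rightarrow> {0::real}) = {0}) \<or>
       (unit_plane s um = {v. um \<bullet> v = 1} \<and> um \<noteq> 0 \<and> (case s of Minus \<Rightarrow> {0..1} | Plus \<Rightarrow> {0::real}) = {0..1})"
      using nz by (cases s) (simp_all add: unit_plane_def)
    then show ?thesis
      by (rule aff_vol_linear_image[OF N(1,2)]) (use that in \<open>simp add: thicken_def\<close>)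
  qed
  have cX: "compact ?Xm" by (rule compact_sign_space[OF nz(2)])
  have cX2: "compact X2"
    unfolding X2 using T(1) by (intro compact_continuous_image cX) (simp add: linear_continuous_on linear_linear)
  have hull: "affine hull X2 = unit_plane s um"
  proof -
    have "affine hull X2 = T ` (affine hull ?Xm)"
      unfolding X2 using affine_hull_linear_image[of T ?Xm] T(1) by (simp add: linear_conv_bounded_linear)
    also have "\<dots> = T ` unit_plane s um" by (simp add: affine_hull_sign_space[OF nz(2)])
    also have "\<dots> = Q -` unit_plane s um"
      by (rule image_inverse_eq_vimage) (simp_all add: T)
    also have "\<dots> = unit_plane s um" using Q(3) by (cases s) (auto simp: unit_plane_def)
    finally show ?thesis .
  qed
  \<comment> \<open>In \<open>ennreal\<close> a factor above 1 gives a strict inequality only for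
    finite and nonzero volumes.\<close>
  define r where "r = measure lborel (thicken s um X2)"
  have "emeasure lborel (thicken s um X2) < \<infinity>"
    by (rule emeasure_compact_finite[OF compact_thicken[OF cX2]])
  then have r: "emeasure lborel (thicken s um X2) = ennreal r" by (simp add: r_def emeasure_eq_ennreal_measure less_top)
  have "emeasure lborel (thicken s um X2) \<noteq> 0"
    using d(2) emeasure_thicken_sign_space[OF nz(2), of s] unfolding X2_def by auto
  then have r0: "0 < r" using r by (metis ennreal_eq_0_iff not_le)
  have "aff_vol (N ` X2) = ennreal (\<kappa> * r)"
    using \<kappa>(2)[OF cX2 hull] \<kappa>(1) r0 by (simp add: r ennreal_mult)
  moreover have "aff_vol (N ` ?Xm) = ennreal (\<kappa> * (d * r))"
    using \<kappa>(2)[OF cX affine_hull_sign_space[OF nz(2)]] \<kappa>(1) r0 d by (simp add: X2_def[symmetric] r ennreal_mult)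
  moreover have "\<kappa> * r < \<kappa> * (d * r)" using \<kappa>(1) r0 d(1) by simp
  ultimately have "aff_vol (N ` X2) < aff_vol (N ` ?Xm)"
    using \<kappa>(1) r0 by (simp add: ennreal_lessI)
  then show False using min by (simp add: im)
qed

text \<open>On a line |u| |w| = \<bar>u . w\<bar> = 1, whereas a boundary point would need |u| |w| =
  sqrt 2. So the moment condition of a design is vacuous.\<close>

lemma boundary_sphere_dim_1:
  fixes u :: "real^'m"
  assumes "CARD('m) = 1" "u \<noteq> 0"
  shows "boundary_sphere u = {}"
proof -
  obtain a where a: "(UNIV :: 'm set) = {a}" using assms(1) by (auto simp: card_1_singleton_iff)
  have n: "norm x = \<bar>x $ a\<bar>" and i: "x \<bullet> y = x $ a * y $ a" for x y :: "real^'m"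
    by (simp_all add: norm_vec_def L2_set_def inner_vec_def a)
  have False if w: "u \<bullet> w = 1" "cone_fun u w = 0" for w
  proof -
    have "norm u * norm w = 1" using w(1) by (simp add: n i abs_mult[symmetric])
    moreover have "norm u * norm w = sqrt 2"
      using w assms(2) by (simp add: cone_fun_def)
    ultimately show False by simp
  qed
  then show ?thesis by (auto simp: boundary_sphere_def)
qed

lemma supports_design_dim_1:
  fixes u :: "real^'m"
  assumes "CARD('m) = 1" "u \<noteq> 0" "y \<in> Y" "u \<bullet> y \<noteq> 0"
  shows "supports_design u t Y"
  unfolding supports_design_def spherical_design_def boundary_sphere_dim_1[OF assms(1,2)]
  using assms(3,4) by (intro exI[of _ 1] exI[of _ "\<lambda>_. 1"] exI[of _ "\<lambda>_. y"]) (auto simp: inner_commute)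

text \<open>The section of the closed cone over \<open>X\<close> by ul . x = 1 is compact, and the
  normalized image is a continuous image of it: the map x -> L x / (um . L x) is homogeneous of
  degree 0, so rescaling \<open>x\<close> first changes nothing.\<close>

lemma compact_normalized_image:
  fixes L :: "real^'l^'m"
  assumes ul: "ul \<noteq> 0" and X: "\<And>x. x \<in> X \<Longrightarrow> cone_fun ul x \<le> 0" and closed: "closed (cone hull X)"
    and pos: "\<And>x. cone_fun ul x \<le> 0 \<Longrightarrow> x \<noteq> 0 \<Longrightarrow> um \<bullet> (L *v x) \<noteq> 0"
  shows "compact {y /\<^sub>R (um \<bullet> y) | y. y \<in> (*v) L ` X \<and> y \<noteq> 0}"
proof -
  let ?S = "{x \<in> cone hull X. ul \<bullet> x = 1}"
  have cone: "cone_fun ul x \<le> 0" if "x \<in> cone hull X" for x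
    using that X by (auto simp: cone_hull_expl intro: cone_fun_scale)
  have "closed ?S"
  proof -
    have "?S = cone hull X \<inter> {x. ul \<bullet> x = 1}" by auto
    then show ?thesis using closed closed_hyperplane by (metis closed_Int)
  qed
  moreover have "bounded ?S"
  proof -
    have "norm x \<le> 2 / norm ul" if "x \<in> ?S" for x
      using cone_fun_le_0_imp_norm_le[OF cone ul, of x] that ul by (simp add: field_simps)
    then show ?thesis by (auto simp: bounded_iff)
  qed
  ultimately have "compact ?S" by (simp add: compact_eq_bounded_closed)
  moreover have "continuous_on ?S (\<lambda>x. (L *v x) /\<^sub>R (um \<bullet> (L *v x)))"
  proof -
    have "um \<bullet> (L *v x) \<noteq> 0" if "x \<in> ?S" for x
      using that pos[OF cone, of x] by (cases "x = 0") auto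
    then show ?thesis by (intro continuous_intros matrix_vector_mult_linear_continuous_on) auto
  qed
  ultimately have "compact ((\<lambda>x. (L *v x) /\<^sub>R (um \<bullet> (L *v x))) ` ?S)"
    by (rule compact_continuous_image[rotated])
  also have "(\<lambda>x. (L *v x) /\<^sub>R (um \<bullet> (L *v x))) ` ?S = {y /\<^sub>R (um \<bullet> y) | y. y \<in> (*v) L ` X \<and> y \<noteq> 0}"
  proof (intro set_eqI iffI)
    fix z assume "z \<in> (\<lambda>x. (L *v x) /\<^sub>R (um \<bullet> (L *v x))) ` ?S"
    then obtain x where x: "x \<in> cone hull X" "ul \<bullet> x = 1" "z = (L *v x) /\<^sub>R (um \<bullet> (L *v x))" by auto
    then obtain c x' where c: "0 \<le> c" "x' \<in> X" "x = c *\<^sub>R x'" by (auto simp: cone_hull_expl)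
    have nz: "c \<noteq> 0" "x' \<noteq> 0" using x(2) c(3) by auto
    then have "L *v x' \<noteq> 0" using pos[OF X[OF c(2)] nz(2)] by auto
    moreover have "z = (L *v x') /\<^sub>R (um \<bullet> (L *v x'))"
      using nz by (simp add: x(3) c(3) matrix_vector_mult_scaleR)
    ultimately show "z \<in> {y /\<^sub>R (um \<bullet> y) | y. y \<in> (*v) L ` X \<and> y \<noteq> 0}" using c(2) by blast
  next
    fix z assume "z \<in> {y /\<^sub>R (um \<bullet> y) | y. y \<in> (*v) L ` X \<and> y \<noteq> 0}"
    then obtain x where x: "x \<in> X" "L *v x \<noteq> 0" "z = (L *v x) /\<^sub>R (um \<bullet> (L *v x))" by auto
    then have "x \<noteq> 0" by auto
    then have p: "0 < ul \<bullet> x" by (rule cone_fun_le_0_imp_inner_pos[OF X[OF x(1)] ul])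
    let ?x = "(1 / (ul \<bullet> x)) *\<^sub>R x"
    have "?x \<in> cone hull X" using p x(1) by (auto simp: cone_hull_expl intro!: exI[of _ "1 / (ul \<bullet> x)"] exI[of _ x])
    then have "?x \<in> ?S" using p by simp
    moreover have "z = (L *v ?x) /\<^sub>R (um \<bullet> (L *v ?x))"
      using p by (simp add: x(3) matrix_vector_mult_scaleR divide_inverse)
    ultimately show "z \<in> (\<lambda>x. (L *v x) /\<^sub>R (um \<bullet> (L *v x))) ` ?S" by blast
  qed
  finally show ?thesis .
qed

lemma supports_design_if_complete:
  fixes M :: "real^'l^'n" and L :: "real^'l^'m" and N :: "real^'m \<Rightarrow> real^'n"
  assumes nz: "ul \<noteq> 0" "um \<noteq> 0" and m: "2 \<le> CARD('m)"
    and M: "M \<in> sign_maps s ul un"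
    and L: "L \<in> sign_maps s ul um" "(*v) L ` sign_space s ul = sign_space s um" "surj ((*v) L)"
    and N: "linear N" "inj N" "\<And>x. N (L *v x) = M *v x"
    and X: "X \<subseteq> sign_space s ul" "s = Plus \<Longrightarrow> half_unit_symmetric ul X" "closed (cone hull X)"
    and complete: "obs_complete s ul un (sign_space s ul) M X"
  shows "supports_design um 2 ((*v) L ` X)"
proof (rule ccontr)
  assume not_design: "\<not> ?thesis"
  let ?Xm = "sign_space s um" and ?Y = "(*v) L ` X"
  define e where "e = um /\<^sub>R norm um"
  have XC: "cone_fun ul x \<le> 0" if "x \<in> X" for x using that X(1) sign_space_cone by blast
  have LC: "cone_fun um (L *v x) \<le> 0" if "cone_fun ul x \<le> 0" for x
    by (rule cone_image_if_sign_map[OF nz L(1,2) that])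
  have YC: "cone_fun um y \<le> 0" if "y \<in> ?Y" for y using that LC XC by auto
  have Lnz: "um \<bullet> (L *v x) \<noteq> 0" if "cone_fun ul x \<le> 0" "x \<noteq> 0" for x
  proof -
    have "L *v x \<noteq> 0"
    \<comment> \<open>In the - case \<open>L\<close> preserves the normalization. In the + case it
      only preserves the unit, and the pointedness of the image cone is needed.\<close>
    proof (cases s)
      case Minus
      then have "um \<bullet> (L *v x) = ul \<bullet> x" using L(1) by (simp add: sign_maps_iff)
      then show ?thesis using cone_fun_le_0_imp_inner_pos[OF that(1) nz(1) that(2)] by auto
    next
      case Plus
      then have "L *v ul = um" using L(1) by (simp add: sign_maps_iff)
      then show ?thesis using cone_kernel_trivial[OF nz m _ L(3)] LC that by blast
    qed
    then show ?thesis using cone_fun_le_0_imp_inner_pos[OF LC[OF that(1)] nz(2)] by auto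
  qed
  have compact: "compact {y /\<^sub>R (um \<bullet> y) | y. y \<in> ?Y \<and> y \<noteq> 0}"
    by (rule compact_normalized_image[OF nz(1) XC X(3) Lnz])
  obtain S :: "real^'m^'m" and k :: "real^'m" where S: "S *v um = 0" "\<And>v. um \<bullet> (S *v v) = 0" "um \<bullet> k = 0" "0 < trace S"
    "\<forall>\<^sub>F t in at_right 0. \<forall>y\<in>?Y. cone_fun um (y + t *\<^sub>R (S *v y - (e \<bullet> y) *\<^sub>R k)) \<le> 0"
    "\<forall>\<^sub>F t in at_right 0. \<forall>y\<in>?Y. cone_fun um (y + t *\<^sub>R (S *v y + (k \<bullet> y) *\<^sub>R e)) \<le> 0"
    by (rule cone_motion_if_not_design[OF nz(2) m _ compact not_design, folded e_def]) (erule YC, rule that)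
  have nu: "norm um \<noteq> 0" using nz by simp
  have ume: "um \<bullet> e = norm um" using nz by (simp add: e_def power2_norm_eq_inner[symmetric] power2_eq_square)
  have cXm: "compact (thicken s um ?Xm)" by (rule compact_thicken[OF compact_sign_space[OF nz(2)]])
  show False
  proof (cases s)
    case Minus
    obtain t d where t: "1 < d" "inj (\<lambda>x. x + t *\<^sub>R (S *v x))"
      "\<And>A. A \<in> sets borel \<Longrightarrow> emeasure lborel A < \<infinity> \<Longrightarrow>
        emeasure lborel ((\<lambda>x. x + t *\<^sub>R (S *v x)) ` A) = ennreal d * emeasure lborel A"
      "\<And>y. y \<in> ?Y \<Longrightarrow> cone_fun um (y + t *\<^sub>R (S *v y - (e \<bullet> y) *\<^sub>R k)) \<le> 0"
      using eventually_happens[OF eventually_conj[OF emeasure_perturbation_image[OF S(4)] S(5)]] by auto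
    \<comment> \<open>\<open>Q\<close> shears \<open>um\<close>, the direction of thickening, while
      \<open>?R\<close> fixes it because S um = 0. On the plane um . v = 1 they differ by a constant
      translation, so the thickened volume changes by the determinant of \<open>?R\<close>.\<close>
    let ?R = "\<lambda>x. x + t *\<^sub>R (S *v x)"
    define Q where "Q v = v + t *\<^sub>R (S *v v - (e \<bullet> v) *\<^sub>R k)" for v
    have linQ: "linear Q"
      unfolding Q_def by (intro linearI) (simp_all add: inner_add_right algebra_simps matrix_vector_right_distrib matrix_vector_mult_scaleR)
    have uQ: "um \<bullet> Q v = um \<bullet> v" for v
      by (simp add: Q_def inner_add_right inner_diff_right S)
    have QR: "Q v = ?R v - ((t * (um \<bullet> v)) / norm um) *\<^sub>R k" for v
      by (simp add: Q_def e_def algebra_simps divide_inverse)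
    have injQ: "inj Q"
    proof (rule linear_injective_0[OF linQ, THEN iffD2], intro allI impI)
      fix v assume "Q v = 0"
      then have "um \<bullet> v = 0" using uQ[of v] by simp
      then have "?R v = ?R 0" using QR[of v] \<open>Q v = 0\<close> by simp
      then show "v = 0" by (rule injD[OF t(2)])
    qed
    let ?X2 = "{y. Q y \<in> ?Xm}"
    obtain T where T: "linear T" "\<And>x. T (Q x) = x" "\<And>x. Q (T x) = x"
      using linear_injective_isomorphism[OF linQ injQ] by auto
    have X2: "?X2 = T ` ?Xm" by (subst image_inverse_eq_vimage[of Q T]) (auto simp: T)
    have cX2: "compact (thicken s um ?X2)"
      unfolding X2 using T(1) compact_sign_space[OF nz(2)]
      by (intro compact_thicken compact_continuous_image) (auto simp: linear_continuous_on linear_linear)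
    have R: "?R (y + c *\<^sub>R um) = (t / norm um) *\<^sub>R k + (Q y + c *\<^sub>R um)" if "um \<bullet> y = 1" for y c
      using that by (simp add: QR matrix_vector_right_distrib matrix_vector_mult_scaleR S algebra_simps)
    have um1: "um \<bullet> y = 1" if "y \<in> ?Xm" for y
      using that Minus by (simp add: sign_space_def state_space_def)
    have "?R ` thicken s um ?X2 = (\<lambda>x. (t / norm um) *\<^sub>R k + x) ` thicken s um ?Xm"
    proof (intro set_eqI iffI)
      fix z assume "z \<in> ?R ` thicken s um ?X2"
      then obtain y c where y: "Q y \<in> ?Xm" "c \<in> {0..1}" "z = ?R (y + c *\<^sub>R um)"
        using Minus by (auto simp: thicken_def)
      have "um \<bullet> y = 1" using um1[OF y(1)] uQ by simp
      then have "z = (t / norm um) *\<^sub>R k + (Q y + c *\<^sub>R um)" using R y(3) by simp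
      moreover have "Q y + c *\<^sub>R um \<in> thicken s um ?Xm"
        using y Minus unfolding thicken_def by auto
      ultimately show "z \<in> (\<lambda>x. (t / norm um) *\<^sub>R k + x) ` thicken s um ?Xm" by blast
    next
      fix z assume "z \<in> (\<lambda>x. (t / norm um) *\<^sub>R k + x) ` thicken s um ?Xm"
      then obtain y c where y: "y \<in> ?Xm" "c \<in> {0..1}" "z = (t / norm um) *\<^sub>R k + (y + c *\<^sub>R um)"
        using Minus by (auto simp: thicken_def)
      have "um \<bullet> T y = 1" using um1[OF y(1)] uQ[of "T y"] by (simp add: T)
      then have "z = ?R (T y + c *\<^sub>R um)" using R y(3) by (simp add: T)
      moreover have "T y + c *\<^sub>R um \<in> thicken s um ?X2"
        using y Minus unfolding thicken_def
        by (auto intro!: exI[of _ "T y"] exI[of _ c] simp: T)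
      ultimately show "z \<in> ?R ` thicken s um ?X2" by blast
    qed
    then have "emeasure lborel (thicken s um ?Xm) = emeasure lborel (?R ` thicken s um ?X2)"
      using emeasure_lborel_translation[OF borel_compact[OF cXm]] by simp
    also have "\<dots> = ennreal d * emeasure lborel (thicken s um ?X2)"
      by (intro t(3) borel_compact cX2 emeasure_compact_finite)
    finally have vol: "emeasure lborel (thicken s um ?Xm) = ennreal d * emeasure lborel (thicken s um ?X2)" .
    have QX: "Q (L *v x) \<in> ?Xm" if "x \<in> X" for x
    proof -
      have "ul \<bullet> x = 1" using that X(1) Minus by (auto simp: sign_space_def state_space_def)
      then have "um \<bullet> (L *v x) = 1" using L(1) Minus by (simp add: sign_maps_iff)
      then show ?thesis
        using t(4)[of "L *v x"] that uQ[of "L *v x"] Minus by (simp add: sign_space_def state_space_def Q_def)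
    qed
    show False
      by (rule not_complete_if_contracting[OF nz M L N complete linQ injQ _ QX t(1) vol]) (simp add: Minus uQ)
  next
    case Plus
    \<comment> \<open>The summand e k\<open>\<^sup>T\<close> is traceless as e . k = 0, and it
      annihilates \<open>um\<close>, so \<open>Q\<close> fixes the unit.\<close>
    define A where "A = S + (\<chi> i j. e $ i * k $ j)"
    have Av: "A *v v = S *v v + (k \<bullet> v) *\<^sub>R e" for v
    proof -
      have "(\<chi> i j. e $ i * k $ j) *v v = (k \<bullet> v) *\<^sub>R e"
        by (simp add: vec_eq_iff matrix_vector_mult_def inner_vec_def sum_distrib_left sum_distrib_right mult_ac)
      then show ?thesis by (simp add: A_def matrix_vector_mult_add_rdistrib)
    qed
    have "e \<bullet> k = 0" using S(3) by (simp add: e_def)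
    then have trA: "0 < trace A"
      using S(4) by (simp add: A_def trace_def sum.distrib inner_vec_def)
    obtain t d where t: "1 < d" "inj (\<lambda>x. x + t *\<^sub>R (A *v x))"
      "\<And>B. B \<in> sets borel \<Longrightarrow> emeasure lborel B < \<infinity> \<Longrightarrow>
        emeasure lborel ((\<lambda>x. x + t *\<^sub>R (A *v x)) ` B) = ennreal d * emeasure lborel B"
      "\<And>y. y \<in> ?Y \<Longrightarrow> cone_fun um (y + t *\<^sub>R (S *v y + (k \<bullet> y) *\<^sub>R e)) \<le> 0"
      using eventually_happens[OF eventually_conj[OF emeasure_perturbation_image[OF trA] S(6)]] by auto
    define Q where "Q v = v + t *\<^sub>R (A *v v)" for v
    have linQ: "linear Q"
      unfolding Q_def by (intro linearI) (simp_all add: algebra_simps matrix_vector_right_distrib matrix_vector_mult_scaleR)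
    have injQ: "inj Q" using t(2) by (simp add: Q_def[abs_def])
    have Qum: "Q um = um" using S(3) by (simp add: Q_def Av S(1) inner_commute)
    have thick: "thicken s um B = B" for B by (simp add: thicken_def Plus)
    let ?X2 = "{y. Q y \<in> ?Xm}"
    obtain T where T: "linear T" "\<And>x. T (Q x) = x" "\<And>x. Q (T x) = x"
      using linear_injective_isomorphism[OF linQ injQ] by auto
    have X2: "?X2 = T ` ?Xm" by (subst image_inverse_eq_vimage[of Q T]) (auto simp: T)
    have cX2: "compact ?X2"
      unfolding X2 using T(1) compact_sign_space[OF nz(2)]
      by (intro compact_continuous_image) (auto simp: linear_continuous_on linear_linear)
    have "?Xm = Q ` ?X2" unfolding X2 by (simp add: image_image T)
    then have "emeasure lborel ?Xm = emeasure lborel ((\<lambda>x. x + t *\<^sub>R (A *v x)) ` ?X2)"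
      by (simp add: Q_def[abs_def])
    also have "\<dots> = ennreal d * emeasure lborel ?X2"
      by (intro t(3) borel_compact cX2 emeasure_compact_finite)
    finally have vol: "emeasure lborel (thicken s um ?Xm) = ennreal d * emeasure lborel (thicken s um ?X2)"
      by (simp add: thick)
    have QC: "cone_fun um (Q y) \<le> 0" if "y \<in> ?Y" for y
      using t(4)[OF that] by (simp add: Q_def Av)
    have Lul: "L *v ul = um" using L(1) Plus by (simp add: sign_maps_iff)
    \<comment> \<open>Since \<open>Q\<close> and \<open>L\<close> preserve the unit, the second
      inequality of the effect space for x is the first one for ul - x, which is in \<open>X\<close>
      by symmetry.\<close>
    have QX: "Q (L *v x) \<in> ?Xm" if x: "x \<in> X" for x
    proof -
      have "um - Q (L *v x) = Q (L *v (ul - x))"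
        by (simp add: linear_diff[OF linQ] matrix_vector_mult_diff_distrib Lul Qum)
      moreover have "ul - x \<in> X" using X(2) Plus x by (simp add: half_unit_symmetric_def)
      ultimately show ?thesis
        using QC x Plus by (simp add: sign_space_def effect_space_def)
    qed
    show False
      by (rule not_complete_if_contracting[OF nz M L N complete linQ injQ _ QX t(1) vol]) (simp add: Plus Qum)
  qed
qed

theorem theorem3:
  fixes s :: sign
    and ul :: "real^'l" and un :: "real^'n" and um :: "real^'m"
    and M :: "real^'l^'n" and X :: "(real^'l) set"
  assumes "ul \<noteq> 0" and "un \<noteq> 0" and "um \<noteq> 0"
    and "M \<in> sign_maps s ul un"
    and "CARD('m) = dim (supp M)"
    and "X \<subseteq> sign_space s ul"
    and "s = Plus \<Longrightarrow> half_unit_symmetric ul X"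
    and "closed (cone hull X)"
    and "obs_complete s ul un (sign_space s ul) M X"
  shows "\<forall>L :: real^'l^'m.
           L \<in> sign_maps s ul um \<and> pinv M ** M = pinv L ** L \<and>
           (*v) L ` sign_space s ul = sign_space s um \<longrightarrow>
           supports_design um 2 ((*v) L ` X)"
proof (intro allI impI, elim conjE)
  fix L :: "real^'l^'m"
  assume L: "L \<in> sign_maps s ul um" "pinv M ** M = pinv L ** L" "(*v) L ` sign_space s ul = sign_space s um"
  have ker: "M *v x = 0 \<longleftrightarrow> L *v x = 0" for x by (rule pinv_mult_eq_imp_kernel_eq[OF L(2)])
  obtain N where N: "linear N" "inj N" "\<And>x. N (L *v x) = M *v x" and surj: "surj ((*v) L)"
    by (rule support_factorization[OF ker assms(5)]) (rule that)
  show "supports_design um 2 ((*v) L ` X)"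
  proof (cases "2 \<le> CARD('m)")
    case True
    show ?thesis
      by (rule supports_design_if_complete[OF assms(1,3) True assms(4) L(1,3) surj N assms(6-9)])
  next
    case False
    moreover have "0 < CARD('m)" by simp
    ultimately have m: "CARD('m) = 1" by linarith
    \<comment> \<open>If the data were only 0, feasibility of the minimizer would confine the image
      of \<open>M\<close> to the span of 0; then \<open>L\<close> would vanish too, although it is
      onto.\<close>
    have "\<exists>x\<in>X. L *v x \<noteq> 0"
    proof (rule ccontr)
      assume "\<not> (\<exists>x\<in>X. L *v x \<noteq> 0)"
      then have 0: "(*v) M ` X \<subseteq> {0}" using ker by auto
      obtain K where K: "(*v) K ` sign_space s ul = (*v) M ` sign_space s ul"
        "K \<in> feasible_maps s ul un ((*v) M ` X) (sign_space s ul)"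
        using assms(9) by (auto simp: obs_complete_def ddi_def is_arg_min_def set_eq_iff) metis
      have "(*v) M ` sign_space s ul \<subseteq> span ((*v) M ` X)"
        using K by (auto simp: feasible_maps_def)
      also have "\<dots> \<subseteq> {0}" using span_mono[OF 0] by simp
      finally have "span ((*v) M ` sign_space s ul) \<subseteq> {0}" by (metis span_mono span_0 span_empty span_insert_0)
      then have "M *v x = 0" for x
        using span_sign_space[OF assms(1), of s] by (auto simp: linear_span_image)
      then have "L *v x = 0" for x using ker by simp
      then show False using surj assms(3) by (metis surjD)
    qed
    then obtain x where x: "x \<in> X" "L *v x \<noteq> 0" by auto
    have "cone_fun ul x \<le> 0" using x(1) assms(6) sign_space_cone by blast
    then have "cone_fun um (L *v x) \<le> 0" by (rule cone_image_if_sign_map[OF assms(1,3) L(1,3)])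
    then have "0 < um \<bullet> (L *v x)" by (rule cone_fun_le_0_imp_inner_pos[OF _ assms(3) x(2)])
    then show ?thesis using x(1) by (intro supports_design_dim_1[OF m assms(3), of "L *v x"]) auto
  qed
qed

end
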